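(* For each $j=1,\dots,r$ one has $\rho(\beta_j)=i\epsilon'_j$. The set $\rho(\Delta^+_{\mathfrak m})$ is a subset of the set $$\left\{\tfrac i2\epsilon'_j,\ i\epsilon'_j,\ 1\le j\le r;\quad \tfrac i2(\epsilon'_p+\epsilon'_k),\ 1\le p<k\le r\right\}.$$ For each $\lambda\in\Sigma^+$, $$\mathfrak m_\lambda+I\mathfrak m_\lambda=\sum_{\alpha\in\Delta^+_{\mathfrak m},\ \rho(\alpha)=\rho_{\mathfrak m}(\lambda)}(\mathbb RX_\alpha\oplus\mathbb RY_\alpha).$$ In particular, for every $T\in\mathfrak t'$ the operator $I\operatorname{ad}_T$ acts on the space $\mathfrak m_\lambda+I\mathfrak m_\lambda$ as multiplication by $i\rho_{\mathfrak m}(\lambda)(T)$.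
   Context: $G/K$ is an irreducible Hermitian symmetric space of compact type: $\mathfrak g=\mathrm{Lie}(G)$ is a simple compact Lie algebra, $K$ is connected, $\mathfrak g=\mathfrak k\oplus\mathfrak m$ with $[\mathfrak k,\mathfrak m]\subset\mathfrak m$, $[\mathfrak m,\mathfrak m]\subset\mathfrak k$. $\mathfrak k$ is the centralizer of its one-dimensional center $\mathfrak z$. Let $\mathfrak t\subset\mathfrak k$ be a Cartan subalgebra of $\mathfrak k$ (hence of $\mathfrak g$), $\Delta$ the root system of $(\mathfrak g^{\mathbb C},\mathfrak t^{\mathbb C})$ with root spaces $\tilde{\mathfrak g}^\alpha$, $\Delta_{\mathfrak k}$ the roots vanishing on $\mathfrak z$, $\Delta_{\mathfrak m}=\Delta\setminus\Delta_{\mathfrak k}$. There is a system of simple roots $\alpha_1,\dots,\alpha_l$ such that the coefficient $n_1^\alpha$ of $\alpha_1$ in each $\alpha\in\Delta$ lies in $\{0,1,-1\}$ and $\Delta_{\mathfrak k}=\{\alpha:n_1^\alpha=0\}$; $\Delta^+$ is the corresponding set of positive roots and $\Delta_{\mathfrak m}^+=\Delta_{\mathfrak m}\cap\Delta^+$. For $\alpha\in\Delta^+$ choose $H_\alpha\in i\mathfrak t$, $E_{\pm\alpha}\in\tilde{\mathfrak g}^{\pm\alpha}$ with $[H_\alpha,E_{\pm\alpha}]=\pm2E_{\pm\alpha}$, $[E_\alpha,E_{-\alpha}]=-H_\alpha$, such that $X_\alpha=\frac12(E_\alpha+E_{-\alpha})$, $Y_\alpha=\frac i2(E_\alpha-E_{-\alpha})$,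 $T_\alpha=\frac i2H_\alpha$ lie in $\mathfrak g$; then $\mathfrak m=\sum_{\alpha\in\Delta_{\mathfrak m}^+}(\mathbb RX_\alpha\oplus\mathbb RY_\alpha)$. $Z_0\in\mathfrak z$ is the element with $\alpha_1(Z_0)=i$ and $I=\operatorname{ad}_{Z_0}|_{\mathfrak m}$, so $I^2=-\mathrm{Id}$, $IX_\alpha=Y_\alpha$, $IY_\alpha=-X_\alpha$ for $\alpha\in\Delta_{\mathfrak m}^+$. Let $\beta_1,\dots,\beta_r\in\Delta_{\mathfrak m}^+$, $r=\operatorname{rank}(G/K)$, be strongly orthogonal roots ($\beta_j\pm\beta_k\notin\Delta\cup\{0\}$ for $j\neq k$), and put $X_j=X_{\beta_j}$, $Y_j=Y_{\beta_j}$, $T_j=T_{\beta_j}$. Then $\mathfrak a=\sum_j\mathbb RX_j$ is a maximal abelian subspace of $\mathfrak m$, and $[X_j,Y_k]=\delta_j^kT_j$, $[T_j,X_k]=\delta_j^kY_j$, $[T_j,Y_k]=-\delta_j^kX_j$. $\{\epsilon_j\}$ is the basis of $(\mathfrak a^{\mathbb C})^*$ dual to $\{X_j\}$. $\Sigma$ is the set of restricted roots of $(\mathfrak g^{\mathbb C},\mathfrak a^{\mathbb C})$, $\Sigma^+$ the positive ones for the lexicographic order with respect to the basis $\{-iX_j\}$ of $i\mathfrak a$; $\Sigma^+\subset(BC)_r^+:=\{\frac i2\epsilon_j,i\epsilon_j;\ \frac i2(\epsilon_p\pm\epsilon_k),p<k\}$. $\mathfrak m_\lambda=\{\eta\in\mathfrak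 m:\operatorname{ad}_w^2\eta=\lambda^2(w)\eta\ \forall w\in\mathfrak a\}$. $\mathfrak t'\subset\mathfrak t$ is the span of $T_1,\dots,T_r$, $\{\epsilon'_j\}$ the basis of $(\mathfrak t'^{\mathbb C})^*$ dual to $\{T_j\}$, and $\rho:(\mathfrak t^{\mathbb C})^*\to(\mathfrak t'^{\mathbb C})^*$ the restriction map. $\rho_{\mathfrak m}:(BC)_r^+\to(\mathfrak t'^{\mathbb C})^*$ is defined by $\frac i2\epsilon_j\mapsto\frac i2\epsilon'_j$, $i\epsilon_j\mapsto i\epsilon'_j$, $\frac i2(\epsilon_p\pm\epsilon_k)\mapsto\frac i2(\epsilon'_p+\epsilon'_k)$. *)

theory Defs
  imports "HOL-Analysis.Analysis" "HOL-Library.Function_Algebras"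
begin

section \<open>Finite-dimensional real Lie algebras\<close>

text \<open>
  The class \<open>euclidean_space\<close> is used only as the class of finite-dimensional real vector spaces;
  its inner product is auxiliary (it serves to write down traces) and is not assumed to be
  compatible with the bracket.
\<close>

class lie_algebra = euclidean_space +
  fixes lie_bracket :: "'a \<Rightarrow> 'a \<Rightarrow> 'a"  ("[_,_]\<^sub>L")
  assumes lie_bracket_add_left: "[x + y,z]\<^sub>L = [x,z]\<^sub>L + [y,z]\<^sub>L"
    and lie_bracket_add_right: "[x,y + z]\<^sub>L = [x,y]\<^sub>L + [x,z]\<^sub>L"
    and lie_bracket_scale_left: "[c *\<^sub>R x,y]\<^sub>L = c *\<^sub>R [x,y]\<^sub>L"
    and lie_bracket_scale_right: "[x,c *\<^sub>R y]\<^sub>L = c *\<^sub>R [x,y]\<^sub>L"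
    and lie_bracket_self: "[x,x]\<^sub>L = 0"
    and jacobi: "[x,[y,z]\<^sub>L]\<^sub>L + [y,[z,x]\<^sub>L]\<^sub>L + [z,[x,y]\<^sub>L]\<^sub>L = 0"

text \<open>The trace of \<open>ad x \<circ> ad y\<close>.\<close>

definition killing_form :: "'g::lie_algebra \<Rightarrow> 'g \<Rightarrow> real" where
  "killing_form x y = (\<Sum>b\<in>Basis. [x,[y,b]\<^sub>L]\<^sub>L \<bullet> b)"

definition lie_ideal :: "'g::lie_algebra set \<Rightarrow> bool" where
  "lie_ideal J \<longleftrightarrow> subspace J \<and> (\<forall>x. \<forall>y\<in>J. [x,y]\<^sub>L \<in> J)"

definition compact_simple_lie_algebra :: "'g::lie_algebra itself \<Rightarrow> bool" where
  "compact_simple_lie_algebra _ \<longleftrightarrow>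
     (\<forall>x::'g. x \<noteq> 0 \<longrightarrow> killing_form x x < 0) \<and>
     (\<exists>x y::'g. [x,y]\<^sub>L \<noteq> 0) \<and>
     (\<forall>J::'g set. lie_ideal J \<longrightarrow> J = {0} \<or> J = UNIV)"

definition lie_subalgebra :: "'g::lie_algebra set \<Rightarrow> bool" where
  "lie_subalgebra h \<longleftrightarrow> subspace h \<and> (\<forall>x\<in>h. \<forall>y\<in>h. [x,y]\<^sub>L \<in> h)"

definition lie_center :: "'g::lie_algebra set \<Rightarrow> 'g set" where
  "lie_center h = {z\<in>h. \<forall>x\<in>h. [z,x]\<^sub>L = 0}"

definition lie_centralizer :: "'g::lie_algebra set \<Rightarrow> 'g set" where
  "lie_centralizer S = {x. \<forall>z\<in>S. [x,z]\<^sub>L = 0}"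

primrec lower_central_series :: "'g::lie_algebra set \<Rightarrow> nat \<Rightarrow> 'g set" where
  "lower_central_series h 0 = h"
| "lower_central_series h (Suc n) = span {[x,y]\<^sub>L | x y. x \<in> h \<and> y \<in> lower_central_series h n}"

definition nilpotent_lie_subalgebra :: "'g::lie_algebra set \<Rightarrow> bool" where
  "nilpotent_lie_subalgebra h \<longleftrightarrow> lie_subalgebra h \<and> (\<exists>n. lower_central_series h n = {0})"

text \<open>\<open>t\<close> is a Cartan subalgebra of \<open>h\<close>: nilpotent and equal to its normalizer in \<open>h\<close>.\<close>

definition cartan_subalgebra :: "'g::lie_algebra set \<Rightarrow> 'g set \<Rightarrow> bool" where
  "cartan_subalgebra h t \<longleftrightarrow>
     t \<subseteq> h \<and> nilpotent_lie_subalgebra t \<and> {x\<in>h. \<forall>y\<in>t. [x,y]\<^sub>L \<in> t} = t"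

section \<open>Hermitian symmetric decompositions\<close>

definition hermitian_symmetric_decomposition :: "'g::lie_algebra set \<Rightarrow> 'g set \<Rightarrow> bool" where
  "hermitian_symmetric_decomposition k m \<longleftrightarrow>
     lie_subalgebra k \<and> subspace m \<and> k \<inter> m = {0} \<and> {x + y | x y. x \<in> k \<and> y \<in> m} = UNIV \<and>
     (\<forall>x\<in>k. \<forall>y\<in>m. [x,y]\<^sub>L \<in> m) \<and> (\<forall>x\<in>m. \<forall>y\<in>m. [x,y]\<^sub>L \<in> k) \<and>
     dim (lie_center k) = 1 \<and> lie_centralizer (lie_center k) = k"

text \<open>The rank of the symmetric space with tangent space \<open>m\<close>.\<close>

definition symmetric_rank :: "'g::lie_algebra set \<Rightarrow> nat" where
  "symmetric_rank m =
     Max {dim a | a. subspace a \<and> a \<subseteq> m \<and> (\<forall>x\<in>a. \<forall>y\<in>a. [x,y]\<^sub>L = 0)}"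

section \<open>Complexification\<close>

text \<open>
  The pair \<open>(x, y)\<close> stands for \<open>x + iy\<close> in the complexification of \<open>'g\<close>; the complexification of
  a real subspace \<open>V\<close> is then \<open>V \<times> V\<close>.
\<close>

definition cplx_scale :: "complex \<Rightarrow> 'g::real_vector \<times> 'g \<Rightarrow> 'g \<times> 'g"  (infixr "*\<^sub>C" 75) where
  "c *\<^sub>C v = (Re c *\<^sub>R fst v - Im c *\<^sub>R snd v, Re c *\<^sub>R snd v + Im c *\<^sub>R fst v)"

definition cplx_bracket :: "'g::lie_algebra \<times> 'g \<Rightarrow> 'g \<times> 'g \<Rightarrow> 'g \<times> 'g"  ("[_,_]\<^sub>C") where
  "[v,w]\<^sub>C = ([fst v, fst w]\<^sub>L - [snd v, snd w]\<^sub>L, [fst v, snd w]\<^sub>L + [snd v, fst w]\<^sub>L)"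

definition cplx_of :: "'g::real_vector \<Rightarrow> 'g \<times> 'g" where
  "cplx_of x = (x, 0)"

type_synonym 'g functional = "'g \<times> 'g \<Rightarrow> complex"

definition fun_scale :: "complex \<Rightarrow> 'g functional \<Rightarrow> 'g functional"  (infixr "*\<^sub>F" 75) where
  "c *\<^sub>F f = (\<lambda>h. c * f h)"

text \<open>
  The complex dual of the complexification of \<open>V\<close>. A functional on \<open>V \<times> V\<close> is represented by its
  extension by zero (as a function), so that functionals on \<open>V \<times> V\<close> are equal iff they agree
  on \<open>V \<times> V\<close>.
\<close>

definition cplx_dual :: "'g::real_vector set \<Rightarrow> 'g functional set" where
  "cplx_dual V = {f. (\<forall>u\<in>V \<times> V. \<forall>v\<in>V \<times> V. f (u + v) = f u + f v) \<and>
                     (\<forall>c. \<forall>u\<in>V \<times> V. f (c *\<^sub>C u) = c * f u) \<and>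
                     (\<forall>u. u \<notin> V \<times> V \<longrightarrow> f u = 0)}"

definition restrict_functional :: "'g::real_vector set \<Rightarrow> 'g functional \<Rightarrow> 'g functional" where
  "restrict_functional V f = (\<lambda>h. if h \<in> V \<times> V then f h else 0)"

text \<open>The basis of \<open>cplx_dual V\<close> dual to the basis \<open>b 1, \<dots>, b n\<close> of \<open>V\<close>.\<close>

definition dual_basis :: "'g::real_vector set \<Rightarrow> nat \<Rightarrow> (nat \<Rightarrow> 'g) \<Rightarrow> nat \<Rightarrow> 'g functional" where
  "dual_basis V n b j =
     (THE f. f \<in> cplx_dual V \<and> (\<forall>k\<in>{1..n}. f (cplx_of (b k)) = (if k = j then 1 else 0)))"

section \<open>Roots\<close>

text \<open>Used both for a Cartan subalgebra and for a maximal abelian subspace of \<open>m\<close>.\<close>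

definition root_space :: "'g::lie_algebra set \<Rightarrow> 'g functional \<Rightarrow> ('g \<times> 'g) set" where
  "root_space V \<alpha> = {v. \<forall>h\<in>V \<times> V. [h,v]\<^sub>C = \<alpha> h *\<^sub>C v}"

definition roots :: "'g::lie_algebra set \<Rightarrow> 'g functional set" where
  "roots V = {\<alpha>\<in>cplx_dual V. \<alpha> \<noteq> 0 \<and> root_space V \<alpha> \<noteq> {0}}"

definition simple_root_system :: "'g::lie_algebra set \<Rightarrow> nat \<Rightarrow> (nat \<Rightarrow> 'g functional) \<Rightarrow> bool" where
  "simple_root_system t l a \<longleftrightarrow>
     (\<forall>j\<in>{1..l}. a j \<in> roots t) \<and>
     (\<forall>c :: nat \<Rightarrow> real. (\<Sum>j\<in>{1..l}. of_real (c j) *\<^sub>F a j) = 0 \<longrightarrow> (\<forall>j\<in>{1..l}. c j = 0)) \<and>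
     (\<forall>\<alpha>\<in>roots t. \<exists>n :: nat \<Rightarrow> int. \<alpha> = (\<Sum>j\<in>{1..l}. of_int (n j) *\<^sub>F a j) \<and>
        ((\<forall>j\<in>{1..l}. 0 \<le> n j) \<or> (\<forall>j\<in>{1..l}. n j \<le> 0)))"

text \<open>\<open>root_coeff l a \<alpha> j\<close> is the coefficient of the simple root \<open>a j\<close> in \<open>\<alpha>\<close>.\<close>

definition root_coeff :: "nat \<Rightarrow> (nat \<Rightarrow> 'g functional) \<Rightarrow> 'g functional \<Rightarrow> nat \<Rightarrow> int" where
  "root_coeff l a \<alpha> =
     (THE n. \<alpha> = (\<Sum>j\<in>{1..l}. of_int (n j) *\<^sub>F a j) \<and> (\<forall>j. j \<notin> {1..l} \<longrightarrow> n j = 0))"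

definition positive_roots ::
    "'g::lie_algebra set \<Rightarrow> nat \<Rightarrow> (nat \<Rightarrow> 'g functional) \<Rightarrow> 'g functional set" where
  "positive_roots t l a = {\<alpha>\<in>roots t. \<forall>j\<in>{1..l}. 0 \<le> root_coeff l a \<alpha> j}"

text \<open>The roots of \<open>k\<close>, i.e. those vanishing on the center of \<open>k\<close>, and the complementary ones.\<close>

definition roots_k :: "'g::lie_algebra set \<Rightarrow> 'g set \<Rightarrow> 'g functional set" where
  "roots_k k t = {\<alpha>\<in>roots t. \<forall>z\<in>lie_center k. \<alpha> (cplx_of z) = 0}"

definition roots_m :: "'g::lie_algebra set \<Rightarrow> 'g set \<Rightarrow> 'g functional set" where
  "roots_m k t = roots t - roots_k k t"

definition positive_roots_m ::
    "'g::lie_algebra set \<Rightarrow> 'g set \<Rightarrow> nat \<Rightarrow> (nat \<Rightarrow> 'g functional) \<Rightarrow> 'g functional set" where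
  "positive_roots_m k t l a = roots_m k t \<inter> positive_roots t l a"

definition hermitian_simple_roots ::
    "'g::lie_algebra set \<Rightarrow> 'g set \<Rightarrow> nat \<Rightarrow> (nat \<Rightarrow> 'g functional) \<Rightarrow> bool" where
  "hermitian_simple_roots k t l a \<longleftrightarrow>
     simple_root_system t l a \<and>
     (\<forall>\<alpha>\<in>roots t. root_coeff l a \<alpha> 1 \<in> {0, 1, -1}) \<and>
     roots_k k t = {\<alpha>\<in>roots t. root_coeff l a \<alpha> 1 = 0}"

definition strongly_orthogonal ::
    "'g::lie_algebra set \<Rightarrow> nat \<Rightarrow> (nat \<Rightarrow> 'g functional) \<Rightarrow> bool" where
  "strongly_orthogonal t r \<beta> \<longleftrightarrow>
     (\<forall>j\<in>{1..r}. \<forall>k\<in>{1..r}. j \<noteq> k \<longrightarrow>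
        \<beta> j + \<beta> k \<notin> roots t \<union> {0} \<and> \<beta> j - \<beta> k \<notin> roots t \<union> {0})"

section \<open>Root vectors\<close>

text \<open>
  \<open>E \<alpha> \<noteq> 0\<close> excludes \<open>H \<alpha> = E \<alpha> = E (-\<alpha>) = 0\<close>, which satisfies all the other conditions. It
  forces \<open>\<alpha> (H \<alpha>) = 2\<close>, hence also that \<open>H \<alpha>\<close> and \<open>E (-\<alpha>)\<close> are non-zero.
\<close>

definition root_vectors ::
    "'g::lie_algebra set \<Rightarrow> 'g functional set \<Rightarrow>
     ('g functional \<Rightarrow> 'g \<times> 'g) \<Rightarrow> ('g functional \<Rightarrow> 'g \<times> 'g) \<Rightarrow> bool" where
  "root_vectors t P H E \<longleftrightarrow>
     (\<forall>\<alpha>\<in>P.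
        H \<alpha> \<in> {\<i> *\<^sub>C cplx_of h | h. h \<in> t} \<and>
        E \<alpha> \<in> root_space t \<alpha> \<and> E (-\<alpha>) \<in> root_space t (-\<alpha>) \<and> E \<alpha> \<noteq> 0 \<and>
        [H \<alpha>, E \<alpha>]\<^sub>C = 2 *\<^sub>C E \<alpha> \<and> [H \<alpha>, E (-\<alpha>)]\<^sub>C = (-2) *\<^sub>C E (-\<alpha>) \<and>
        [E \<alpha>, E (-\<alpha>)]\<^sub>C = - H \<alpha> \<and>
        (1/2) *\<^sub>C (E \<alpha> + E (-\<alpha>)) \<in> range cplx_of \<and>
        (\<i>/2) *\<^sub>C (E \<alpha> - E (-\<alpha>)) \<in> range cplx_of \<and>
        (\<i>/2) *\<^sub>C H \<alpha> \<in> range cplx_of)"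

text \<open>
  Under \<open>root_vectors\<close> the elements of the complexification below are real; \<open>fst\<close> reads them as
  elements of the real Lie algebra itself.
\<close>

definition vec_X :: "('g::lie_algebra functional \<Rightarrow> 'g \<times> 'g) \<Rightarrow> 'g functional \<Rightarrow> 'g" where
  "vec_X E \<alpha> = fst ((1/2) *\<^sub>C (E \<alpha> + E (-\<alpha>)))"

definition vec_Y :: "('g::lie_algebra functional \<Rightarrow> 'g \<times> 'g) \<Rightarrow> 'g functional \<Rightarrow> 'g" where
  "vec_Y E \<alpha> = fst ((\<i>/2) *\<^sub>C (E \<alpha> - E (-\<alpha>)))"

definition vec_T :: "('g::lie_algebra functional \<Rightarrow> 'g \<times> 'g) \<Rightarrow> 'g functional \<Rightarrow> 'g" where
  "vec_T H \<alpha> = fst ((\<i>/2) *\<^sub>C H \<alpha>)"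

section \<open>Restricted roots\<close>

text \<open>
  Positivity with respect to the lexicographic order given by the ordered basis
  \<open>-i x 1, \<dots>, -i x r\<close> of \<open>i a\<close>, where \<open>a\<close> is the span of \<open>x 1, \<dots>, x r\<close>. Restricted roots are
  real-valued on \<open>i a\<close>, so \<open>Re\<close> only changes the type.
\<close>

definition lex_positive :: "nat \<Rightarrow> (nat \<Rightarrow> 'g::real_vector) \<Rightarrow> 'g functional \<Rightarrow> bool" where
  "lex_positive r x f \<longleftrightarrow>
     (\<exists>j\<in>{1..r}. Re (f ((-\<i>) *\<^sub>C cplx_of (x j))) > 0 \<and>
        (\<forall>k\<in>{1..<j}. f ((-\<i>) *\<^sub>C cplx_of (x k)) = 0))"

definition restricted_positive_roots ::
    "'g::lie_algebra set \<Rightarrow> nat \<Rightarrow> (nat \<Rightarrow> 'g) \<Rightarrow> 'g functional set" where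
  "restricted_positive_roots a r x = {f\<in>roots a. lex_positive r x f}"

definition m_space :: "'g::lie_algebra set \<Rightarrow> 'g set \<Rightarrow> 'g functional \<Rightarrow> 'g set" where
  "m_space m a f =
     {\<eta>\<in>m. \<forall>w\<in>a. cplx_of [w,[w,\<eta>]\<^sub>L]\<^sub>L = (f (cplx_of w))\<^sup>2 *\<^sub>C cplx_of \<eta>}"

text \<open>
  The map from \<open>{(i/2) \<epsilon>\<^sub>j, i \<epsilon>\<^sub>j, (i/2) (\<epsilon>\<^sub>p \<plusminus> \<epsilon>\<^sub>k)}\<close> given by its values on these pairwise distinct
  functionals (the arguments \<open>e\<close>, \<open>e'\<close> are the two dual bases); it is unspecified elsewhere.
\<close>

definition rho_m ::
    "nat \<Rightarrow> (nat \<Rightarrow> 'g functional) \<Rightarrow> (nat \<Rightarrow> 'g functional) \<Rightarrow> 'g functional \<Rightarrow> 'g functional" where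
  "rho_m r e e' f = (THE g.
     (\<exists>j\<in>{1..r}. f = (\<i>/2) *\<^sub>F e j \<and> g = (\<i>/2) *\<^sub>F e' j) \<or>
     (\<exists>j\<in>{1..r}. f = \<i> *\<^sub>F e j \<and> g = \<i> *\<^sub>F e' j) \<or>
     (\<exists>p k. 1 \<le> p \<and> p < k \<and> k \<le> r \<and>
        (f = (\<i>/2) *\<^sub>F (e p + e k) \<or> f = (\<i>/2) *\<^sub>F (e p - e k)) \<and>
        g = (\<i>/2) *\<^sub>F (e' p + e' k)))"

end

theory Submission
  imports Defs
begin

text \<open>
  Everything happens over the reals, with \<open>J = ad Z\<close> and minus the Killing form as inner product.
  The commuting symmetric operators \<open>J ad h\<close>, \<open>h \<in> t\<close>, diagonalize \<open>m\<close>, and their common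
  eigenspaces are the planes spanned by \<open>X\<^sub>\<alpha>\<close>, \<open>Y\<^sub>\<alpha>\<close>. Strong orthogonality makes \<open>X\<^sub>1, \<dots>, X\<^sub>r\<close> a
  frame of tripotents: \<open>T\<^sub>j = [X\<^sub>j, J X\<^sub>j]\<close>, \<open>[T\<^sub>j, X\<^sub>j] = J X\<^sub>j\<close>, and all mixed brackets vanish. For a
  single tripotent \<open>x\<close> the Peirce decomposition gives the eigenvalues \<open>0, 1/2, 1\<close> of
  \<open>- J ad [x, J x]\<close> together with the action of \<open>(ad x)\<^sup>2\<close> on each eigenspace. Since the sum of the
  frame is a tripotent as well, the joint eigenvalues \<open>a\<^sub>1, \<dots>, a\<^sub>r\<close> on \<open>m\<close> have sum at most \<open>1\<close>, and they
  do not all vanish because \<open>\<aa>\<close> is maximal abelian. This yields the three types of \<open>\<rho>(\<alpha>)\<close>. On a joint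
  eigenspace the operators \<open>ad X\<^sub>p ad X\<^sub>q\<close> are then explicit, so \<open>m\<^sub>\<lambda>\<close> with
  \<open>\<lambda> = i (l\<^sub>1 \<epsilon>\<^sub>1 + \<dots> + l\<^sub>r \<epsilon>\<^sub>r)\<close> lies in the one with \<open>a\<^sub>j = \<bar>l\<^sub>j\<bar>\<close>, which \<open>m\<^sub>\<lambda> + J m\<^sub>\<lambda>\<close> fills.
\<close>

section \<open>Commuting families of symmetric operators\<close>

text \<open>Working over the reals means recovering what complex structure theory would supply. That
  \<open>t\<close> is abelian, that \<open>J\<close> squares to -1 on \<open>m\<close> and that a
  root contributes only one plane to \<open>m\<close> are not hypotheses; all three are derived from
  the skewness of \<open>ad\<close> for a definite form. The eigenvalues 0, 1/2, 1 have an
  elementary origin. For a tripotent \<open>x\<close> and an eigenvector \<open>v\<close> with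
  eigenvalue \<open>a\<close>, the vector \<open>2 (ad x)^2 v + a v\<close> has eigenvalue
  \<open>2 - a\<close> or is zero. The relations that hold for \<open>v\<close> must hold for this
  vector too, and their comparison leaves the factor \<open>3 (1 - a) (1 - 2 a)\<close>. The
  restricted spaces are cut out by the products \<open>ad X_p ad X_q\<close>, and these do not
  commute with \<open>J\<close>. On a weight space of type \<open>i \<epsilon>'_j\<close> the
  operator \<open>(ad X_j)^2\<close> has the eigenvalues 0 and -1; on one of type
  \<open>(i/2)(\<epsilon>'_p + \<epsilon>'_q)\<close> the operator \<open>ad X_p ad X_q\<close> has
  the eigenvalues 1/4 and -1/4. In both cases \<open>J\<close> swaps the two eigenspaces. So a
  restricted space alone is only half of such a weight space, its image under \<open>J\<close> is
  the other half, and the signs in \<open>\<epsilon>_p + \<epsilon>_q\<close> and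
  \<open>\<epsilon>_p - \<epsilon>_q\<close> are forgotten.\<close>

locale inner_form =
  fixes B :: "'a::euclidean_space \<Rightarrow> 'a \<Rightarrow> real"
  assumes bilinear_B: "bilinear B"
    and B_sym: "B x y = B y x"
    and B_pos: "x \<noteq> 0 \<Longrightarrow> B x x > 0"
begin

lemma B_linear_simps [simp]:
  "B (x + y) z = B x z + B y z" "B x (y + z) = B x y + B x z"
  "B (x - y) z = B x z - B y z" "B x (y - z) = B x y - B x z"
  "B (c *\<^sub>R x) z = c * B x z" "B x (c *\<^sub>R z) = c * B x z"
  "B (- x) z = - B x z" "B x (- z) = - B x z"
  "B 0 z = 0" "B x 0 = 0"
  using bilinear_ladd[OF bilinear_B] bilinear_radd[OF bilinear_B]
    bilinear_lsub[OF bilinear_B] bilinear_rsub[OF bilinear_B]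
    bilinear_lmul[OF bilinear_B] bilinear_rmul[OF bilinear_B]
    bilinear_lneg[OF bilinear_B] bilinear_rneg[OF bilinear_B]
    bilinear_lzero[OF bilinear_B] bilinear_rzero[OF bilinear_B]
  by auto

lemma B_nonneg: "0 \<le> B x x"
  using B_pos[of x] by (cases "x = 0") auto

lemma B_eq_0_iff: "B x x = 0 \<longleftrightarrow> x = 0"
  using B_pos[of x] by (cases "x = 0") auto

text \<open>The Rayleigh quotient of \<open>A\<close> attains a maximum \<open>c\<close> on the unit
  sphere of \<open>V\<close>; the norm of the type serves only for compactness. Then
  \<open>c B(x,y) - B(A x,y)\<close> is positive semidefinite on \<open>V\<close> and vanishes at
  the maximizer, which therefore lies in its radical.\<close>

lemma symmetric_eigenvector:
  assumes V: "subspace V" "V \<noteq> {0}" and A: "linear A" "\<And>x. x \<in> V \<Longrightarrow> A x \<in> V"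
    and sym: "\<And>x y. x \<in> V \<Longrightarrow> y \<in> V \<Longrightarrow> B (A x) y = B x (A y)"
  shows "\<exists>v\<in>V. v \<noteq> 0 \<and> (\<exists>c. A v = c *\<^sub>R v)"
proof -
  define S where "S = V \<inter> sphere 0 1"
  have bb: "bounded_bilinear B" using bilinear_B bilinear_conv_bounded_bilinear by blast
  obtain x0 where x0: "x0 \<in> V" "x0 \<noteq> 0" using V subspace_0 by fastforce
  have scal: "inverse (norm x) *\<^sub>R x \<in> S" if "x \<in> V" "x \<noteq> 0" for x
    using that V(1) by (simp add: S_def subspace_scale)
  have "compact S" unfolding S_def
    using closed_subspace[OF V(1)] compact_sphere by (simp add: closed_Int_compact)
  moreover have "S \<noteq> {}" using scal[OF x0] by blast
  moreover have "continuous_on S (\<lambda>x. B (A x) x / B x x)"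
  proof (rule continuous_on_divide)
    have "continuous_on S A" by (rule linear_continuous_on) (use A(1) linear_conv_bounded_linear in blast)
    then show "continuous_on S (\<lambda>x. B (A x) x)"
      by (rule bounded_bilinear.continuous_on[OF bb _ continuous_on_id])
    show "continuous_on S (\<lambda>x. B x x)"
      by (rule bounded_bilinear.continuous_on[OF bb continuous_on_id continuous_on_id])
    show "\<forall>x\<in>S. B x x \<noteq> 0" by (auto simp: S_def B_eq_0_iff)
  qed
  ultimately obtain v where v: "v \<in> S" and
    max: "\<And>x. x \<in> S \<Longrightarrow> B (A x) x / B x x \<le> B (A v) v / B v v"
    using continuous_attains_sup[of S "\<lambda>x. B (A x) x / B x x"] by blast
  define c where "c = B (A v) v / B v v"
  have vV: "v \<in> V" "v \<noteq> 0" using v by (auto simp: S_def)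
  define G where "G x y = c * B x y - B (A x) y" for x y
  have lin: "A (x + y) = A x + A y" "A (s *\<^sub>R x) = s *\<^sub>R A x" for x y s
    using A(1) by (auto simp: linear_add linear_scale)
  have Gpos: "G x x \<ge> 0" if "x \<in> V" for x
  proof (cases "x = 0")
    case True then show ?thesis using A(1) by (simp add: G_def linear_0)
  next
    case False
    let ?s = "inverse (norm x)"
    have "B (A (?s *\<^sub>R x)) (?s *\<^sub>R x) / B (?s *\<^sub>R x) (?s *\<^sub>R x) = B (A x) x / B x x"
      using False by (simp add: lin)
    then have "B (A x) x / B x x \<le> c" using max[OF scal[OF that False]] by (simp add: c_def)
    then show ?thesis using B_pos[OF False] by (simp add: G_def pos_divide_le_eq)
  qed
  have Gv: "G v v = 0" using vV by (simp add: G_def c_def B_eq_0_iff)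
  have G0: "G v y = 0" if y: "y \<in> V" for y
  proof (rule ccontr)
    assume n: "G v y \<noteq> 0"
    define q where "q = G y y"
    \<comment> \<open>A small step against the sign of \<open>G v y\<close> would make the
      semidefinite form negative. The denominator \<open>q + 1\<close> also covers
      \<open>q = 0\<close>.\<close>
    define s where "s = - G v y / (q + 1)"
    have q: "q \<ge> 0" using Gpos[OF y] by (simp add: q_def)
    have "v + s *\<^sub>R y \<in> V" using V(1) vV y by (simp add: subspace_add subspace_scale)
    from Gpos[OF this] have "0 \<le> G (v + s *\<^sub>R y) (v + s *\<^sub>R y)" .
    also have "\<dots> = G v v + s * (G v y + G y v) + s\<^sup>2 * G y y"
      unfolding G_def lin B_linear_simps by (simp add: algebra_simps power2_eq_square)
    also have "G y v = G v y"
      using sym[OF vV(1) y] unfolding G_def by (simp only: B_sym[of y v] B_sym[of "A y" v])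
    also have "G v v + s * (G v y + G v y) + s\<^sup>2 * G y y = 2 * s * G v y + s\<^sup>2 * q"
      by (simp add: Gv q_def)
    also have "\<dots> = (G v y)\<^sup>2 * (- 2 * (q + 1) + q) / (q + 1)\<^sup>2"
    proof -
      have "2 * (- g / (q + 1)) * g + (- g / (q + 1))\<^sup>2 * q = g\<^sup>2 * (- 2 * (q + 1) + q) / (q + 1)\<^sup>2" for g
        using q by (simp add: divide_simps) (simp add: algebra_simps power2_eq_square)
      then show ?thesis unfolding s_def .
    qed
    also have "\<dots> < 0" using n q by (intro divide_neg_pos mult_pos_neg) auto
    finally show False by simp
  qed
  let ?y = "c *\<^sub>R v - A v"
  have "?y \<in> V" using V(1) vV A(2) by (simp add: subspace_diff subspace_scale)
  moreover have "B ?y z = G v z" for z by (simp add: G_def)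
  ultimately have "B ?y ?y = 0" using G0 by metis
  then have "?y = 0" by (rule B_eq_0_iff[THEN iffD1])
  then have "A v = c *\<^sub>R v" by simp
  with vV show ?thesis by blast
qed

text \<open>An operator of \<open>F\<close> that is not scalar on \<open>V\<close> has a proper
  nonzero eigenspace, and the others preserve it because they commute with it. Descending in
  dimension handles infinite \<open>F\<close> as well.\<close>

lemma common_eigenvector:
  assumes "subspace V" "V \<noteq> {0}"
    and "\<And>A. A \<in> F \<Longrightarrow> linear A" "\<And>A x. A \<in> F \<Longrightarrow> x \<in> V \<Longrightarrow> A x \<in> V"
    and "\<And>A x y. A \<in> F \<Longrightarrow> x \<in> V \<Longrightarrow> y \<in> V \<Longrightarrow> B (A x) y = B x (A y)"
    and "\<And>A C x. A \<in> F \<Longrightarrow> C \<in> F \<Longrightarrow> x \<in> V \<Longrightarrow> A (C x) = C (A x)"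
  shows "\<exists>v\<in>V. v \<noteq> 0 \<and> (\<forall>A\<in>F. \<exists>c. A v = c *\<^sub>R v)"
  using assms
proof (induction "dim V" arbitrary: V rule: less_induct)
  case less
  note V = less.prems
  show ?case
  proof (cases "\<forall>A\<in>F. \<exists>c. \<forall>x\<in>V. A x = c *\<^sub>R x")
    case True
    moreover obtain x where "x \<in> V" "x \<noteq> 0" using V(1,2) subspace_0 by fastforce
    ultimately show ?thesis by metis
  next
    case False
    then obtain A where A: "A \<in> F" and nA: "\<And>c. \<exists>x\<in>V. A x \<noteq> c *\<^sub>R x" by blast
    obtain v c where v: "v \<in> V" "v \<noteq> 0" "A v = c *\<^sub>R v"
      using symmetric_eigenvector[OF V(1,2) V(3,4,5)[OF A]] by blast
    define W where "W = {x\<in>V. A x = c *\<^sub>R x}"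
    have lin: "linear A" using V(3) A by blast
    have W: "subspace W" "W \<subseteq> V"
      using V(1) lin unfolding W_def subspace_def
      by (auto simp: linear_0 linear_add linear_scale algebra_simps)
    have "W \<noteq> V" using nA[of c] by (auto simp: W_def)
    have dim: "dim W < dim V"
      using dim_subset[OF W(2)] subspace_dim_equal[OF W(1) V(1) W(2)] \<open>W \<noteq> V\<close> by linarith
    have "\<exists>v\<in>W. v \<noteq> 0 \<and> (\<forall>A\<in>F. \<exists>c. A v = c *\<^sub>R v)"
    proof (rule less.hyps[OF dim W(1)])
      show "W \<noteq> {0}" using v by (auto simp: W_def)
      show "linear C" if "C \<in> F" for C using V(3) that .
      show "C x \<in> W" if C: "C \<in> F" and x: "x \<in> W" for C x
      proof -
        have "A (C x) = C (A x)" using V(6)[OF A C] x W by auto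
        also have "\<dots> = c *\<^sub>R C x" using x V(3)[OF C] by (simp add: W_def linear_scale)
        finally show ?thesis using V(4)[OF C] x by (auto simp: W_def)
      qed
      show "B (C x) y = B x (C y)" if "C \<in> F" "x \<in> W" "y \<in> W" for C x y
        using V(5)[OF that(1)] that W by blast
      show "C (D x) = D (C x)" if "C \<in> F" "D \<in> F" "x \<in> W" for C D x
        using V(6)[OF that(1,2)] that W by blast
    qed
    then show ?thesis using W by blast
  qed
qed

text \<open>By symmetry the orthogonal complement of a common eigenvector is invariant, so one line
  at a time is split off.\<close>

theorem simultaneous_diagonalization:
  assumes "subspace V"
    and "\<And>A. A \<in> F \<Longrightarrow> linear A" "\<And>A x. A \<in> F \<Longrightarrow> x \<in> V \<Longrightarrow> A x \<in> V"
    and "\<And>A x y. A \<in> F \<Longrightarrow> x \<in> V \<Longrightarrow> y \<in> V \<Longrightarrow> B (A x) y = B x (A y)"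
    and "\<And>A C x. A \<in> F \<Longrightarrow> C \<in> F \<Longrightarrow> x \<in> V \<Longrightarrow> A (C x) = C (A x)"
  shows "V \<subseteq> span {v\<in>V. v \<noteq> 0 \<and> (\<forall>A\<in>F. \<exists>c. A v = c *\<^sub>R v)}"
  using assms
proof (induction "dim V" arbitrary: V rule: less_induct)
  case less
  note V = less.prems
  let ?E = "\<lambda>V. {v\<in>V. v \<noteq> 0 \<and> (\<forall>A\<in>F. \<exists>c. A v = c *\<^sub>R v)}"
  show ?case
  proof (cases "V = {0}")
    case True then show ?thesis by (simp add: span_0)
  next
    case False
    obtain v where v: "v \<in> V" "v \<noteq> 0" "\<forall>A\<in>F. \<exists>c. A v = c *\<^sub>R v"
      using common_eigenvector[OF V(1) False, of F] V by blast
    define W where "W = {x\<in>V. B x v = 0}"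
    have W: "subspace W" "W \<subseteq> V" using V(1) unfolding W_def subspace_def by auto
    have "v \<notin> W" using v by (simp add: W_def B_eq_0_iff)
    then have dim: "dim W < dim V"
      using dim_subset[OF W(2)] subspace_dim_equal[OF W(1) V(1) W(2)] v(1) by fastforce
    have "W \<subseteq> span (?E W)"
    proof (rule less.hyps[OF dim W(1)])
      show "C x \<in> W" if C: "C \<in> F" and x: "x \<in> W" for C x
      proof -
        obtain c where "C v = c *\<^sub>R v" using v(3) C by blast
        then have "B (C x) v = 0" using V(4)[OF C _ v(1), of x] x by (auto simp: W_def)
        then show ?thesis using V(3)[OF C] x by (auto simp: W_def)
      qed
      show "linear C" if "C \<in> F" for C using V(2) that .
      show "B (C x) y = B x (C y)" if "C \<in> F" "x \<in> W" "y \<in> W" for C x y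
        using V(4)[OF that(1)] that W by blast
      show "C (D x) = D (C x)" if "C \<in> F" "D \<in> F" "x \<in> W" for C D x
        using V(5)[OF that(1,2)] that W by blast
    qed
    also have "\<dots> \<subseteq> span (?E V)" using W by (intro span_mono) auto
    finally have WE: "W \<subseteq> span (?E V)" .
    show ?thesis
    proof
      fix x assume x: "x \<in> V"
      let ?c = "B x v / B v v"
      have "x - ?c *\<^sub>R v \<in> W"
        using x v V(1) by (auto simp: W_def B_eq_0_iff subspace_diff subspace_scale)
      then have "x - ?c *\<^sub>R v \<in> span (?E V)" using WE by blast
      moreover have "?c *\<^sub>R v \<in> span (?E V)" using v by (intro span_scale span_base) auto
      ultimately have "(x - ?c *\<^sub>R v) + ?c *\<^sub>R v \<in> span (?E V)" by (rule span_add)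
      then show "x \<in> span (?E V)" by simp
    qed
  qed
qed

end

section \<open>The Killing form\<close>

lemma lie_bracket_simps [simp]:
  fixes x y z :: "'g::lie_algebra"
  shows "[x + y,z]\<^sub>L = [x,z]\<^sub>L + [y,z]\<^sub>L" "[x,y + z]\<^sub>L = [x,y]\<^sub>L + [x,z]\<^sub>L"
    "[c *\<^sub>R x,y]\<^sub>L = c *\<^sub>R [x,y]\<^sub>L" "[x,c *\<^sub>R y]\<^sub>L = c *\<^sub>R [x,y]\<^sub>L"
    "[x,x]\<^sub>L = 0" "[0,x]\<^sub>L = 0" "[x,0]\<^sub>L = 0"
    "[- x,y]\<^sub>L = - [x,y]\<^sub>L" "[x,- y]\<^sub>L = - [x,y]\<^sub>L"
    "[x - y,z]\<^sub>L = [x,z]\<^sub>L - [y,z]\<^sub>L" "[x,y - z]\<^sub>L = [x,y]\<^sub>L - [x,z]\<^sub>L"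
proof -
  show a: "[x + y,z]\<^sub>L = [x,z]\<^sub>L + [y,z]\<^sub>L" "[x,y + z]\<^sub>L = [x,y]\<^sub>L + [x,z]\<^sub>L" for x y z :: 'g
    by (rule lie_bracket_add_left lie_bracket_add_right)+
  show s: "[c *\<^sub>R x,y]\<^sub>L = c *\<^sub>R [x,y]\<^sub>L" "[x,c *\<^sub>R y]\<^sub>L = c *\<^sub>R [x,y]\<^sub>L" for x y :: 'g and c
    by (rule lie_bracket_scale_left lie_bracket_scale_right)+
  show "[x,x]\<^sub>L = 0" by (rule lie_bracket_self)
  show "[0,x]\<^sub>L = 0" "[x,0]\<^sub>L = 0" using s(1)[of 0 0 x] s(2)[of x 0 0] by auto
  show n: "[- x,y]\<^sub>L = - [x,y]\<^sub>L" "[x,- y]\<^sub>L = - [x,y]\<^sub>L" for x y :: 'g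
    using s(1)[of "-1" x y] s(2)[of x "-1" y] by auto
  show "[x - y,z]\<^sub>L = [x,z]\<^sub>L - [y,z]\<^sub>L" "[x,y - z]\<^sub>L = [x,y]\<^sub>L - [x,z]\<^sub>L"
    using a(1)[of x "-y" z] a(2)[of x y "-z"] n by auto
qed

lemma lie_bracket_anticomm: "[x,y]\<^sub>L = - [y,x::'g::lie_algebra]\<^sub>L"
proof -
  have "[x + y,x + y]\<^sub>L = 0" by (rule lie_bracket_self)
  then have "[x,y]\<^sub>L + [y,x]\<^sub>L = 0"
    unfolding lie_bracket_add_left lie_bracket_add_right unfolding lie_bracket_self
    by (simp add: add.commute)
  then show ?thesis by (rule eq_neg_iff_add_eq_0[THEN iffD2])
qed

lemma bracket_bracket_right: "[x,[y,z]\<^sub>L]\<^sub>L = [[x,y]\<^sub>L,z]\<^sub>L + [y,[x,z::'g::lie_algebra]\<^sub>L]\<^sub>L"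
proof -
  have "[y,[z,x]\<^sub>L]\<^sub>L = - [y,[x,z]\<^sub>L]\<^sub>L" by (subst lie_bracket_anticomm[of z x]) simp
  moreover have "[z,[x,y]\<^sub>L]\<^sub>L = - [[x,y]\<^sub>L,z]\<^sub>L" by (rule lie_bracket_anticomm)
  ultimately show ?thesis using jacobi[of x y z] by (simp add: diff_eq_eq add.commute)
qed

lemma bracket_bracket_left: "[[x,y]\<^sub>L,z]\<^sub>L = [x,[y,z]\<^sub>L]\<^sub>L - [y,[x,z::'g::lie_algebra]\<^sub>L]\<^sub>L"
  using bracket_bracket_right[of x y z] by simp

lemma linear_lie_bracket: "linear (\<lambda>y. [x,y::'g::lie_algebra]\<^sub>L)"
  by (rule linearI) auto

lemma linear_lie_bracket_left: "linear (\<lambda>x. [x,y::'g::lie_algebra]\<^sub>L)"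
  by (rule linearI) auto

lemma trace_commute:
  fixes A C :: "'a::euclidean_space \<Rightarrow> 'a"
  assumes "linear A" "linear C"
  shows "(\<Sum>b\<in>Basis. A (C b) \<bullet> b) = (\<Sum>b\<in>Basis. C (A b) \<bullet> b)"
proof -
  have e: "(\<Sum>b\<in>Basis. A (C b) \<bullet> b) = (\<Sum>b\<in>Basis. \<Sum>c\<in>Basis. (C b \<bullet> c) * (A c \<bullet> b))"
    if "linear A" for A C :: "'a \<Rightarrow> 'a"
  proof (rule sum.cong[OF refl])
    fix b :: 'a
    have "A (C b) = A (\<Sum>c\<in>Basis. (C b \<bullet> c) *\<^sub>R c)" by (simp add: euclidean_representation)
    also have "\<dots> = (\<Sum>c\<in>Basis. (C b \<bullet> c) *\<^sub>R A c)"
      using that by (simp add: linear_sum linear_scale)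
    finally show "A (C b) \<bullet> b = (\<Sum>c\<in>Basis. (C b \<bullet> c) * (A c \<bullet> b))"
      by (simp add: inner_sum_left)
  qed
  show ?thesis unfolding e[OF assms(1)] e[OF assms(2)]
    by (subst sum.swap) (simp add: mult.commute)
qed

lemma killing_form_sym: "killing_form x y = killing_form y x"
  unfolding killing_form_def by (rule trace_commute; rule linear_lie_bracket)

text \<open>After expanding \<open>ad [z,x]\<close> and \<open>ad [z,y]\<close>, the trace of
  \<open>ad x ad z ad y\<close> occurs on both sides; the two remaining traces agree by
  cyclicity.\<close>

lemma killing_form_invariant: "killing_form [z,x]\<^sub>L y = - killing_form x [z,y]\<^sub>L"
proof -
  have "(\<Sum>b\<in>Basis. [z,[x,[y,b]\<^sub>L]\<^sub>L]\<^sub>L \<bullet> b) = (\<Sum>b\<in>Basis. [x,[y,[z,b]\<^sub>L]\<^sub>L]\<^sub>L \<bullet> b)"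
    using trace_commute[of "\<lambda>b. [z,b]\<^sub>L" "\<lambda>b. [x,[y,b]\<^sub>L]\<^sub>L"]
    by (simp add: linear_lie_bracket linear_compose[OF linear_lie_bracket linear_lie_bracket, unfolded o_def])
  then show ?thesis
    by (simp add: killing_form_def bracket_bracket_left inner_diff_left sum_subtractf)
qed

definition lie_form :: "'g::lie_algebra \<Rightarrow> 'g \<Rightarrow> real" where
  "lie_form x y = - killing_form x y"

lemma lie_form_invariant: "lie_form [z,x]\<^sub>L y = - lie_form x [z,y]\<^sub>L"
  by (simp add: lie_form_def killing_form_invariant)

lemma inner_form_lie_form:
  assumes "compact_simple_lie_algebra TYPE('g::lie_algebra)"
  shows "inner_form (lie_form :: 'g \<Rightarrow> 'g \<Rightarrow> real)"
proof
  have l: "linear (\<lambda>y. lie_form x y)" for x :: 'g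
    by (rule linearI)
      (auto simp: lie_form_def killing_form_def inner_add_left sum.distrib sum_distrib_left sum_negf)
  show sym: "lie_form x y = lie_form y x" for x y :: 'g by (simp add: lie_form_def killing_form_sym)
  show "bilinear (lie_form :: 'g \<Rightarrow> 'g \<Rightarrow> real)"
    unfolding bilinear_def
  proof (intro conjI allI l)
    have "(\<lambda>x. lie_form x y) = lie_form y" for y :: 'g by (rule ext) (rule sym)
    then show "linear (\<lambda>x. lie_form x y)" for y :: 'g using l[of y] by simp
  qed
  show "lie_form x x > 0" if "x \<noteq> 0" for x :: 'g
    using assms that by (simp add: compact_simple_lie_algebra_def lie_form_def)
qed

section \<open>Hermitian decompositions and the Peirce decomposition of a tripotent\<close>

text \<open>The setting of the Peirce theory, free of roots and Cartan subalgebras. The axiom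
  \<open>Z_Z\<close>, which makes \<open>ad Z\<close> a complex structure on \<open>m\<close>, is
  established from the root data in \<open>compact_hermitian\<close>.\<close>

locale hermitian_lie = inner_form B for B :: "'g::lie_algebra \<Rightarrow> 'g \<Rightarrow> real" +
  fixes k m :: "'g set" and Z :: 'g
  assumes B_invariant: "B [z,x]\<^sub>L y = - B x [z,y]\<^sub>L"
    and subspace_k: "subspace k" and subspace_m: "subspace m"
    and bracket_km: "x \<in> k \<Longrightarrow> y \<in> m \<Longrightarrow> [x,y]\<^sub>L \<in> m"
    and bracket_mm: "x \<in> m \<Longrightarrow> y \<in> m \<Longrightarrow> [x,y]\<^sub>L \<in> k"
    and Z_in_k: "Z \<in> k"
    and Z_central: "u \<in> k \<Longrightarrow> [Z,u]\<^sub>L = 0"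
    and Z_Z: "x \<in> m \<Longrightarrow> [Z,[Z,x]\<^sub>L]\<^sub>L = - x"
begin

section \<open>The complex structure and the bracket\<close>

abbreviation J :: "'g \<Rightarrow> 'g" where "J x \<equiv> [Z,x]\<^sub>L"

lemma J_in_m: "x \<in> m \<Longrightarrow> J x \<in> m"
  using bracket_km Z_in_k by blast

lemma bracket_mk: "x \<in> m \<Longrightarrow> u \<in> k \<Longrightarrow> [x,u]\<^sub>L \<in> m"
  using bracket_km[of u x] subspace_neg[OF subspace_m] lie_bracket_anticomm[of x u] by simp

lemma bracket_k_J: "u \<in> k \<Longrightarrow> [u,J x]\<^sub>L = J [u,x]\<^sub>L"
  using bracket_bracket_right[of Z u x] Z_central by simp

lemma bracket_J_k: "u \<in> k \<Longrightarrow> [J x,u]\<^sub>L = J [x,u]\<^sub>L"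
  using bracket_bracket_right[of Z x u] Z_central by simp

text \<open>\<open>J\<close> is a derivation and kills \<open>[x,y]\<close>, which lies in
  \<open>k\<close>.\<close>

lemma bracket_J_left: "x \<in> m \<Longrightarrow> y \<in> m \<Longrightarrow> [J x,y]\<^sub>L = - [x,J y]\<^sub>L"
  using bracket_bracket_right[of Z x y] Z_central[OF bracket_mm, of x y]
  by (simp add: eq_neg_iff_add_eq_0)

lemma J_eq_0_iff: "x \<in> m \<Longrightarrow> J x = 0 \<longleftrightarrow> x = 0"
  using Z_Z[of x] by auto

lemma B_J_J: "y \<in> m \<Longrightarrow> B (J x) (J y) = B x y"
  by (simp add: B_invariant Z_Z)

text \<open>\<open>ad x\<close> is skew, so the square length of \<open>[x,v]\<close> is minus the
  product of \<open>v\<close> with \<open>[x,[x,v]]\<close>.\<close>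

lemma bracket_eq_0_if_square_0:
  fixes x v :: 'g
  assumes "[x,[x,v]\<^sub>L]\<^sub>L = 0" shows "[x,v]\<^sub>L = 0"
  using B_invariant[of x v "[x,v]\<^sub>L"] assms by (simp add: B_eq_0_iff)

text \<open>The bracket with \<open>[x,J x]\<close> measures how far \<open>(ad x)^2\<close> is from
  anticommuting with \<open>J\<close>.\<close>

lemma ad_square_J:
  assumes "x \<in> m" "v \<in> m"
  shows "[x,[x,J v]\<^sub>L]\<^sub>L = - J [x,[x,v]\<^sub>L]\<^sub>L - [[x,J x]\<^sub>L,v]\<^sub>L"
proof -
  have "[[x,J x]\<^sub>L,v]\<^sub>L = [x,[J x,v]\<^sub>L]\<^sub>L - [J x,[x,v]\<^sub>L]\<^sub>L" by (rule bracket_bracket_left)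
  also have "[J x,[x,v]\<^sub>L]\<^sub>L = J [x,[x,v]\<^sub>L]\<^sub>L" using assms by (intro bracket_J_k bracket_mm)
  also have "[x,[J x,v]\<^sub>L]\<^sub>L = - [x,[x,J v]\<^sub>L]\<^sub>L" using assms by (simp add: bracket_J_left)
  finally show ?thesis by simp
qed

section \<open>Peirce theory of a single tripotent\<close>

context
  fixes x :: 'g
  assumes x: "x \<in> m" and tripotent: "[[x,J x]\<^sub>L,x]\<^sub>L = J x"
begin

text \<open>With \<open>T = [x,J x]\<close>, the element \<open>[T,[x,v]]\<close> is evaluated
  twice: by the derivation rule with \<open>[T,x] = J x\<close>, and by expanding \<open>T\<close>.
  Equating the results determines \<open>[J x,p]\<close>. The last relation arises likewise from two
  evaluations of \<open>(ad (J x))^2 p\<close>.\<close>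

lemma tripotent_relations:
  assumes v: "v \<in> m" and a: "[[x,J x]\<^sub>L,v]\<^sub>L = a *\<^sub>R J v"
  defines "p \<equiv> [x,[x,v]\<^sub>L]\<^sub>L"
  shows "p \<in> m"
    and "[J x,[J x,v]\<^sub>L]\<^sub>L = - p - a *\<^sub>R v"
    and "[J x,p]\<^sub>L = - ((1 - a) / 2) *\<^sub>R [J x,v]\<^sub>L"
    and "[[x,J x]\<^sub>L,p]\<^sub>L = J ((2 - a) *\<^sub>R p + (a * (1 - a)) *\<^sub>R v)"
    and "[x,[x,p]\<^sub>L]\<^sub>L = - ((5 - 3 * a) / 2) *\<^sub>R p - (3 * a * (1 - a) / 2) *\<^sub>R v"
proof -
  let ?T = "[x,J x]\<^sub>L"
  note Jx = J_in_m[OF x]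
  have u: "[x,v]\<^sub>L \<in> k" "[J x,v]\<^sub>L \<in> k" using x Jx v by (auto intro: bracket_mm)
  show p: "p \<in> m" unfolding p_def using x u by (intro bracket_mk)
  have Yu: "[J x,[x,v]\<^sub>L]\<^sub>L = J p" unfolding p_def by (rule bracket_J_k[OF u(1)])
  have Xu': "[x,[J x,v]\<^sub>L]\<^sub>L = J p + a *\<^sub>R J v"
    using bracket_bracket_left[of x "J x" v] Yu a by simp
  have Y2: "[J x,[J x,w]\<^sub>L]\<^sub>L = J [x,[J x,w]\<^sub>L]\<^sub>L" if "w \<in> m" for w
    using Jx that by (intro bracket_J_k bracket_mm)
  show Yu': "[J x,[J x,v]\<^sub>L]\<^sub>L = - p - a *\<^sub>R v"
    unfolding Y2[OF v] Xu' using p v by (simp add: Z_Z)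
  have Tu: "[?T,[x,v]\<^sub>L]\<^sub>L = (1 - a) *\<^sub>R [J x,v]\<^sub>L"
    using bracket_bracket_right[of ?T x v] bracket_J_left[OF x v] tripotent a
    by (simp add: algebra_simps)
  have "[?T,[x,v]\<^sub>L]\<^sub>L = - 2 *\<^sub>R [J x,p]\<^sub>L"
    using bracket_bracket_left[of x "J x" "[x,v]\<^sub>L"] Yu bracket_J_left[OF x p]
    by (simp add: p_def scaleR_2)
  note Tu' = this
  have "[J x,p]\<^sub>L = (- (1/2)) *\<^sub>R (- 2 *\<^sub>R [J x,p]\<^sub>L)" by simp
  also have "\<dots> = (- (1/2)) *\<^sub>R ((1 - a) *\<^sub>R [J x,v]\<^sub>L)" using Tu Tu' by (simp only:)
  finally show Yp: "[J x,p]\<^sub>L = - ((1 - a) / 2) *\<^sub>R [J x,v]\<^sub>L" by simp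
  have "[?T,p]\<^sub>L = [J x,[x,v]\<^sub>L]\<^sub>L + [x,[?T,[x,v]\<^sub>L]\<^sub>L]\<^sub>L"
    unfolding p_def using bracket_bracket_right[of ?T x "[x,v]\<^sub>L"] tripotent by simp
  also have "\<dots> = J p + (1 - a) *\<^sub>R (J p + a *\<^sub>R J v)" by (simp add: Yu Tu Xu')
  finally show Tp: "[?T,p]\<^sub>L = J ((2 - a) *\<^sub>R p + (a * (1 - a)) *\<^sub>R v)"
    by (simp add: algebra_simps scaleR_2)
  have "[J x,[J x,p]\<^sub>L]\<^sub>L = - ((1 - a) / 2) *\<^sub>R (- p - a *\<^sub>R v)"
    by (simp add: Yp Yu')
  moreover have "[J x,[J x,p]\<^sub>L]\<^sub>L = - [x,[x,p]\<^sub>L]\<^sub>L - ((2 - a) *\<^sub>R p + (a * (1 - a)) *\<^sub>R v)"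
  proof -
    have "[J x,[J x,p]\<^sub>L]\<^sub>L = - J [x,[x,J p]\<^sub>L]\<^sub>L"
      unfolding bracket_J_left[OF x p]
      using bracket_J_k[OF bracket_mm[OF x J_in_m[OF p]], of x] by simp
    also have "\<dots> = - [x,[x,p]\<^sub>L]\<^sub>L + J [?T,p]\<^sub>L"
      using x p by (simp add: ad_square_J Z_Z bracket_mk bracket_mm)
    also have "J [?T,p]\<^sub>L = - ((2 - a) *\<^sub>R p + (a * (1 - a)) *\<^sub>R v)"
      unfolding Tp using p v by (intro Z_Z subspace_add subspace_scale subspace_m)
    finally show ?thesis by simp
  qed
  ultimately have "[x,[x,p]\<^sub>L]\<^sub>L =
      ((1 - a) / 2) *\<^sub>R (- p - a *\<^sub>R v) - ((2 - a) *\<^sub>R p + (a * (1 - a)) *\<^sub>R v)"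
    by (simp add: algebra_simps)
  also have "\<dots> = (- (1 - a) / 2 - (2 - a)) *\<^sub>R p + (- (1 - a) / 2 * a - a * (1 - a)) *\<^sub>R v"
    by (simp only: scaleR_left_distrib scaleR_left_diff_distrib scaleR_right_diff_distrib
        scaleR_minus_left scaleR_minus_right scaleR_scaleR minus_divide_left[symmetric]
        mult_minus_left) (simp add: algebra_simps)
  also have "- (1 - a) / 2 - (2 - a) = - ((5 - 3 * a) / 2)" by (simp add: field_simps)
  also have "- (1 - a) / 2 * a - a * (1 - a) = - (3 * a * (1 - a) / 2)" by (simp add: field_simps)
  finally show "[x,[x,p]\<^sub>L]\<^sub>L = - ((5 - 3 * a) / 2) *\<^sub>R p - (3 * a * (1 - a) / 2) *\<^sub>R v" by simp
qed

text \<open>By the fourth relation the span of \<open>p\<close> and \<open>v\<close> is invariant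
  under \<open>- J ad [x,J x]\<close>, and \<open>2 p + a v\<close> is its eigenvector for
  \<open>2 - a\<close>. Using the third relation for this vector as well as for \<open>v\<close>
  gives a second equation for \<open>[J x,v]\<close>.\<close>

lemma tripotent_eigenvalue_aux:
  assumes v: "v \<in> m" "v \<noteq> 0" and a: "[[x,J x]\<^sub>L,v]\<^sub>L = a *\<^sub>R J v"
  defines "p \<equiv> [x,[x,v]\<^sub>L]\<^sub>L"
  shows "2 *\<^sub>R p + a *\<^sub>R v \<in> m"
    and "[[x,J x]\<^sub>L,2 *\<^sub>R p + a *\<^sub>R v]\<^sub>L = (2 - a) *\<^sub>R J (2 *\<^sub>R p + a *\<^sub>R v)"
    and "a = 1 \<or> a = 1/2 \<or> a = 0 \<and> p = 0"
proof -
  note rel = tripotent_relations[OF v(1) a, folded p_def]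
  let ?w = "2 *\<^sub>R p + a *\<^sub>R v" and ?u = "[J x,v]\<^sub>L"
  show w: "?w \<in> m" using rel(1) v(1) by (intro subspace_add subspace_scale subspace_m)
  have "[[x,J x]\<^sub>L,?w]\<^sub>L = (2 * (2 - a)) *\<^sub>R J p + (2 * (a * (1 - a)) + a * a) *\<^sub>R J v"
    using rel(4) a
    by (simp only: lie_bracket_simps scaleR_left_distrib scaleR_right_distrib scaleR_scaleR add.assoc)
  also have "2 * (a * (1 - a)) + a * a = (2 - a) * a" by (simp add: algebra_simps)
  finally show Tw: "[[x,J x]\<^sub>L,?w]\<^sub>L = (2 - a) *\<^sub>R J ?w" by (simp add: algebra_simps)
  have "[J x,[x,[x,?w]\<^sub>L]\<^sub>L]\<^sub>L = - ((1 - (2 - a)) / 2) *\<^sub>R [J x,?w]\<^sub>L"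
    by (rule tripotent_relations(3)[OF w Tw])
  moreover have "[x,[x,?w]\<^sub>L]\<^sub>L = (a - (5 - 3 * a)) *\<^sub>R p - (3 * a * (1 - a)) *\<^sub>R v"
  proof -
    have "[x,[x,?w]\<^sub>L]\<^sub>L
        = 2 *\<^sub>R (- ((5 - 3 * a) / 2) *\<^sub>R p - (3 * a * (1 - a) / 2) *\<^sub>R v) + a *\<^sub>R p"
      using rel(5) by (simp only: lie_bracket_simps p_def[symmetric])
    also have "\<dots> = (2 * - ((5 - 3 * a) / 2) + a) *\<^sub>R p - (2 * (3 * a * (1 - a) / 2)) *\<^sub>R v"
      by (simp only: scaleR_left_distrib scaleR_right_diff_distrib scaleR_scaleR diff_add_eq)
    also have "2 * - ((5 - 3 * a) / 2) + a = a - (5 - 3 * a)" by (simp add: field_simps)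
    also have "2 * (3 * a * (1 - a) / 2) = 3 * a * (1 - a)" by simp
    finally show ?thesis .
  qed
  ultimately have "[J x,(a - (5 - 3 * a)) *\<^sub>R p - (3 * a * (1 - a)) *\<^sub>R v]\<^sub>L
      = - ((1 - (2 - a)) / 2) *\<^sub>R [J x,?w]\<^sub>L" by (simp only:)
  moreover have "[J x,(a - (5 - 3 * a)) *\<^sub>R p - (3 * a * (1 - a)) *\<^sub>R v]\<^sub>L
      = ((a - (5 - 3 * a)) * - ((1 - a) / 2) - 3 * a * (1 - a)) *\<^sub>R ?u"
    unfolding lie_bracket_simps rel(3) scaleR_scaleR by (rule scaleR_left_diff_distrib[symmetric])
  moreover have "[J x,?w]\<^sub>L = (2 * - ((1 - a) / 2) + a) *\<^sub>R ?u"
    unfolding lie_bracket_simps rel(3) scaleR_scaleR by (rule scaleR_left_distrib[symmetric])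
  ultimately have "((a - (5 - 3 * a)) * - ((1 - a) / 2) - 3 * a * (1 - a)) *\<^sub>R ?u
      = (- ((1 - (2 - a)) / 2) * (2 * - ((1 - a) / 2) + a)) *\<^sub>R ?u"
    by (simp only: scaleR_scaleR)
  then have "((a - (5 - 3 * a)) * - ((1 - a) / 2) - 3 * a * (1 - a)
      - - ((1 - (2 - a)) / 2) * (2 * - ((1 - a) / 2) + a)) *\<^sub>R ?u = 0"
    by (simp only: scaleR_left_diff_distrib right_minus_eq)
  \<comment> \<open>The difference of the two coefficients of \<open>[J x,v]\<close> factors; its
    zeros are the eigenvalues 1 and 1/2, and otherwise \<open>[J x,v]\<close> vanishes.\<close>
  moreover have "(a - (5 - 3 * a)) * - ((1 - a) / 2) - 3 * a * (1 - a)
      - - ((1 - (2 - a)) / 2) * (2 * - ((1 - a) / 2) + a) = 3 * (1 - a) * (1 - 2 * a)"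
    by (simp add: field_simps)
  ultimately have "a = 1 \<or> a = 1/2 \<or> ?u = 0" by auto
  \<comment> \<open>If \<open>[J x,v] = 0\<close>, the second relation gives
    \<open>p = - a v\<close>, and the fourth one then leaves \<open>a (1 - a) = 0\<close>.\<close>
  moreover have "a = 0 \<and> p = 0" if "?u = 0" "a \<noteq> 1"
  proof -
    have p: "p = - a *\<^sub>R v" using rel(2) that(1) by (simp add: algebra_simps add_eq_0_iff)
    have "(- a * a) *\<^sub>R J v = ((2 - a) * - a + a * (1 - a)) *\<^sub>R J v"
      using rel(4) a unfolding p
      by (simp only: lie_bracket_simps scaleR_scaleR scaleR_left_distrib)
    then have "(- a * a - ((2 - a) * - a + a * (1 - a))) *\<^sub>R J v = 0"
      by (simp only: scaleR_left_diff_distrib right_minus_eq)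
    moreover have "- a * a - ((2 - a) * - a + a * (1 - a)) = a * (1 - a)" by (simp add: algebra_simps)
    ultimately have "a * (1 - a) = 0" using J_eq_0_iff[OF v(1)] v(2) by simp
    then show ?thesis using that p by simp
  qed
  ultimately show "a = 1 \<or> a = 1/2 \<or> a = 0 \<and> p = 0" by blast
qed

text \<open>
  The operator \<open>w = 2 (ad x)\<^sup>2 + a\<close> maps the eigenspace \<open>a\<close> of \<open>- J ad [x, J x]\<close> to the eigenspace
  \<open>2 - a\<close>; as \<open>3/2\<close> is not an eigenvalue, it vanishes for \<open>a = 1/2\<close>.
\<close>

proposition peirce_decomposition:
  assumes v: "v \<in> m" "v \<noteq> 0" and a: "[[x,J x]\<^sub>L,v]\<^sub>L = a *\<^sub>R J v"
  shows "a = 0 \<and> [x,v]\<^sub>L = 0 \<or> a = 1/2 \<and> [x,[x,v]\<^sub>L]\<^sub>L = - (1/4) *\<^sub>R v \<or>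
    a = 1 \<and> [x,[x,[x,[x,v]\<^sub>L]\<^sub>L]\<^sub>L]\<^sub>L = - [x,[x,v]\<^sub>L]\<^sub>L \<and>
      [[x,J x]\<^sub>L,[x,[x,v]\<^sub>L]\<^sub>L]\<^sub>L = J [x,[x,v]\<^sub>L]\<^sub>L"
proof -
  let ?p = "[x,[x,v]\<^sub>L]\<^sub>L"
  note rel = tripotent_relations[OF v(1) a] and aux = tripotent_eigenvalue_aux[OF v a]
  consider "a = 1" | "a = 1/2" | "a = 0" "?p = 0" using aux(3) by blast
  then show ?thesis
  proof cases
    case 1 then show ?thesis using rel(4,5) by simp
  next
    case 2
    have "2 *\<^sub>R ?p + a *\<^sub>R v = 0"
      using tripotent_eigenvalue_aux(3)[OF aux(1) _ aux(2)] 2 by fastforce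
    then have "(1/2) *\<^sub>R (2 *\<^sub>R ?p + a *\<^sub>R v) = 0" by simp
    then show ?thesis using 2 by (simp add: scaleR_right_distrib eq_neg_iff_add_eq_0)
  next
    case 3 then show ?thesis using bracket_eq_0_if_square_0 by simp
  qed
qed

end

end

section \<open>Frames of strongly orthogonal tripotents\<close>

lemma lie_bracket_sum_right: "[x,\<Sum>i\<in>A. f i]\<^sub>L = (\<Sum>i\<in>A. [x,f i :: 'g::lie_algebra]\<^sub>L)"
  by (rule linear_sum[OF linear_lie_bracket])

lemma lie_bracket_sum_left: "[\<Sum>i\<in>A. f i,x]\<^sub>L = (\<Sum>i\<in>A. [f i,x :: 'g::lie_algebra]\<^sub>L)"
  by (rule linear_sum[OF linear_lie_bracket_left])

locale tripotent_frame = hermitian_lie B k m Z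
  for B :: "'g::lie_algebra \<Rightarrow> 'g \<Rightarrow> real" and k m Z +
  fixes r :: nat and X :: "nat \<Rightarrow> 'g"
  assumes X_m: "j \<in> {1..r} \<Longrightarrow> X j \<in> m"
    and X_X: "p \<in> {1..r} \<Longrightarrow> q \<in> {1..r} \<Longrightarrow> [X p,X q]\<^sub>L = 0"
    and X_JX: "p \<in> {1..r} \<Longrightarrow> q \<in> {1..r} \<Longrightarrow> p \<noteq> q \<Longrightarrow> [X p,[Z,X q]\<^sub>L]\<^sub>L = 0"
    and X_tripotent: "j \<in> {1..r} \<Longrightarrow> [[X j,[Z,X j]\<^sub>L]\<^sub>L,X j]\<^sub>L = [Z,X j]\<^sub>L"
    and X_maximal: "v \<in> m \<Longrightarrow> (\<And>j. j \<in> {1..r} \<Longrightarrow> [X j,v]\<^sub>L = 0) \<Longrightarrow> v \<in> span (X ` {1..r})"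
begin

abbreviation T :: "nat \<Rightarrow> 'g" where "T j \<equiv> [X j,J (X j)]\<^sub>L"

abbreviation P :: "nat \<Rightarrow> nat \<Rightarrow> 'g \<Rightarrow> 'g" where "P p q v \<equiv> [X p,[X q,v]\<^sub>L]\<^sub>L"

text \<open>By \<open>Z_Z\<close>, \<open>a j\<close> is the eigenvalue of
  \<open>- J ad (T j)\<close>. For the vectors \<open>X\<close>, \<open>Y\<close> of a root it is
  the value of the root at \<open>T j\<close> divided by i.\<close>

definition weight_space :: "(nat \<Rightarrow> real) \<Rightarrow> 'g set" where
  "weight_space a = {v\<in>m. \<forall>j\<in>{1..r}. [T j,v]\<^sub>L = a j *\<^sub>R J v}"

text \<open>The polarized form of the condition \<open>ad_w^2 = \<lambda>(w)^2\<close> that defines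
  \<open>m_space\<close>, with \<open>\<lambda>(X j) = i l j\<close>; the factor i accounts for the
  minus sign.\<close>

definition restricted_space :: "(nat \<Rightarrow> real) \<Rightarrow> 'g set" where
  "restricted_space l = {v\<in>m. \<forall>p\<in>{1..r}. \<forall>q\<in>{1..r}. P p q v = - (l p * l q) *\<^sub>R v}"

definition short_weight :: "(nat \<Rightarrow> real) \<Rightarrow> nat \<Rightarrow> bool" where
  "short_weight a j \<longleftrightarrow> j \<in> {1..r} \<and> a j = 1/2 \<and> (\<forall>i\<in>{1..r} - {j}. a i = 0)"

definition long_weight :: "(nat \<Rightarrow> real) \<Rightarrow> nat \<Rightarrow> bool" where
  "long_weight a j \<longleftrightarrow> j \<in> {1..r} \<and> a j = 1 \<and> (\<forall>i\<in>{1..r} - {j}. a i = 0)"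

definition pair_weight :: "(nat \<Rightarrow> real) \<Rightarrow> nat \<Rightarrow> nat \<Rightarrow> bool" where
  "pair_weight a p q \<longleftrightarrow> 1 \<le> p \<and> p < q \<and> q \<le> r \<and> a p = 1/2 \<and> a q = 1/2 \<and>
     (\<forall>i\<in>{1..r} - {p, q}. a i = 0)"

lemma JX_m: "j \<in> {1..r} \<Longrightarrow> J (X j) \<in> m"
  using X_m J_in_m by blast

lemma T_k: "j \<in> {1..r} \<Longrightarrow> T j \<in> k"
  using X_m JX_m bracket_mm by blast

lemma T_X: "p \<in> {1..r} \<Longrightarrow> q \<in> {1..r} \<Longrightarrow> [T p,X q]\<^sub>L = (if p = q then J (X q) else 0)"
  using X_tripotent[of p] X_X[of p q] X_JX[of p q] bracket_J_left[of "X p" "X q"] X_m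
  by (cases "p = q") (simp_all add: bracket_bracket_left[of _ _ "X q"])

lemma T_JX: "p \<in> {1..r} \<Longrightarrow> q \<in> {1..r} \<Longrightarrow> p \<noteq> q \<Longrightarrow> [T p,J (X q)]\<^sub>L = 0"
  using bracket_k_J[OF T_k, of p "X q"] T_X[of p q] by simp

lemma T_T: "p \<in> {1..r} \<Longrightarrow> q \<in> {1..r} \<Longrightarrow> [T p,T q]\<^sub>L = 0"
  by (cases "p = q") (simp_all add: bracket_bracket_right[of "T p" "X q"] T_X T_JX)

lemma P_commute: "p \<in> {1..r} \<Longrightarrow> q \<in> {1..r} \<Longrightarrow> P p q v = P q p v"
  using bracket_bracket_right[of "X p" "X q" v] X_X[of p q] by simp

lemma P_m: "p \<in> {1..r} \<Longrightarrow> q \<in> {1..r} \<Longrightarrow> v \<in> m \<Longrightarrow> P p q v \<in> m"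
  using X_m by (intro bracket_mk bracket_mm)

text \<open>For \<open>p \<noteq> q\<close> the bracket \<open>[X p,J (X q)]\<close> vanishes, so no
  correction term arises as in \<open>ad_square_J\<close> and \<open>P p q\<close> anticommutes with
  \<open>J\<close> exactly.\<close>

lemma P_J:
  assumes "p \<in> {1..r}" "q \<in> {1..r}" "p \<noteq> q" "v \<in> m"
  shows "[X p,[J (X q),v]\<^sub>L]\<^sub>L = J (P p q v)" and "P p q (J v) = - J (P p q v)"
proof -
  have "[X p,[J (X q),v]\<^sub>L]\<^sub>L = [J (X q),[X p,v]\<^sub>L]\<^sub>L"
    using bracket_bracket_right[of "X p" "J (X q)" v] X_JX[OF assms(1-3)] by simp
  also have "\<dots> = J (P q p v)" using assms X_m by (intro bracket_J_k bracket_mm)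
  finally show *: "[X p,[J (X q),v]\<^sub>L]\<^sub>L = J (P p q v)" using P_commute assms by simp
  have "[X q,J v]\<^sub>L = - [J (X q),v]\<^sub>L" using bracket_J_left[OF X_m assms(4), of q] assms by simp
  then show "P p q (J v) = - J (P p q v)" using * by simp
qed

lemma subspace_weight_space: "subspace (weight_space a)"
  using subspace_m unfolding weight_space_def subspace_def by (auto simp: scaleR_right_distrib)

lemma subspace_restricted_space: "subspace (restricted_space l)"
  using subspace_m unfolding restricted_space_def subspace_def
  by (auto simp: algebra_simps)

lemma J_weight_space: "v \<in> weight_space a \<Longrightarrow> J v \<in> weight_space a"
  using J_in_m bracket_k_J[OF T_k] by (auto simp: weight_space_def)

section \<open>Possible joint weights of a frame\<close>

lemma weight_values:
  assumes v: "v \<in> weight_space a" "v \<noteq> 0" and j: "j \<in> {1..r}"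
  shows "a j = 0 \<and> [X j,v]\<^sub>L = 0 \<or> a j = 1/2 \<and> P j j v = - (1/4) *\<^sub>R v \<or>
    a j = 1 \<and> P j j (P j j v) = - P j j v \<and> [T j,P j j v]\<^sub>L = J (P j j v)"
  using peirce_decomposition[OF X_m[OF j] X_tripotent[OF j], of v "a j"] v j
  by (auto simp: weight_space_def)

text \<open>The sum of a frame of tripotents is again a tripotent.\<close>

lemma weight_sum:
  assumes v: "v \<in> weight_space a" "v \<noteq> 0"
  shows "(\<Sum>j\<in>{1..r}. a j) \<in> {0, 1/2, 1}"
proof -
  let ?e = "\<Sum>j\<in>{1..r}. X j"
  have e: "?e \<in> m" using X_m by (intro subspace_sum subspace_m)
  have T: "[?e,J ?e]\<^sub>L = (\<Sum>j\<in>{1..r}. T j)"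
  proof -
    have "[?e,J ?e]\<^sub>L = (\<Sum>p\<in>{1..r}. \<Sum>q\<in>{1..r}. [X p,J (X q)]\<^sub>L)"
      by (subst lie_bracket_sum_left) (simp only: lie_bracket_sum_right)
    also have "\<dots> = (\<Sum>p\<in>{1..r}. \<Sum>q\<in>{1..r}. if q = p then T p else 0)"
      using X_JX by (intro sum.cong refl) auto
    finally show ?thesis by simp
  qed
  have "[[?e,J ?e]\<^sub>L,?e]\<^sub>L = (\<Sum>p\<in>{1..r}. \<Sum>q\<in>{1..r}. [T p,X q]\<^sub>L)"
    unfolding T by (subst lie_bracket_sum_left) (simp only: lie_bracket_sum_right)
  also have "\<dots> = (\<Sum>p\<in>{1..r}. \<Sum>q\<in>{1..r}. if p = q then J (X q) else 0)"
    using T_X by (intro sum.cong refl) auto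
  also have "\<dots> = J ?e" by (simp add: lie_bracket_sum_right)
  finally have tri: "[[?e,J ?e]\<^sub>L,?e]\<^sub>L = J ?e" .
  have "[[?e,J ?e]\<^sub>L,v]\<^sub>L = (\<Sum>j\<in>{1..r}. a j) *\<^sub>R J v"
    using v unfolding T by (simp add: lie_bracket_sum_left weight_space_def scaleR_sum_left)
  from peirce_decomposition[OF e tri _ v(2) this] v(1) show ?thesis
    by (auto simp: weight_space_def)
qed

text \<open>If all weights vanish, \<open>v\<close> commutes with every \<open>X j\<close> and lies
  in their span by maximality. But \<open>v\<close> is also orthogonal to every \<open>X j\<close>:
  since \<open>J (X j) = [T j,X j]\<close>, skewness moves \<open>T j\<close> to \<open>J v\<close>,
  where it gives 0.\<close>

lemma weight_nonzero:
  assumes v: "v \<in> weight_space a" "v \<noteq> 0"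
  shows "\<exists>j\<in>{1..r}. a j \<noteq> 0"
proof (rule ccontr)
  assume "\<not> ?thesis"
  then have a: "a j = 0" if "j \<in> {1..r}" for j using that by blast
  have vm: "v \<in> m" using v by (simp add: weight_space_def)
  have Tv: "[T j,v]\<^sub>L = 0" if "j \<in> {1..r}" for j using v a that by (simp add: weight_space_def)
  have "[X j,v]\<^sub>L = 0" if "j \<in> {1..r}" for j using weight_values[OF v that] a[OF that] by simp
  from X_maximal[OF vm this] have "v \<in> span (X ` {1..r})" .
  moreover have "span (X ` {1..r}) \<subseteq> {y. B v y = 0}"
  proof (rule span_minimal)
    show "subspace {y. B v y = 0}" by (auto simp: subspace_def)
    have "B v (X j) = 0" if j: "j \<in> {1..r}" for j
    proof -
      have "B v (X j) = B (J v) (J (X j))" using B_J_J X_m[OF j] by simp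
      also have "\<dots> = B (J v) [T j,X j]\<^sub>L" using T_X j by simp
      also have "\<dots> = - B [T j,J v]\<^sub>L (X j)" by (simp add: B_invariant)
      also have "[T j,J v]\<^sub>L = 0" using bracket_k_J[OF T_k[OF j]] Tv[OF j] by simp
      finally show ?thesis by simp
    qed
    then show "X ` {1..r} \<subseteq> {y. B v y = 0}" by blast
  qed
  ultimately show False using v(2) B_eq_0_iff by blast
qed

text \<open>Weights are nonnegative and their total is at most 1. Used for two and three indices,
  this excludes any weight besides a 1, and any third weight besides two halves.\<close>

lemma weight_partial_sum:
  assumes v: "v \<in> weight_space a" "v \<noteq> 0" and S: "S \<subseteq> {1..r}"
  shows "(\<Sum>j\<in>S. a j) \<le> 1"
proof -
  have "a j \<ge> 0" if "j \<in> {1..r}" for j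
    using weight_values[OF v that] by fastforce
  then have "(\<Sum>j\<in>S. a j) \<le> (\<Sum>j\<in>{1..r}. a j)" using S by (intro sum_mono2) auto
  also have "\<dots> \<le> 1" using weight_sum[OF v] by auto
  finally show ?thesis .
qed

lemma weight_one:
  assumes v: "v \<in> weight_space a" "v \<noteq> 0" and p: "p \<in> {1..r}" "a p = 1"
    and j: "j \<in> {1..r}" "j \<noteq> p"
  shows "a j = 0"
  using weight_partial_sum[OF v, of "{p, j}"] weight_values[OF v j(1)] p j by auto

lemma weight_pair:
  assumes v: "v \<in> weight_space a" "v \<noteq> 0" and p: "p \<in> {1..r}" "a p \<noteq> 0"
    and q: "q \<in> {1..r}" "a q \<noteq> 0" and "p \<noteq> q"
  shows "a p = 1/2" "a q = 1/2" "\<And>j. j \<in> {1..r} \<Longrightarrow> j \<noteq> p \<Longrightarrow> j \<noteq> q \<Longrightarrow> a j = 0"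
proof -
  show half: "a p = 1/2" "a q = 1/2"
    using weight_partial_sum[OF v, of "{p, q}"] weight_values[OF v p(1)] weight_values[OF v q(1)]
      p q \<open>p \<noteq> q\<close> by auto
  show "a j = 0" if "j \<in> {1..r}" "j \<noteq> p" "j \<noteq> q" for j
    using weight_partial_sum[OF v, of "{j, p, q}"] weight_values[OF v that(1)] that
      p q \<open>p \<noteq> q\<close> half by auto
qed

theorem weight_classification:
  assumes v: "v \<in> weight_space a" "v \<noteq> 0"
  shows "(\<exists>j. short_weight a j) \<or> (\<exists>j. long_weight a j) \<or> (\<exists>p q. pair_weight a p q)"
proof -
  obtain j where j: "j \<in> {1..r}" "a j \<noteq> 0" using weight_nonzero[OF v] by blast
  show ?thesis
  proof (cases "\<forall>i\<in>{1..r} - {j}. a i = 0")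
    case True
    then show ?thesis
      using weight_values[OF v j(1)] j by (auto simp: short_weight_def long_weight_def)
  next
    case False
    then obtain i where i: "i \<in> {1..r}" "i \<noteq> j" "a i \<noteq> 0" by blast
    have "pair_weight a (min i j) (max i j)"
      using weight_pair[OF v i(1,3) j i(2)] i j by (auto simp: pair_weight_def min_def max_def)
    then show ?thesis by blast
  qed
qed

text \<open>The delicate case is \<open>p \<noteq> q\<close> with both weights 1/2. Bracketing with
  \<open>T p\<close> turns the factor \<open>X p\<close> into \<open>J (X p)\<close>, which
  contributes \<open>J (P p q v)\<close>; acting on \<open>v\<close> it contributes minus half of
  this, because \<open>P p q\<close> anticommutes with \<open>J\<close>. The weight 1/2 is left, and
  \<open>T q\<close> behaves in the same way.\<close>

lemma P_weight_space:
  assumes v: "v \<in> weight_space a" and p: "p \<in> {1..r}" and q: "q \<in> {1..r}"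
  shows "P p q v \<in> weight_space a"
proof (cases "v = 0")
  case True then show ?thesis using subspace_0[OF subspace_weight_space] by simp
next
  case v0: False
  note vals = weight_values[OF v v0]
  have vm: "v \<in> m" and Tv: "\<And>j. j \<in> {1..r} \<Longrightarrow> [T j,v]\<^sub>L = a j *\<^sub>R J v"
    using v by (auto simp: weight_space_def)
  have 0: "0 \<in> weight_space a" using subspace_0[OF subspace_weight_space] .
  show ?thesis
  proof (cases "a p = 0 \<or> a q = 0")
    case True
    then have "P p q v = 0" using vals[OF p] vals[OF q] P_commute[OF p q, of v] by auto
    then show ?thesis using 0 by simp
  next
    case False
    then have ap: "a p \<noteq> 0" and aq: "a q \<noteq> 0" by auto
    show ?thesis
    proof (cases "p = q")
      case True
      show ?thesis
      proof (cases "a p = 1/2")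
        case True
        then have "P p p v = - (1/4) *\<^sub>R v" using vals[OF p] by auto
        then show ?thesis using \<open>p = q\<close> v subspace_scale[OF subspace_weight_space v, of "- (1/4)"] by simp
      next
        case False
        then have a1: "a p = 1" and TP: "[T p,P p p v]\<^sub>L = J (P p p v)" using vals[OF p] ap by auto
        have "[T j,P p p v]\<^sub>L = a j *\<^sub>R J (P p p v)" if j: "j \<in> {1..r}" for j
        proof (cases "j = p")
          case True then show ?thesis using TP a1 by simp
        next
          case False
          have "a j = 0" using weight_one[OF v v0 p a1 j False] .
          then show ?thesis
            using T_X[OF j p] Tv[OF j] False by (simp add: bracket_bracket_right[of "T j"])
        qed
        then show ?thesis using \<open>p = q\<close> P_m[OF p p vm] by (simp add: weight_space_def)
      qed
    next
      case pq: False
      have a: "a j = (if j = p \<or> j = q then 1/2 else 0)" if "j \<in> {1..r}" for j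
        using weight_pair[OF v v0 p ap q aq pq] that by auto
      have "[T j,P p q v]\<^sub>L = a j *\<^sub>R J (P p q v)" if j: "j \<in> {1..r}" for j
      proof -
        have "[T j,P p q v]\<^sub>L = [[T j,X p]\<^sub>L,[X q,v]\<^sub>L]\<^sub>L + [X p,[[T j,X q]\<^sub>L,v]\<^sub>L]\<^sub>L + P p q [T j,v]\<^sub>L"
          using bracket_bracket_right[of "T j" "X p" "[X q,v]\<^sub>L"] bracket_bracket_right[of "T j" "X q" v]
          by simp
        moreover have "[J (X p),[X q,v]\<^sub>L]\<^sub>L = J (P p q v)"
          using X_m p q vm by (intro bracket_J_k bracket_mm)
        moreover have "w - (1/2) *\<^sub>R w = (1/2) *\<^sub>R w" for w :: 'g
          using scaleR_left_diff_distrib[of 1 "1/2" w] by simp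
        ultimately show ?thesis
          using T_X[OF j p] T_X[OF j q] P_J[OF p q pq vm] Tv[OF j] a[OF j] pq
          by auto
      qed
      then show ?thesis using P_m[OF p q vm] by (simp add: weight_space_def)
    qed
  qed
qed

text \<open>
  The operators \<open>- J ad (T j)\<close> preserve \<open>restricted_space l\<close> because they commute with all
  \<open>P p q\<close>; the latter holds since the \<open>P p q\<close> preserve the weight spaces, which span \<open>m\<close>.
\<close>

abbreviation D :: "nat \<Rightarrow> 'g \<Rightarrow> 'g" where "D j v \<equiv> - J [T j,v]\<^sub>L"

text \<open>Each \<open>D j\<close> is symmetric, up to sign the product of the commuting skew
  operators \<open>J\<close> and \<open>ad (T j)\<close>, and the \<open>D j\<close> commute because
  the \<open>T j\<close> do. Stated for invariant subspaces, so that it applies to \<open>m\<close>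
  and to the restricted spaces alike.\<close>

lemma D_diagonalization:
  assumes V: "subspace V" "V \<subseteq> m" and D: "\<And>j v. j \<in> {1..r} \<Longrightarrow> v \<in> V \<Longrightarrow> D j v \<in> V"
  shows "V \<subseteq> span (\<Union>a. V \<inter> weight_space a - {0})"
proof -
  let ?F = "D ` {1..r}"
  have Tm: "[T j,v]\<^sub>L \<in> m" if "j \<in> {1..r}" "v \<in> m" for j v using T_k bracket_km that by blast
  have "V \<subseteq> span {v\<in>V. v \<noteq> 0 \<and> (\<forall>A\<in>?F. \<exists>c. A v = c *\<^sub>R v)}"
  proof (rule simultaneous_diagonalization[OF V(1)])
    show "linear A" if "A \<in> ?F" for A using that by (auto intro!: linearI)
    show "A v \<in> V" if "A \<in> ?F" "v \<in> V" for A v using that D by auto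
    show "B (A v) w = B v (A w)" if A: "A \<in> ?F" and vw: "v \<in> V" "w \<in> V" for A v w
    proof -
      obtain j where j: "j \<in> {1..r}" "A = D j" using A by blast
      have "B (A v) w = B [T j,v]\<^sub>L (J w)" unfolding j(2) by (simp add: B_invariant)
      also have "\<dots> = - B v [T j,J w]\<^sub>L" by (simp only: B_invariant)
      also have "\<dots> = B v (A w)" unfolding j(2) bracket_k_J[OF T_k[OF j(1)]] by simp
      finally show ?thesis .
    qed
    show "A (C v) = C (A v)" if AC: "A \<in> ?F" "C \<in> ?F" and v: "v \<in> V" for A C v
    proof -
      obtain i j where ij: "i \<in> {1..r}" "A = D i" "j \<in> {1..r}" "C = D j" using AC by blast
      have DD: "D i (D j v) = - [T i,[T j,v]\<^sub>L]\<^sub>L" if "i \<in> {1..r}" "j \<in> {1..r}" for i j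
        using bracket_k_J[OF T_k[OF that(1)]] Z_Z[OF Tm[OF that(1) Tm[OF that(2), of v]]] v V(2)
        by auto
      have "[T i,[T j,v]\<^sub>L]\<^sub>L = [T j,[T i,v]\<^sub>L]\<^sub>L"
        using bracket_bracket_right[of "T i" "T j" v] T_T[OF ij(1,3)] by simp
      then show ?thesis unfolding ij(2,4) using DD[OF ij(1,3)] DD[OF ij(3,1)] by simp
    qed
  qed
  also have "\<dots> \<subseteq> span (\<Union>a. V \<inter> weight_space a - {0})"
  proof (rule span_mono, rule subsetI)
    fix v assume "v \<in> {v\<in>V. v \<noteq> 0 \<and> (\<forall>A\<in>?F. \<exists>c. A v = c *\<^sub>R v)}"
    then have v: "v \<in> V" "v \<noteq> 0" "\<forall>j\<in>{1..r}. \<exists>c. D j v = c *\<^sub>R v" by auto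
    then obtain a where a: "\<And>j. j \<in> {1..r} \<Longrightarrow> D j v = a j *\<^sub>R v" by metis
    have vm: "v \<in> m" using v V(2) by blast
    have "[T j,v]\<^sub>L = a j *\<^sub>R J v" if "j \<in> {1..r}" for j
      using arg_cong[OF a[OF that], of J] Z_Z[OF Tm[OF that vm]] by simp
    then show "v \<in> (\<Union>a. V \<inter> weight_space a - {0})" using v vm by (auto simp: weight_space_def)
  qed
  finally show ?thesis .
qed

lemma P_D_commute:
  assumes "p \<in> {1..r}" "q \<in> {1..r}" "j \<in> {1..r}" "v \<in> m"
  shows "P p q (D j v) = D j (P p q v)"
proof -
  have "m \<subseteq> span (\<Union>a. m \<inter> weight_space a - {0})"
    using T_k bracket_km J_in_m subspace_neg[OF subspace_m]
    by (intro D_diagonalization subspace_m order_refl) blast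
  also have "\<dots> \<subseteq> {v. P p q (D j v) = D j (P p q v)}"
  proof (rule span_minimal)
    show "subspace {v. P p q (D j v) = D j (P p q v)}" by (auto simp: subspace_def)
    have "P p q (D j v) = D j (P p q v)" if "v \<in> weight_space a" for a v
    proof -
      have "D j v = a j *\<^sub>R v" if "v \<in> weight_space a" for v
        using that assms(3) Z_Z by (auto simp: weight_space_def)
      from this[OF that] this[OF P_weight_space[OF that assms(1,2)]] show ?thesis by simp
    qed
    then show "(\<Union>a. m \<inter> weight_space a - {0}) \<subseteq> {v. P p q (D j v) = D j (P p q v)}" by blast
  qed
  finally show ?thesis using assms(4) by blast
qed

section \<open>Restricted spaces inside weight spaces\<close>

lemma restricted_diagonalization:
  "restricted_space l \<subseteq> span (\<Union>a. restricted_space l \<inter> weight_space a - {0})"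
proof (rule D_diagonalization[OF subspace_restricted_space])
  show "restricted_space l \<subseteq> m" by (auto simp: restricted_space_def)
  show "D j v \<in> restricted_space l" if j: "j \<in> {1..r}" and v: "v \<in> restricted_space l" for j v
  proof -
    have vm: "v \<in> m" using v by (simp add: restricted_space_def)
    have "D j v \<in> m" using vm j T_k bracket_km J_in_m subspace_neg[OF subspace_m] by blast
    moreover have "P p q (D j v) = - (l p * l q) *\<^sub>R D j v" if "p \<in> {1..r}" "q \<in> {1..r}" for p q
    proof -
      have "P p q v = - (l p * l q) *\<^sub>R v" using v that by (simp add: restricted_space_def)
      then show ?thesis unfolding P_D_commute[OF that j vm] by simp
    qed
    ultimately show ?thesis by (simp add: restricted_space_def)
  qed
qed

text \<open>\<open>P j j\<close> acts on \<open>v\<close> by \<open>- (l j)^2\<close>. The Peirce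
  decomposition gives another description: 0 for weight 0, -1/4 for weight 1/2, and
  \<open>P^2 = - P\<close> for weight 1. Comparing the two determines \<open>l j\<close> up to
  sign.\<close>

lemma restricted_weight:
  assumes v: "v \<in> restricted_space l" "v \<in> weight_space a" "v \<noteq> 0"
    and l: "\<exists>j\<in>{1..r}. l j \<noteq> 0" and j: "j \<in> {1..r}"
  shows "a j = \<bar>l j\<bar>"
proof -
  have P: "P p p v = - (l p * l p) *\<^sub>R v" if "p \<in> {1..r}" for p
    using v(1) that by (simp add: restricted_space_def)
  have zero: "l p = 0" if "p \<in> {1..r}" "a p = 0" for p
    using weight_values[OF v(2,3) that(1)] P[OF that(1)] that(2) v(3) by auto
  consider "a j = 0" | "a j = 1/2" "P j j v = - (1/4) *\<^sub>R v"
    | "a j = 1" "P j j (P j j v) = - P j j v"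
    using weight_values[OF v(2,3) j] by blast
  then show ?thesis
  proof cases
    case 1 then show ?thesis using zero[OF j] by simp
  next
    case 2
    then have "(l j * l j - 1/4) *\<^sub>R v = 0" using P[OF j] by (simp add: scaleR_left_diff_distrib)
    then have "l j * l j = 1/4" using v(3) by simp
    then have "\<bar>l j\<bar>\<^sup>2 = (1/2)\<^sup>2" by (simp add: power2_eq_square)
    then have "\<bar>l j\<bar> = 1/2" by (rule power2_eq_imp_eq) simp_all
    then show ?thesis using 2 by simp
  next
    case 3
    \<comment> \<open>For weight 1 the relation \<open>P^2 = - P\<close> would also allow
      \<open>l j = 0\<close>. As all other weights, and with them all other \<open>l i\<close>,
      vanish, \<open>l\<close> would then be zero altogether.\<close>
    have "l j \<noteq> 0"
    proof
      assume "l j = 0"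
      moreover have "l i = 0" if "i \<in> {1..r}" "i \<noteq> j" for i
        using zero weight_one[OF v(2,3) j 3(1)] that by blast
      ultimately show False using l by blast
    qed
    have "(l j * l j * (l j * l j) - l j * l j) *\<^sub>R v = 0"
      using 3(2) P[OF j] by (simp add: scaleR_left_diff_distrib)
    then have "l j * l j * (l j * l j - 1) = 0" using v(3) by (simp add: algebra_simps)
    then have "l j * l j = 1" using \<open>l j \<noteq> 0\<close> by simp
    then have "\<bar>l j\<bar>\<^sup>2 = 1\<^sup>2" by (simp add: power2_eq_square)
    then have "\<bar>l j\<bar> = 1" by (rule power2_eq_imp_eq) simp_all
    then show ?thesis using 3 by simp
  qed
qed

lemma restricted_subset_weight:
  assumes "\<exists>j\<in>{1..r}. l j \<noteq> 0"
  shows "restricted_space l \<subseteq> weight_space (\<lambda>j. \<bar>l j\<bar>)"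
proof -
  have "restricted_space l \<subseteq> span (\<Union>a. restricted_space l \<inter> weight_space a - {0})"
    by (rule restricted_diagonalization)
  also have "\<dots> \<subseteq> weight_space (\<lambda>j. \<bar>l j\<bar>)"
    using restricted_weight[OF _ _ _ assms]
    by (intro span_minimal subspace_weight_space) (auto simp: weight_space_def)
  finally show ?thesis .
qed

text \<open>
  If \<open>\<bar>l\<bar>\<close> is a long or a pair weight, then \<open>J\<close> exchanges the two eigenspaces of the relevant
  \<open>P p q\<close> on the weight space, and one of them is the restricted space.
\<close>

theorem restricted_plus_J_restricted:
  assumes l: "\<exists>j\<in>{1..r}. l j \<noteq> 0"
  shows "{x + J y | x y. x \<in> restricted_space l \<and> y \<in> restricted_space l}
    = weight_space (\<lambda>j. \<bar>l j\<bar>)" (is "?L = ?W")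
proof
  show "?L \<subseteq> ?W"
    using restricted_subset_weight[OF l] J_weight_space subspace_add[OF subspace_weight_space]
    by blast
  have lsq: "l j * l j = \<bar>l j\<bar> * \<bar>l j\<bar>" for j by simp
  show "?W \<subseteq> ?L"
  proof
    fix v assume v: "v \<in> ?W"
    show "v \<in> ?L"
    proof (cases "v = 0")
      case True
      then have "v = 0 + J 0" by simp
      then show ?thesis using subspace_0[OF subspace_restricted_space, of l] by blast
    next
      case v0: False
      have vm: "v \<in> m" using v by (simp add: weight_space_def)
      have kill: "[X j,w]\<^sub>L = 0" if "w \<in> ?W" "j \<in> {1..r}" "l j = 0" for w j
        using weight_values[OF that(1) _ that(2)] that(3) by (cases "w = 0") auto
      have kill2: "P p q w = - (l p * l q) *\<^sub>R w"
        if "w \<in> ?W" "p \<in> {1..r}" "q \<in> {1..r}" "l p = 0 \<or> l q = 0" for w p q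
        using kill[OF that(1)] P_commute[OF that(2,3), of w] that by auto
      have half: "P j j w = - (l j * l j) *\<^sub>R w" if "w \<in> ?W" "j \<in> {1..r}" "\<bar>l j\<bar> = 1/2" for w j
      proof -
        have "l j * l j = 1/4" by (subst lsq) (simp add: that(3))
        then show ?thesis
          using weight_values[OF that(1) _ that(2)] that(3) by (cases "w = 0") auto
      qed
      consider j where "short_weight (\<lambda>j. \<bar>l j\<bar>) j" | j where "long_weight (\<lambda>j. \<bar>l j\<bar>) j"
        | p q where "pair_weight (\<lambda>j. \<bar>l j\<bar>) p q"
        using weight_classification[OF v v0] by blast
      then show ?thesis
      proof cases
        case 1
        then have j: "\<bar>l j\<bar> = 1/2" "\<And>i. i \<in> {1..r} \<Longrightarrow> i \<noteq> j \<Longrightarrow> l i = 0"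
          by (auto simp: short_weight_def)
        have "P p q v = - (l p * l q) *\<^sub>R v" if "p \<in> {1..r}" "q \<in> {1..r}" for p q
          using kill2[OF v that] half[OF v that(1)] j that by (cases "p = j \<and> q = j") blast+
        then have "v \<in> restricted_space l" using vm by (simp add: restricted_space_def)
        moreover have "v = v + J 0" by simp
        ultimately show ?thesis using subspace_0[OF subspace_restricted_space] by blast
      next
        case 2
        then have j: "j \<in> {1..r}" "\<bar>l j\<bar> = 1" and other: "\<And>i. i \<in> {1..r} \<Longrightarrow> i \<noteq> j \<Longrightarrow> l i = 0"
          by (auto simp: long_weight_def)
        have ljj: "l j * l j = 1" using lsq[of j] j(2) by simp
        have PP: "P j j (P j j v) = - P j j v" and Pv: "P j j v \<in> ?W"
          using weight_values[OF v v0 j(1)] j(2) P_weight_space[OF v j(1) j(1)] by auto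
        have rest: "w \<in> restricted_space l" if w: "w \<in> ?W" "P j j w = - w" for w
        proof -
          have "P p q w = - (l p * l q) *\<^sub>R w" if "p \<in> {1..r}" "q \<in> {1..r}" for p q
          proof (cases "p = j \<and> q = j")
            case True then show ?thesis using w(2) ljj by simp
          next
            case False then show ?thesis using kill2[OF w(1) that] other that by blast
          qed
          then show ?thesis using w(1) by (simp add: restricted_space_def weight_space_def)
        qed
        \<comment> \<open>As \<open>P j j\<close> has square \<open>- P j j\<close> on
          \<open>v\<close>, the splitting \<open>v = - P j j v + (v + P j j v)\<close> has parts in
          the eigenspaces for -1 and 0. The second part equals \<open>J ?y\<close>, and
          \<open>J\<close> carries it to the eigenvalue -1.\<close>
        let ?y = "- J (v + P j j v)"
        have W: "v + P j j v \<in> ?W" using v Pv by (intro subspace_add subspace_weight_space)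
        then have Wm: "v + P j j v \<in> m" by (simp add: weight_space_def)
        have "P j j ?y = - ?y"
        proof -
          have "P j j (J (v + P j j v)) = - J (P j j (v + P j j v)) - [T j,v + P j j v]\<^sub>L"
            by (rule ad_square_J[OF X_m[OF j(1)] Wm])
          also have "P j j (v + P j j v) = 0" by (simp add: PP)
          also have "[T j,v + P j j v]\<^sub>L = J (v + P j j v)"
            using W j unfolding weight_space_def by simp
          finally have "P j j (J (v + P j j v)) = - J (v + P j j v)"
            by (simp only: lie_bracket_simps(7) minus_zero diff_0)
          then show ?thesis unfolding lie_bracket_simps(9) by (simp only:)
        qed
        moreover have "?y \<in> ?W"
          using J_weight_space[OF W] subspace_neg[OF subspace_weight_space] by blast
        ultimately have "?y \<in> restricted_space l" using rest by blast
        moreover have "- P j j v \<in> restricted_space l"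
          using rest[of "- P j j v"] PP subspace_neg[OF subspace_weight_space Pv] by simp
        moreover have "J ?y = v + P j j v"
          using Z_Z[OF Wm] by (simp only: lie_bracket_simps(9) minus_minus)
        then have "v = - P j j v + J ?y" by simp
        ultimately show ?thesis by blast
      next
        case 3
        then have p: "p \<in> {1..r}" "\<bar>l p\<bar> = 1/2" and q: "q \<in> {1..r}" "\<bar>l q\<bar> = 1/2" and pq: "p \<noteq> q"
          and other: "\<And>i. i \<in> {1..r} \<Longrightarrow> i \<noteq> p \<Longrightarrow> i \<noteq> q \<Longrightarrow> l i = 0"
          by (auto simp: pair_weight_def)
        let ?s = "l p * l q"
        have s: "?s * ?s = 1/16"
        proof -
          have "?s * ?s = (l p * l p) * (l q * l q)" by (simp only: ac_simps)
          also have "\<dots> = 1/16" by (simp only: lsq[of p] lsq[of q] p(2) q(2))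
          finally show ?thesis .
        qed
        have rest: "w \<in> restricted_space l" if w: "w \<in> ?W" "P p q w = - ?s *\<^sub>R w" for w
        proof -
          have "P i j w = - (l i * l j) *\<^sub>R w" if ij: "i \<in> {1..r}" "j \<in> {1..r}" for i j
          proof (cases "i = j")
            case True
            then show ?thesis using half[OF w(1) ij(1)] kill2[OF w(1) ij] other[OF ij(1)] p q by blast
          next
            case False
            then consider "i = p" "j = q" | "i = q" "j = p" | "l i = 0 \<or> l j = 0"
              using other ij by blast
            then show ?thesis
            proof cases
              case 2 then show ?thesis using w(2) P_commute[OF p(1) q(1), of w] by (simp add: mult.commute)
            qed (use w kill2[OF w(1) ij] in auto)
          qed
          then show ?thesis using w(1) by (simp add: restricted_space_def weight_space_def)
        qed
        let ?A = "P p q v"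
        have A: "?A \<in> ?W" by (rule P_weight_space[OF v p(1) q(1)])
        have AA: "P p q ?A = (1/16) *\<^sub>R v"
        proof -
          have "P q p [X q,v]\<^sub>L = P p q [X q,v]\<^sub>L" by (rule P_commute[OF q(1) p(1)])
          then have "P p q ?A = P p p (P q q v)" by simp
          also have "\<dots> = - (l q * l q) *\<^sub>R P p p v"
            unfolding half[OF v q] by (simp only: lie_bracket_simps)
          also have "\<dots> = (?s * ?s) *\<^sub>R v" unfolding half[OF v p] by (simp add: ac_simps)
          finally show ?thesis unfolding s .
        qed
        \<comment> \<open>\<open>P p q\<close> squares to 1/16 here, so its eigenvalues are
          \<open>s\<close> and \<open>- s\<close> for \<open>s = l p * l q\<close>. The projections
          are \<open>(v - P p q v / s) / 2\<close> and \<open>(v + P p q v / s) / 2\<close>; since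
          \<open>s^2 = 1/16\<close>, the factor \<open>1 / (2 s)\<close> is
          \<open>8 s\<close>.\<close>
        define x where "x = (1/2) *\<^sub>R v - (8 * ?s) *\<^sub>R ?A"
        define z where "z = (1/2) *\<^sub>R v + (8 * ?s) *\<^sub>R ?A"
        have xz: "x \<in> ?W" "z \<in> ?W"
          unfolding x_def z_def using v A
          by (auto intro!: subspace_add subspace_diff subspace_scale subspace_weight_space)
        have Ax: "P p q x = - ?s *\<^sub>R x"
        proof -
          have "P p q x = (1/2) *\<^sub>R ?A - (8 * ?s * (1/16)) *\<^sub>R v" by (simp add: x_def AA)
          moreover have "- ?s *\<^sub>R x = (8 * (?s * ?s)) *\<^sub>R ?A - (?s / 2) *\<^sub>R v"
            by (simp add: x_def algebra_simps)
          ultimately show ?thesis using s by simp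
        qed
        have Az: "P p q z = ?s *\<^sub>R z"
        proof -
          have "P p q z = (1/2) *\<^sub>R ?A + (8 * ?s * (1/16)) *\<^sub>R v" by (simp add: z_def AA)
          moreover have "?s *\<^sub>R z = (8 * (?s * ?s)) *\<^sub>R ?A + (?s / 2) *\<^sub>R v"
            by (simp add: z_def algebra_simps)
          ultimately show ?thesis using s by simp
        qed
        have zm: "z \<in> m" using xz by (simp add: weight_space_def)
        have "x \<in> restricted_space l" using rest xz Ax by blast
        moreover have "- J z \<in> restricted_space l"
        proof (rule rest)
          show "- J z \<in> ?W" using J_weight_space[OF xz(2)] subspace_neg[OF subspace_weight_space] by blast
          show "P p q (- J z) = - ?s *\<^sub>R - J z" using P_J(2)[OF p(1) q(1) pq zm] Az by simp
        qed
        moreover have Jz: "J (- J z) = z" using Z_Z[OF zm] by (simp only: lie_bracket_simps(9) minus_minus)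
        have "v = x + J (- J z)" unfolding Jz by (simp add: x_def z_def scaleR_left_distrib[symmetric])
        ultimately show ?thesis by blast
      qed
    qed
  qed
qed

end

section \<open>Functionals on complexifications\<close>

lemma sum_fun_apply: "(\<Sum>i\<in>A. f i) x = (\<Sum>i\<in>A. f i x :: 'b::comm_monoid_add)"
  by (induction A rule: infinite_finite_induct) auto

lemma cplx_dual_add: "f \<in> cplx_dual V \<Longrightarrow> u \<in> V \<times> V \<Longrightarrow> v \<in> V \<times> V \<Longrightarrow> f (u + v) = f u + f v"
  by (simp only: cplx_dual_def mem_Collect_eq)

lemma cplx_dual_scale: "f \<in> cplx_dual V \<Longrightarrow> u \<in> V \<times> V \<Longrightarrow> f (c *\<^sub>C u) = c * f u"
  by (simp only: cplx_dual_def mem_Collect_eq)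

lemma cplx_dual_outside: "f \<in> cplx_dual V \<Longrightarrow> u \<notin> V \<times> V \<Longrightarrow> f u = 0"
  unfolding cplx_dual_def by blast

text \<open>The argument is a function on the whole algebra, so that \<open>linear\<close> can be
  stated for it; only its values on \<open>V\<close> enter.\<close>

definition complexify :: "'g::real_vector set \<Rightarrow> ('g \<Rightarrow> real) \<Rightarrow> 'g functional" where
  "complexify V c = (\<lambda>u. if u \<in> V \<times> V then Complex (c (fst u)) (c (snd u)) else 0)"

context
  fixes V :: "'g::real_vector set"
  assumes V: "subspace V"
begin

lemma cplx_of_mem: "x \<in> V \<Longrightarrow> cplx_of x \<in> V \<times> V"
  using subspace_0[OF V] by (simp add: cplx_of_def)

lemma cplx_dual_cplx_of:
  assumes f: "f \<in> cplx_dual V" and x: "x \<in> V"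
  shows "y \<in> V \<Longrightarrow> f (cplx_of (x + y)) = f (cplx_of x) + f (cplx_of y)"
    and "f (cplx_of (c *\<^sub>R x)) = of_real c * f (cplx_of x)"
proof -
  have "cplx_of (x + y) = cplx_of x + cplx_of y" by (simp add: cplx_of_def)
  then show "y \<in> V \<Longrightarrow> f (cplx_of (x + y)) = f (cplx_of x) + f (cplx_of y)"
    using cplx_dual_add[OF f] cplx_of_mem x by simp
  have "cplx_of (c *\<^sub>R x) = of_real c *\<^sub>C cplx_of x" by (simp add: cplx_of_def cplx_scale_def)
  then show "f (cplx_of (c *\<^sub>R x)) = of_real c * f (cplx_of x)"
    using cplx_dual_scale[OF f] cplx_of_mem x by simp
qed

lemma cplx_dual_split:
  assumes f: "f \<in> cplx_dual V" and u: "u \<in> V \<times> V"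
  shows "f u = f (cplx_of (fst u)) + \<i> * f (cplx_of (snd u))"
proof -
  have m: "fst u \<in> V" "snd u \<in> V" using u by auto
  have "u = cplx_of (fst u) + \<i> *\<^sub>C cplx_of (snd u)"
    by (simp add: cplx_of_def cplx_scale_def prod_eq_iff)
  then have "f u = f (cplx_of (fst u) + \<i> *\<^sub>C cplx_of (snd u))" by simp
  also have "\<dots> = f (cplx_of (fst u)) + f (\<i> *\<^sub>C cplx_of (snd u))"
    using m by (intro cplx_dual_add[OF f]) (auto simp: cplx_of_def cplx_scale_def subspace_0[OF V])
  finally show ?thesis using cplx_dual_scale[OF f] cplx_of_mem m by simp
qed

lemma cplx_dual_eqI:
  assumes "f \<in> cplx_dual V" "g \<in> cplx_dual V"
    and "\<And>x. x \<in> V \<Longrightarrow> f (cplx_of x) = g (cplx_of x)"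
  shows "f = g"
proof
  fix u
  show "f u = g u"
    using assms cplx_dual_split[of f u] cplx_dual_split[of g u] cplx_dual_outside[of f V u] cplx_dual_outside[of g V u]
    by (cases "u \<in> V \<times> V") auto
qed

lemma cplx_dual_eq_on_spanning:
  assumes f: "f \<in> cplx_dual V" and g: "g \<in> cplx_dual V" and S: "V = span S"
    and eq: "\<And>x. x \<in> S \<Longrightarrow> f (cplx_of x) = g (cplx_of x)"
  shows "f = g"
proof (rule cplx_dual_eqI[OF f g])
  have 0: "h (cplx_of 0) = 0" if "h \<in> cplx_dual V" for h
    using cplx_dual_cplx_of(2)[OF that subspace_0[OF V], of 0] by simp
  fix x assume "x \<in> V"
  then have "x \<in> span S" using S by simp
  then have "x \<in> V \<and> f (cplx_of x) = g (cplx_of x)"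
  proof (induction rule: span_induct_alt)
    case base
    then show ?case using 0[OF f] 0[OF g] subspace_0[OF V] by simp
  next
    case (step c x y)
    have x: "x \<in> V" using step(1) S span_base by blast
    then have "c *\<^sub>R x \<in> V" using V subspace_scale by blast
    then show ?case
      using step x cplx_dual_cplx_of[OF f] cplx_dual_cplx_of[OF g] eq[OF step(1)] V
      by (auto simp: subspace_add)
  qed
  then show "f (cplx_of x) = g (cplx_of x)" ..
qed

end

lemma complexify_cplx_dual:
  assumes V: "subspace V" and c: "linear c"
  shows "complexify V c \<in> cplx_dual V"
proof -
  have "complexify V c (d *\<^sub>C u) = d * complexify V c u" if "u \<in> V \<times> V" for d u
  proof -
    have "d *\<^sub>C u \<in> V \<times> V"
      using that V by (auto simp: cplx_scale_def subspace_add subspace_diff subspace_scale)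
    then show ?thesis using that c
      by (auto simp: complexify_def cplx_scale_def complex_eq_iff linear_add linear_diff linear_scale)
  qed
  moreover have "complexify V c (u + v) = complexify V c u + complexify V c v"
    if "u \<in> V \<times> V" "v \<in> V \<times> V" for u v
    using that V c
    by (auto simp: complexify_def complex_eq_iff linear_add subspace_add)
  moreover have "complexify V c u = 0" if "u \<notin> V \<times> V" for u
    using that by (simp add: complexify_def)
  ultimately show ?thesis unfolding cplx_dual_def by blast
qed

lemma complexify_cplx_of: "subspace V \<Longrightarrow> linear c \<Longrightarrow> x \<in> V \<Longrightarrow> complexify V c (cplx_of x) = of_real (c x)"
  by (simp add: complexify_def cplx_of_def subspace_0 linear_0 complex_eq_iff)

lemma fun_scale_cplx_dual: "f \<in> cplx_dual V \<Longrightarrow> c *\<^sub>F f \<in> cplx_dual V"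
  by (simp add: cplx_dual_def fun_scale_def algebra_simps)

lemma add_cplx_dual: "f \<in> cplx_dual V \<Longrightarrow> g \<in> cplx_dual V \<Longrightarrow> f + g \<in> cplx_dual V"
  by (simp add: cplx_dual_def algebra_simps)

lemma diff_cplx_dual: "f \<in> cplx_dual V \<Longrightarrow> g \<in> cplx_dual V \<Longrightarrow> f - g \<in> cplx_dual V"
  by (simp add: cplx_dual_def fun_diff_def algebra_simps)

lemma restrict_functional_cplx_dual:
  assumes V: "subspace V" and f: "f \<in> cplx_dual W" and "V \<subseteq> W"
  shows "restrict_functional V f \<in> cplx_dual V"
proof -
  have W: "u \<in> W \<times> W" if "u \<in> V \<times> V" for u using that assms(3) by auto
  have "d *\<^sub>C u \<in> V \<times> V" if "u \<in> V \<times> V" for d u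
    using that V by (auto simp: cplx_scale_def subspace_add subspace_diff subspace_scale)
  moreover have "u + v \<in> V \<times> V" if "u \<in> V \<times> V" "v \<in> V \<times> V" for u v
    using that V by (auto simp: subspace_add)
  ultimately show ?thesis
    unfolding cplx_dual_def restrict_functional_def
    using cplx_dual_add[OF f] cplx_dual_scale[OF f] W by auto
qed

text \<open>Justifies the description in \<open>dual_basis\<close>. A coordinate function on the
  independent set extends linearly to the whole space, and its complexification is a witness;
  uniqueness holds because the values on a spanning set determine a functional.\<close>

lemma dual_basis_cplx_dual:
  fixes b :: "nat \<Rightarrow> 'g::real_vector"
  assumes V: "V = span (b ` {1..n})" and indep: "independent (b ` {1..n})" and inj: "inj_on b {1..n}"
    and j: "j \<in> {1..n}"
  shows "dual_basis V n b j \<in> cplx_dual V"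
    and "k \<in> {1..n} \<Longrightarrow> dual_basis V n b j (cplx_of (b k)) = (if k = j then 1 else 0)"
proof -
  have sV: "subspace V" unfolding V by (rule subspace_span)
  let ?R = "\<lambda>f. f \<in> cplx_dual V \<and> (\<forall>k\<in>{1..n}. f (cplx_of (b k)) = (if k = j then 1 else 0))"
  obtain c :: "'g \<Rightarrow> real" where c: "linear c" "\<And>x. x \<in> b ` {1..n} \<Longrightarrow> c x = (if x = b j then 1 else 0)"
    using linear_independent_extend[OF indep, of "\<lambda>x. if x = b j then 1 else 0"] by blast
  have "c (b k) = (if k = j then 1 else 0)" if "k \<in> {1..n}" for k
    using c(2)[of "b k"] inj_onD[OF inj, of k j] that j by auto
  moreover have "b k \<in> V" if "k \<in> {1..n}" for k unfolding V using that by (intro span_base) auto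
  ultimately have R: "?R (complexify V c)"
    using complexify_cplx_dual[OF sV c(1)] complexify_cplx_of[OF sV c(1)] by simp
  have "?R (dual_basis V n b j)"
    unfolding dual_basis_def
  proof (rule theI[of ?R, OF R])
    show "f = complexify V c" if "?R f" for f
      using that R by (intro cplx_dual_eq_on_spanning[OF sV _ _ V]) auto
  qed
  then show "dual_basis V n b j \<in> cplx_dual V"
    and "k \<in> {1..n} \<Longrightarrow> dual_basis V n b j (cplx_of (b k)) = (if k = j then 1 else 0)" by auto
qed

text \<open>
  The root vector is \<open>x - \<i>y\<close>.
\<close>

lemma rotation_root:
  assumes V: "subspace V" and a: "linear a"
    and x: "\<And>h. h \<in> V \<Longrightarrow> [h,x]\<^sub>L = a h *\<^sub>R y" and y: "\<And>h. h \<in> V \<Longrightarrow> [h,y]\<^sub>L = - a h *\<^sub>R x"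
    and nz: "x \<noteq> 0 \<or> y \<noteq> 0" and h0: "h0 \<in> V" "a h0 \<noteq> 0"
  shows "\<i> *\<^sub>F complexify V a \<in> roots V"
proof -
  let ?f = "\<i> *\<^sub>F complexify V a"
  have "(x, - y) \<in> root_space V ?f"
    using x y by (auto simp: root_space_def cplx_bracket_def cplx_scale_def fun_scale_def
        complexify_def algebra_simps)
  moreover have "(x, - y) \<noteq> 0" using nz by (simp add: prod_eq_iff)
  ultimately have "root_space V ?f \<noteq> {0}" by auto
  moreover have "?f (cplx_of h0) \<noteq> 0"
    using complexify_cplx_of[OF V a h0(1)] h0(2) by (simp add: fun_scale_def)
  then have "?f \<noteq> 0" by (metis zero_fun_apply)
  ultimately show ?thesis
    using fun_scale_cplx_dual[OF complexify_cplx_dual[OF V a]] by (simp add: roots_def)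
qed

section \<open>Root decomposition of the tangent space\<close>

locale compact_hermitian =
  fixes k m t :: "'g::lie_algebra set" and l :: nat and \<alpha>\<^sub>s :: "nat \<Rightarrow> 'g functional"
    and H E :: "'g functional \<Rightarrow> 'g \<times> 'g" and Z :: 'g
  assumes compact_simple: "compact_simple_lie_algebra TYPE('g)"
    and decomposition: "hermitian_symmetric_decomposition k m"
    and cartan: "cartan_subalgebra k t"
    and simple_roots: "hermitian_simple_roots k t l \<alpha>\<^sub>s"
    and root_vectors: "root_vectors t (positive_roots t l \<alpha>\<^sub>s) H E"
    and Z_center: "Z \<in> lie_center k" and Z_simple: "\<alpha>\<^sub>s 1 (cplx_of Z) = \<i>"
    and l_pos: "1 \<le> l"
begin

sublocale inner_form "lie_form :: 'g \<Rightarrow> 'g \<Rightarrow> real"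
  by (rule inner_form_lie_form[OF compact_simple])

lemma
  shows subspace_k: "subspace k" and subspace_m: "subspace m" and k_m_disjoint: "k \<inter> m = {0}"
    and k_m_sum: "\<exists>a\<in>k. \<exists>b\<in>m. x = a + b"
    and bracket_km: "x \<in> k \<Longrightarrow> y \<in> m \<Longrightarrow> [x,y]\<^sub>L \<in> m"
    and bracket_mm: "x \<in> m \<Longrightarrow> y \<in> m \<Longrightarrow> [x,y]\<^sub>L \<in> k"
proof -
  note d = decomposition[unfolded hermitian_symmetric_decomposition_def lie_subalgebra_def]
  show "subspace k" "subspace m" "k \<inter> m = {0}" using d by auto
  show "x \<in> k \<Longrightarrow> y \<in> m \<Longrightarrow> [x,y]\<^sub>L \<in> m"
    "x \<in> m \<Longrightarrow> y \<in> m \<Longrightarrow> [x,y]\<^sub>L \<in> k" using d by auto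
  have "x \<in> {x + y | x y. x \<in> k \<and> y \<in> m}" using d by auto
  then show "\<exists>a\<in>k. \<exists>b\<in>m. x = a + b" by auto
qed

lemma Z_in_k: "Z \<in> k" and Z_central: "u \<in> k \<Longrightarrow> [Z,u]\<^sub>L = 0"
  using Z_center by (auto simp: lie_center_def)

lemma subspace_t: "subspace t" and t_subset_k: "t \<subseteq> k"
  using cartan by (auto simp: cartan_subalgebra_def nilpotent_lie_subalgebra_def lie_subalgebra_def)

text \<open>A skew operator is nilpotent only if it vanishes.\<close>

lemma t_abelian:
  assumes x: "x \<in> t" and y: "y \<in> t"
  shows "[x,y]\<^sub>L = 0"
proof -
  let ?A = "\<lambda>v. [x,v]\<^sub>L"
  have t: "[u,v]\<^sub>L \<in> t" if "u \<in> t" "v \<in> t" for u v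
    using cartan that
    by (auto simp: cartan_subalgebra_def nilpotent_lie_subalgebra_def lie_subalgebra_def)
  obtain n where n: "lower_central_series t n = {0}"
    using cartan by (auto simp: cartan_subalgebra_def nilpotent_lie_subalgebra_def)
  have "(?A ^^ n) y \<in> lower_central_series t n"
    by (induction n) (use x y in \<open>auto intro!: span_base\<close>)
  then have "(?A ^^ n) y = 0" using n by simp
  then have "(?A ^^ Suc n) y = 0" by simp
  then show ?thesis
  proof (induction n)
    case (Suc n)
    let ?w = "(?A ^^ n) y"
    have "[x,[x,?w]\<^sub>L]\<^sub>L = 0" using Suc.prems by simp
    then have "lie_form [x,?w]\<^sub>L [x,?w]\<^sub>L = 0" by (simp add: lie_form_invariant)
    then have "[x,?w]\<^sub>L = 0" by (rule B_eq_0_iff[THEN iffD1])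
    then show ?case by (intro Suc.IH) simp
  qed simp
qed

text \<open>What commutes with \<open>t\<close> normalizes it, and \<open>t\<close> is its own
  normalizer in \<open>k\<close>.\<close>

lemma centralizer_t:
  assumes "u \<in> k" "\<And>y. y \<in> t \<Longrightarrow> [u,y]\<^sub>L = 0" shows "u \<in> t"
  using cartan assms subspace_0[OF subspace_t] by (auto simp: cartan_subalgebra_def)

lemma Z_in_t: "Z \<in> t"
  using centralizer_t[OF Z_in_k] Z_central t_subset_k by blast

lemma bracket_t_t: "x \<in> t \<Longrightarrow> y \<in> t \<Longrightarrow> [x,[y,v]\<^sub>L]\<^sub>L = [y,[x,v]\<^sub>L]\<^sub>L"
  using bracket_bracket_right[of x y v] t_abelian by simp

section \<open>Root coefficients and the values of roots at the central element\<close>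

lemma simple_root: "j \<in> {1..l} \<Longrightarrow> \<alpha>\<^sub>s j \<in> roots t"
  using simple_roots by (auto simp: hermitian_simple_roots_def simple_root_system_def)

lemma root_coeff_eqI:
  assumes "\<alpha> = (\<Sum>j\<in>{1..l}. of_int (n j) *\<^sub>F \<alpha>\<^sub>s j)" "\<And>j. j \<notin> {1..l} \<Longrightarrow> n j = 0"
  shows "root_coeff l \<alpha>\<^sub>s \<alpha> = n"
  unfolding root_coeff_def
proof (rule the_equality)
  fix n' :: "nat \<Rightarrow> int"
  assume n': "\<alpha> = (\<Sum>j\<in>{1..l}. of_int (n' j) *\<^sub>F \<alpha>\<^sub>s j) \<and> (\<forall>j. j \<notin> {1..l} \<longrightarrow> n' j = 0)"
  have "(\<Sum>j\<in>{1..l}. of_real (of_int (n' j - n j)) *\<^sub>F \<alpha>\<^sub>s j) = 0"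
  proof
    fix u
    have "(\<Sum>j\<in>{1..l}. of_int (n' j) *\<^sub>F \<alpha>\<^sub>s j) u = (\<Sum>j\<in>{1..l}. of_int (n j) *\<^sub>F \<alpha>\<^sub>s j) u"
      using n' assms(1) by simp
    then show "(\<Sum>j\<in>{1..l}. of_real (of_int (n' j - n j)) *\<^sub>F \<alpha>\<^sub>s j) u = 0 u"
      by (simp add: sum_fun_apply fun_scale_def left_diff_distrib sum_subtractf)
  qed
  then have "\<forall>j\<in>{1..l}. real_of_int (n' j - n j) = 0"
    using simple_roots unfolding hermitian_simple_roots_def simple_root_system_def by meson
  then show "n' = n" using n' assms(2) by (metis eq_iff_diff_eq_0 of_int_eq_0_iff ext)
qed (use assms in auto)

lemma root_expansion:
  assumes "\<alpha> \<in> roots t"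
  shows "\<alpha> = (\<Sum>j\<in>{1..l}. of_int (root_coeff l \<alpha>\<^sub>s \<alpha> j) *\<^sub>F \<alpha>\<^sub>s j)"
    and "(\<forall>j\<in>{1..l}. 0 \<le> root_coeff l \<alpha>\<^sub>s \<alpha> j) \<or> (\<forall>j\<in>{1..l}. root_coeff l \<alpha>\<^sub>s \<alpha> j \<le> 0)"
proof -
  obtain n :: "nat \<Rightarrow> int" where n: "\<alpha> = (\<Sum>j\<in>{1..l}. of_int (n j) *\<^sub>F \<alpha>\<^sub>s j)"
    "(\<forall>j\<in>{1..l}. 0 \<le> n j) \<or> (\<forall>j\<in>{1..l}. n j \<le> 0)"
    using simple_roots assms unfolding hermitian_simple_roots_def simple_root_system_def by meson
  let ?n = "\<lambda>j. if j \<in> {1..l} then n j else 0"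
  have "\<alpha> = (\<Sum>j\<in>{1..l}. of_int (?n j) *\<^sub>F \<alpha>\<^sub>s j)"
    unfolding n(1) by (rule sum.cong) auto
  then have "root_coeff l \<alpha>\<^sub>s \<alpha> = ?n" by (intro root_coeff_eqI) auto
  then show "\<alpha> = (\<Sum>j\<in>{1..l}. of_int (root_coeff l \<alpha>\<^sub>s \<alpha> j) *\<^sub>F \<alpha>\<^sub>s j)"
    and "(\<forall>j\<in>{1..l}. 0 \<le> root_coeff l \<alpha>\<^sub>s \<alpha> j) \<or> (\<forall>j\<in>{1..l}. root_coeff l \<alpha>\<^sub>s \<alpha> j \<le> 0)"
    using n \<open>\<alpha> = (\<Sum>j\<in>{1..l}. of_int (?n j) *\<^sub>F \<alpha>\<^sub>s j)\<close> by auto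
qed

text \<open>A simple root other than the first has first coefficient 0, so it is a root of
  \<open>k\<close> and vanishes on the center. Only the first coefficient is visible at
  \<open>Z\<close>.\<close>

lemma root_at_Z:
  assumes "\<alpha> \<in> roots t"
  shows "\<alpha> (cplx_of Z) = of_int (root_coeff l \<alpha>\<^sub>s \<alpha> 1) * \<i>"
proof -
  have other: "\<alpha>\<^sub>s j (cplx_of Z) = 0" if j: "j \<in> {1..l}" "j \<noteq> 1" for j
  proof -
    have "\<alpha>\<^sub>s j = (\<Sum>i\<in>{1..l}. of_int (if i = j then 1 else 0) *\<^sub>F \<alpha>\<^sub>s i)"
    proof
      fix u
      have "(\<Sum>i\<in>{1..l}. of_int (if i = j then 1 else 0) *\<^sub>F \<alpha>\<^sub>s i) u
          = (\<Sum>i\<in>{1..l}. if i = j then \<alpha>\<^sub>s i u else 0)"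
        unfolding sum_fun_apply fun_scale_def by (rule sum.cong) auto
      then show "\<alpha>\<^sub>s j u = (\<Sum>i\<in>{1..l}. of_int (if i = j then 1 else 0) *\<^sub>F \<alpha>\<^sub>s i) u"
        using j by simp
    qed
    then have "root_coeff l \<alpha>\<^sub>s (\<alpha>\<^sub>s j) = (\<lambda>i. if i = j then 1 else 0)"
      by (rule root_coeff_eqI) (use j in auto)
    then have "\<alpha>\<^sub>s j \<in> roots_k k t"
      using j simple_root simple_roots by (simp add: hermitian_simple_roots_def)
    then show ?thesis using Z_center by (simp add: roots_k_def)
  qed
  let ?n = "root_coeff l \<alpha>\<^sub>s \<alpha>"
  have "\<alpha> (cplx_of Z) = (\<Sum>j\<in>{1..l}. of_int (?n j) * \<alpha>\<^sub>s j (cplx_of Z))"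
    by (subst root_expansion(1)[OF assms]) (simp add: sum_fun_apply fun_scale_def)
  also have "\<dots> = (\<Sum>j\<in>{1..l}. if j = 1 then of_int (?n 1) * \<i> else 0)"
    using other Z_simple by (intro sum.cong refl) auto
  finally show ?thesis using l_pos by simp
qed

lemma root_Z_values:
  assumes "\<alpha> \<in> roots t" shows "\<alpha> (cplx_of Z) \<in> {0, \<i>, - \<i>}"
  using root_at_Z[OF assms] simple_roots assms by (auto simp: hermitian_simple_roots_def)

text \<open>Once the first coefficient is 1, the sign dichotomy makes all coefficients nonnegative.
  The condition at \<open>Z\<close> is the form in which the eigenvalue computations below produce
  roots.\<close>

lemma positive_roots_m_iff:
  "\<alpha> \<in> positive_roots_m k t l \<alpha>\<^sub>s \<longleftrightarrow> \<alpha> \<in> roots t \<and> \<alpha> (cplx_of Z) = \<i>"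
proof
  assume "\<alpha> \<in> positive_roots_m k t l \<alpha>\<^sub>s"
  then have \<alpha>: "\<alpha> \<in> roots t" "\<alpha> \<notin> roots_k k t" "0 \<le> root_coeff l \<alpha>\<^sub>s \<alpha> 1"
    using l_pos by (auto simp: positive_roots_m_def roots_m_def positive_roots_def)
  then have "root_coeff l \<alpha>\<^sub>s \<alpha> 1 = 1"
    using simple_roots by (auto simp: hermitian_simple_roots_def)
  then show "\<alpha> \<in> roots t \<and> \<alpha> (cplx_of Z) = \<i>" using root_at_Z[OF \<alpha>(1)] \<alpha>(1) by simp
next
  assume \<alpha>: "\<alpha> \<in> roots t \<and> \<alpha> (cplx_of Z) = \<i>"
  then have "of_int (root_coeff l \<alpha>\<^sub>s \<alpha> 1) * \<i> = \<i>" using root_at_Z by simp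
  then have 1: "root_coeff l \<alpha>\<^sub>s \<alpha> 1 = 1" by (simp add: complex_eq_iff)
  then have "\<alpha> \<notin> roots_k k t" using simple_roots by (auto simp: hermitian_simple_roots_def)
  moreover have "\<forall>j\<in>{1..l}. 0 \<le> root_coeff l \<alpha>\<^sub>s \<alpha> j"
    using root_expansion(2)[OF \<alpha>[THEN conjunct1]]
  proof
    assume "\<forall>j\<in>{1..l}. root_coeff l \<alpha>\<^sub>s \<alpha> j \<le> 0"
    then have "root_coeff l \<alpha>\<^sub>s \<alpha> 1 \<le> 0" using l_pos by simp
    then show ?thesis using 1 by simp
  qed
  ultimately show "\<alpha> \<in> positive_roots_m k t l \<alpha>\<^sub>s"
    using \<alpha> by (simp add: positive_roots_m_def roots_m_def positive_roots_def)
qed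

text \<open>\<open>Z\<close> is nonzero because \<open>\<alpha>_1(Z) = i\<close>, so it spans the
  one-dimensional center, whose centralizer is \<open>k\<close>.\<close>

lemma centralizer_Z: "[Z,x]\<^sub>L = 0 \<Longrightarrow> x \<in> k"
proof -
  assume x: "[Z,x]\<^sub>L = 0"
  have d: "dim (lie_center k) = 1" "lie_centralizer (lie_center k) = k"
    using decomposition by (auto simp: hermitian_symmetric_decomposition_def)
  have "\<alpha>\<^sub>s 1 \<in> cplx_dual t" using simple_root l_pos by (simp add: roots_def)
  from cplx_dual_cplx_of(2)[OF subspace_t this Z_in_t, of 0] have "Z \<noteq> 0" using Z_simple by auto
  then have "independent {Z}" by simp
  then have "lie_center k \<subseteq> span {Z}"
    using card_ge_dim_independent[of "{Z}" "lie_center k"] Z_center d(1) by simp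
  moreover have "span {Z} \<subseteq> {z. [x,z]\<^sub>L = 0}"
    using x lie_bracket_anticomm[of x Z] by (intro span_minimal) (auto simp: subspace_def)
  ultimately have "x \<in> lie_centralizer (lie_center k)" by (auto simp: lie_centralizer_def)
  then show "x \<in> k" using d by simp
qed

text \<open>
  Diagonalize the symmetric operators \<open>ad h ad h'\<close> on \<open>m\<close>: with \<open>s\<^sup>2\<close> minus the eigenvalue of
  \<open>(ad Z)\<^sup>2\<close>, a common eigenvector \<open>v\<close> and \<open>ad Z v / s\<close> yield a root with value \<open>i s\<close> at \<open>Z\<close>, so \<open>s = 1\<close>.
\<close>

lemma Z_Z:
  assumes "x \<in> m" shows "[Z,[Z,x]\<^sub>L]\<^sub>L = - x"
proof -
  let ?F = "{\<lambda>v. [h,[h',v]\<^sub>L]\<^sub>L | h h'. h \<in> t \<and> h' \<in> t}"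
  have tm: "[h,v]\<^sub>L \<in> m" if "h \<in> t" "v \<in> m" for h v using bracket_km t_subset_k that by blast
  have "m \<subseteq> span {v\<in>m. v \<noteq> 0 \<and> (\<forall>A\<in>?F. \<exists>c. A v = c *\<^sub>R v)}"
  proof (rule simultaneous_diagonalization[OF subspace_m])
    show "linear A" if "A \<in> ?F" for A using that by (auto intro!: linearI)
    show "A v \<in> m" if "A \<in> ?F" "v \<in> m" for A v using that tm by auto
    show "lie_form (A v) w = lie_form v (A w)" if A: "A \<in> ?F" for A v w
    proof -
      obtain h h' where h: "h \<in> t" "h' \<in> t" "A = (\<lambda>v. [h,[h',v]\<^sub>L]\<^sub>L)" using A by blast
      then show ?thesis using bracket_t_t[of h h' w] by (simp add: lie_form_invariant)
    qed
    show "A (C v) = C (A v)" if AC: "A \<in> ?F" "C \<in> ?F" for A C v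
    proof -
      obtain h h' g g' where h: "h \<in> t" "h' \<in> t" "A = (\<lambda>v. [h,[h',v]\<^sub>L]\<^sub>L)"
        "g \<in> t" "g' \<in> t" "C = (\<lambda>v. [g,[g',v]\<^sub>L]\<^sub>L)" using AC by blast
      show ?thesis unfolding h(3,6)
        by (simp only: bracket_t_t[OF h(2,4)] bracket_t_t[OF h(2,5)] bracket_t_t[OF h(1,4)]
            bracket_t_t[OF h(1,5)])
    qed
  qed
  also have "\<dots> \<subseteq> {x. [Z,[Z,x]\<^sub>L]\<^sub>L = - x}"
  proof (rule span_minimal, rule subsetI)
    fix v assume v: "v \<in> {v\<in>m. v \<noteq> 0 \<and> (\<forall>A\<in>?F. \<exists>c. A v = c *\<^sub>R v)}"
    then have vm: "v \<in> m" "v \<noteq> 0" by auto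
    \<comment> \<open>The eigenvalue of \<open>ad h ad Z\<close> is written as a quotient that makes
      sense for every \<open>h\<close>, because \<open>rotation_root\<close> asks for a functional
      that is linear on the whole algebra.\<close>
    define c where "c h = lie_form [h,[Z,v]\<^sub>L]\<^sub>L v / lie_form v v" for h
    have c: "[h,[Z,v]\<^sub>L]\<^sub>L = c h *\<^sub>R v" if "h \<in> t" for h
    proof -
      have F: "(\<lambda>v. [h,[Z,v]\<^sub>L]\<^sub>L) \<in> ?F" using that Z_in_t by blast
      have "\<forall>A\<in>?F. \<exists>c. A v = c *\<^sub>R v" using v by simp
      from bspec[OF this F] have "\<exists>d. [h,[Z,v]\<^sub>L]\<^sub>L = d *\<^sub>R v" .
      then show ?thesis using vm(2) B_pos[OF vm(2)] by (auto simp: c_def)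
    qed
    have "[Z,v]\<^sub>L \<noteq> 0" using centralizer_Z[of v] vm k_m_disjoint by blast
    then have "lie_form [Z,v]\<^sub>L [Z,v]\<^sub>L > 0" by (rule B_pos)
    then have "- c Z > 0" using B_pos[OF vm(2)] by (simp add: c_def lie_form_invariant divide_neg_pos)
    define s where "s = sqrt (- c Z)"
    have s: "s > 0" "s * s = - c Z" using \<open>- c Z > 0\<close> by (auto simp: s_def)
    define y where "y = (1 / s) *\<^sub>R [Z,v]\<^sub>L"
    define a where "a h = - c h / s" for h
    have lin: "linear a"
      by (rule linearI) (auto simp: a_def c_def add_divide_distrib diff_divide_distrib)
    have hx: "[h,v]\<^sub>L = a h *\<^sub>R y" if h: "h \<in> t" for h
    proof -
      have "c Z *\<^sub>R [h,v]\<^sub>L = [h,[Z,[Z,v]\<^sub>L]\<^sub>L]\<^sub>L" using c[OF Z_in_t] by simp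
      also have "\<dots> = c h *\<^sub>R [Z,v]\<^sub>L" using c[OF h] bracket_t_t[OF h Z_in_t, of "[Z,v]\<^sub>L"] by simp
      also have "[Z,v]\<^sub>L = s *\<^sub>R y" using s by (simp add: y_def)
      finally have "(s * s) *\<^sub>R [h,v]\<^sub>L = - (c h * s) *\<^sub>R y" using s(2) by simp
      then have "(1 / (s * s)) *\<^sub>R ((s * s) *\<^sub>R [h,v]\<^sub>L) = (1 / (s * s)) *\<^sub>R (- (c h * s) *\<^sub>R y)" by simp
      then show ?thesis using s(1) by (simp add: a_def)
    qed
    have hy: "[h,y]\<^sub>L = - a h *\<^sub>R v" if h: "h \<in> t" for h
      using c[OF h] by (simp add: y_def a_def)
    have aZ: "a Z = s" using s by (simp add: a_def field_simps)
    have "\<i> *\<^sub>F complexify t a \<in> roots t"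
      using rotation_root[OF subspace_t lin hx hy _ Z_in_t] vm(2) aZ s(1) by simp
    moreover have "(\<i> *\<^sub>F complexify t a) (cplx_of Z) = \<i> * of_real s"
      using complexify_cplx_of[OF subspace_t lin Z_in_t] aZ by (simp add: fun_scale_def)
    ultimately have "s = 1" using root_Z_values s(1) by (fastforce simp: complex_eq_iff)
    then show "v \<in> {x. [Z,[Z,x]\<^sub>L]\<^sub>L = - x}" using c[OF Z_in_t] s(2) by simp
  qed (auto simp: subspace_def)
  finally show ?thesis using assms by blast
qed

sublocale hermitian_lie "lie_form :: 'g \<Rightarrow> 'g \<Rightarrow> real" k m Z
  by unfold_locales
    (auto simp: lie_form_invariant subspace_k subspace_m bracket_km bracket_mm Z_in_k Z_central Z_Z)

section \<open>Real root vectors and the planes they span\<close>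

abbreviation angle :: "'g functional \<Rightarrow> 'g \<Rightarrow> real" where
  "angle \<alpha> h \<equiv> Im (\<alpha> (cplx_of h))"

text \<open>Reality of the three combinations means \<open>E \<alpha> = X - i Y\<close>,
  \<open>E (-\<alpha>) = X + i Y\<close> and \<open>H \<alpha> = -2 i T\<close>, so the complex
  bracket relations split into real ones. Comparing the root equations for \<open>\<alpha>\<close>
  and \<open>-\<alpha>\<close> shows that \<open>\<alpha>\<close> is imaginary on
  \<open>t\<close>.\<close>

lemma root_vectors_real:
  assumes \<alpha>: "\<alpha> \<in> positive_roots_m k t l \<alpha>\<^sub>s"
  defines "X \<equiv> vec_X E \<alpha>" and "Y \<equiv> vec_Y E \<alpha>" and "T \<equiv> vec_T H \<alpha>"
  shows "X \<in> m" "X \<noteq> 0" "Y = J X" "T = [X,J X]\<^sub>L" "T \<in> t" "[T,X]\<^sub>L = J X"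
    and "\<And>h. h \<in> t \<Longrightarrow> \<alpha> (cplx_of h) = \<i> * of_real (angle \<alpha> h)"
    and "\<And>h. h \<in> t \<Longrightarrow> [h,X]\<^sub>L = angle \<alpha> h *\<^sub>R J X"
proof -
  have \<alpha>r: "\<alpha> \<in> cplx_dual t" and \<alpha>Z: "\<alpha> (cplx_of Z) = \<i>"
    using \<alpha> positive_roots_m_iff by (auto simp: roots_def)
  have "\<alpha> \<in> positive_roots t l \<alpha>\<^sub>s" using \<alpha> by (simp add: positive_roots_m_def)
  note rv = root_vectors[unfolded root_vectors_def, rule_format, OF this]
  have r1: "fst (E \<alpha>) = fst (E (- \<alpha>))" "snd (E (- \<alpha>)) = - snd (E \<alpha>)" "fst (H \<alpha>) = 0"
    using rv by (auto simp: cplx_of_def cplx_scale_def prod_eq_iff eq_neg_iff_add_eq_0 add.commute)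
  have "X = (1/2) *\<^sub>R (fst (E \<alpha>) + fst (E \<alpha>))"
    unfolding X_def vec_X_def using r1 by (simp add: cplx_scale_def)
  then have Xf: "X = fst (E \<alpha>)" by (simp add: scaleR_2[symmetric])
  have "Y = - ((1/2) *\<^sub>R (snd (E \<alpha>) + snd (E \<alpha>)))"
    unfolding Y_def vec_Y_def using r1 by (simp add: cplx_scale_def)
  then have Yf: "Y = - snd (E \<alpha>)" by (simp add: scaleR_2[symmetric])
  have Tf: "T = - (1/2) *\<^sub>R snd (H \<alpha>)" unfolding T_def vec_T_def by (simp add: cplx_scale_def)
  have E: "E \<alpha> = (X, - Y)" "E (- \<alpha>) = (X, Y)" "H \<alpha> = (0, - 2 *\<^sub>R T)"
    using r1 Xf Yf Tf by (auto simp: prod_eq_iff)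
  have XY0: "X \<noteq> 0 \<or> Y \<noteq> 0" using rv E by (auto simp: prod_eq_iff)
  have hX: "\<alpha> (cplx_of h) = \<i> * of_real (angle \<alpha> h) \<and> [h,X]\<^sub>L = angle \<alpha> h *\<^sub>R Y
      \<and> [h,Y]\<^sub>L = - angle \<alpha> h *\<^sub>R X" if h: "h \<in> t" for h
  proof -
    let ?z = "\<alpha> (cplx_of h)"
    have "cplx_of h \<in> t \<times> t" by (rule cplx_of_mem[OF subspace_t h])
    then have "[cplx_of h,E \<alpha>]\<^sub>C = ?z *\<^sub>C E \<alpha>" "[cplx_of h,E (- \<alpha>)]\<^sub>C = (- \<alpha>) (cplx_of h) *\<^sub>C E (- \<alpha>)"
      using rv by (auto simp: root_space_def)
    then have e: "[h,X]\<^sub>L = Re ?z *\<^sub>R X + Im ?z *\<^sub>R Y" "- [h,Y]\<^sub>L = - (Re ?z *\<^sub>R Y) + Im ?z *\<^sub>R X"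
      "[h,X]\<^sub>L = - (Re ?z *\<^sub>R X) + Im ?z *\<^sub>R Y" "[h,Y]\<^sub>L = - (Re ?z *\<^sub>R Y) - Im ?z *\<^sub>R X"
      unfolding E by (auto simp: cplx_bracket_def cplx_of_def cplx_scale_def)
    have neg: "x = 0" if "x = - x" for x :: 'g
    proof -
      have "2 *\<^sub>R x = 0" using that by (simp only: scaleR_2 eq_neg_iff_add_eq_0)
      then show ?thesis by simp
    qed
    have "Re ?z *\<^sub>R X = 0" using e(1,3) by (intro neg) simp
    moreover have "Re ?z *\<^sub>R Y = 0" using e(2,4) by (intro neg) simp
    ultimately have "Re ?z = 0" using XY0 by auto
    then show ?thesis using e by (simp add: complex_eq_iff)
  qed
  show "\<And>h. h \<in> t \<Longrightarrow> \<alpha> (cplx_of h) = \<i> * of_real (angle \<alpha> h)" using hX by blast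
  have ZX: "J X = Y" "J Y = - X" using hX[OF Z_in_t] \<alpha>Z by auto
  show YJ: "Y = J X" using ZX by simp
  show "\<And>h. h \<in> t \<Longrightarrow> [h,X]\<^sub>L = angle \<alpha> h *\<^sub>R J X" using hX ZX by simp
  \<comment> \<open>\<open>J\<close> kills \<open>k\<close>, hence maps the whole algebra into
    \<open>m\<close>. This is what places \<open>X = - J Y\<close> in \<open>m\<close>.\<close>
  have Zm: "J x \<in> m" for x
    using k_m_sum[of x] Z_central J_in_m by fastforce
  have "X = - J Y" using ZX by simp
  then show "X \<in> m" using subspace_neg[OF subspace_m Zm] by simp
  show "X \<noteq> 0" using XY0 ZX by auto
  have "[E \<alpha>,E (- \<alpha>)]\<^sub>C = - H \<alpha>" using rv by blast
  then have "2 *\<^sub>R [X,Y]\<^sub>L = 2 *\<^sub>R T"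
    unfolding E using lie_bracket_anticomm[of Y X] by (simp add: cplx_bracket_def scaleR_2)
  then show "T = [X,J X]\<^sub>L" using ZX by simp
  obtain h where h: "h \<in> t" "H \<alpha> = \<i> *\<^sub>C cplx_of h" using rv by blast
  then have "T = - (1/2) *\<^sub>R h" unfolding Tf by (simp add: cplx_of_def cplx_scale_def)
  then show "T \<in> t" using h subspace_scale[OF subspace_t h(1), of "- (1/2)"] by simp
  have "[H \<alpha>,E \<alpha>]\<^sub>C = 2 *\<^sub>C E \<alpha>" using rv by blast
  then have "- (2 *\<^sub>R [T,X]\<^sub>L) = - (2 *\<^sub>R Y)"
    unfolding E by (simp add: cplx_bracket_def cplx_scale_def scaleR_2)
  then have "2 *\<^sub>R [T,X]\<^sub>L = 2 *\<^sub>R Y" by (simp only: neg_equal_iff_equal)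
  then show "[T,X]\<^sub>L = J X" using ZX by simp
qed

text \<open>
  If \<open>v\<close> is orthogonal to \<open>X\<close> and \<open>J X\<close>, then \<open>[v, X]\<close> and \<open>[v, J X]\<close> lie in \<open>t\<close> and are orthogonal
  to \<open>t\<close>, hence vanish; so \<open>T = [X, J X]\<close> annihilates \<open>v\<close>, although it acts on \<open>v\<close> as \<open>J\<close>.
\<close>

lemma root_space_m:
  assumes \<alpha>: "\<alpha> \<in> positive_roots_m k t l \<alpha>\<^sub>s" and v: "v \<in> m"
    and hv: "\<And>h. h \<in> t \<Longrightarrow> [h,v]\<^sub>L = angle \<alpha> h *\<^sub>R J v"
  shows "v \<in> span {vec_X E \<alpha>, vec_Y E \<alpha>}"
proof -
  let ?X = "vec_X E \<alpha>"
  note X = root_vectors_real[OF \<alpha>]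
  have Xpos: "lie_form ?X ?X > 0" using X(2) by (rule B_pos)
  have JX: "J ?X \<in> m" using X(1) J_in_m by blast
  have XJX: "lie_form ?X (J ?X) = 0" "lie_form (J ?X) ?X = 0"
    using lie_form_invariant[of Z ?X ?X] B_sym[of "J ?X" ?X] by auto
  define c where "c = lie_form v ?X / lie_form ?X ?X"
  define d where "d = lie_form v (J ?X) / lie_form ?X ?X"
  define w where "w = v - c *\<^sub>R ?X - d *\<^sub>R J ?X"
  have w: "w \<in> m" unfolding w_def using v X(1) JX by (intro subspace_diff subspace_scale subspace_m)
  have JJ: "J (J ?X) = - ?X" using Z_Z X(1) by blast
  have wo: "lie_form w ?X = 0" "lie_form w (J ?X) = 0"
    using Xpos XJX B_J_J[OF X(1), of ?X] by (auto simp: w_def c_def d_def)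
  have hw: "[h,w]\<^sub>L = angle \<alpha> h *\<^sub>R J w" if h: "h \<in> t" for h
  proof -
    have "[h,J ?X]\<^sub>L = - angle \<alpha> h *\<^sub>R ?X"
      using bracket_k_J[of h ?X] h t_subset_k X(8)[OF h] JJ by auto
    then show ?thesis using hv[OF h] X(8)[OF h] JJ by (simp add: w_def algebra_simps)
  qed
  have hX: "[?X,h]\<^sub>L = - angle \<alpha> h *\<^sub>R J ?X" "[J ?X,h]\<^sub>L = angle \<alpha> h *\<^sub>R ?X" if h: "h \<in> t" for h
    using bracket_k_J[of h ?X] h t_subset_k X(8)[OF h] JJ
      lie_bracket_anticomm[of ?X h] lie_bracket_anticomm[of "J ?X" h] by auto
  have zero: "[y,w]\<^sub>L = 0" if y: "y \<in> m" "\<And>h. h \<in> t \<Longrightarrow> [h,y]\<^sub>L = angle \<alpha> h *\<^sub>R J y"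
    "\<And>h. h \<in> t \<Longrightarrow> lie_form w [y,h]\<^sub>L = 0" for y
  proof -
    have "[y,w]\<^sub>L \<in> t"
    proof (rule centralizer_t)
      show "[y,w]\<^sub>L \<in> k" using y w by (intro bracket_mm)
      fix h assume h: "h \<in> t"
      have "[h,[y,w]\<^sub>L]\<^sub>L = 0"
        using bracket_bracket_right[of h y w] y(2)[OF h] hw[OF h] bracket_J_left[OF y(1) w] by simp
      then show "[[y,w]\<^sub>L,h]\<^sub>L = 0" using lie_bracket_anticomm[of "[y,w]\<^sub>L" h] by simp
    qed
    then have "lie_form [y,w]\<^sub>L [y,w]\<^sub>L = 0" using y(3) by (simp add: lie_form_invariant)
    then show ?thesis by (rule B_eq_0_iff[THEN iffD1])
  qed
  have "[?X,w]\<^sub>L = 0" using X(1) X(8) hX(1) wo by (intro zero) auto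
  moreover have "[J ?X,w]\<^sub>L = 0"
  proof (rule zero[OF JX])
    show "[h,J ?X]\<^sub>L = angle \<alpha> h *\<^sub>R J (J ?X)" if "h \<in> t" for h
      using hX(2)[OF that] lie_bracket_anticomm[of h "J ?X"] JJ by simp
  qed (use hX(2) wo in auto)
  ultimately have "[[?X,J ?X]\<^sub>L,w]\<^sub>L = 0" by (simp add: bracket_bracket_left[of _ _ w])
  moreover have "angle \<alpha> [?X,J ?X]\<^sub>L = 1"
  proof -
    have "angle \<alpha> [?X,J ?X]\<^sub>L *\<^sub>R J ?X = J ?X"
      using X(8)[OF X(5)] X(6) unfolding X(4) by simp
    then have "(angle \<alpha> [?X,J ?X]\<^sub>L - 1) *\<^sub>R J ?X = 0" by (simp only: scaleR_left_diff_distrib) simp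
    then show ?thesis using J_eq_0_iff[OF X(1)] X(2) by simp
  qed
  ultimately have "J w = 0" using hw[OF X(5)] unfolding X(4) by simp
  then have "w = 0" using J_eq_0_iff w by blast
  then have "v = c *\<^sub>R ?X + d *\<^sub>R vec_Y E \<alpha>" by (simp add: w_def X(3) algebra_simps)
  then show ?thesis by (simp add: span_add span_scale span_base)
qed

text \<open>The operators \<open>v \<mapsto> [h,J v]\<close> commute and are symmetric. A common
  eigenvector in \<open>m\<close> defines a functional whose value at \<open>Z\<close> is i, that
  is, a root in \<open>positive_roots_m\<close>, and \<open>root_space_m\<close> puts the vector
  into the plane of this root. An arbitrary invariant \<open>V\<close> is allowed in order to treat
  each weight space by itself.\<close>

theorem root_decomposition:
  assumes V: "subspace V" "V \<subseteq> m" and inv: "\<And>h v. h \<in> t \<Longrightarrow> v \<in> V \<Longrightarrow> [h,J v]\<^sub>L \<in> V"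
  shows "V \<subseteq> span (\<Union>\<alpha>\<in>positive_roots_m k t l \<alpha>\<^sub>s.
    {v\<in>V. v \<noteq> 0 \<and> v \<in> span {vec_X E \<alpha>, vec_Y E \<alpha>} \<and> (\<forall>h\<in>t. [h,v]\<^sub>L = angle \<alpha> h *\<^sub>R J v)})"
    (is "_ \<subseteq> span ?R")
proof -
  let ?F = "(\<lambda>h v. [h,J v]\<^sub>L) ` t"
  have tJ: "[h,J v]\<^sub>L = J [h,v]\<^sub>L" if "h \<in> t" for h v using bracket_k_J t_subset_k that by blast
  have "V \<subseteq> span {v\<in>V. v \<noteq> 0 \<and> (\<forall>A\<in>?F. \<exists>c. A v = c *\<^sub>R v)}"
  proof (rule simultaneous_diagonalization[OF V(1)])
    show "linear A" if "A \<in> ?F" for A using that by (auto intro!: linearI)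
    show "A v \<in> V" if "A \<in> ?F" "v \<in> V" for A v using that inv by auto
    show "lie_form (A v) w = lie_form v (A w)" if "A \<in> ?F" for A v w
      using that tJ by (auto simp: lie_form_invariant)
    show "A (C v) = C (A v)" if "A \<in> ?F" "C \<in> ?F" for A C v
      using that tJ bracket_t_t by auto
  qed
  also have "\<dots> \<subseteq> span ?R"
  proof (rule span_mono, rule subsetI)
    fix v assume v: "v \<in> {v\<in>V. v \<noteq> 0 \<and> (\<forall>A\<in>?F. \<exists>c. A v = c *\<^sub>R v)}"
    then have vV: "v \<in> V" "v \<noteq> 0" "v \<in> m" using V(2) by auto
    define a where "a h = - lie_form [h,J v]\<^sub>L v / lie_form v v" for h
    have lin: "linear a" by (rule linearI) (auto simp: a_def add_divide_distrib diff_divide_distrib)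
    have hy: "[h,J v]\<^sub>L = - a h *\<^sub>R v" if "h \<in> t" for h
    proof -
      have F: "(\<lambda>v. [h,J v]\<^sub>L) \<in> ?F" using that by blast
      have "\<forall>A\<in>?F. \<exists>c. A v = c *\<^sub>R v" using v by simp
      from bspec[OF this F] have "\<exists>c. [h,J v]\<^sub>L = c *\<^sub>R v" .
      then show ?thesis using B_pos[OF vV(2)] by (auto simp: a_def)
    qed
    have hx: "[h,v]\<^sub>L = a h *\<^sub>R J v" if h: "h \<in> t" for h
    proof -
      have "[h,v]\<^sub>L \<in> m" using bracket_km t_subset_k h vV(3) by blast
      then have "[h,v]\<^sub>L = - J [h,J v]\<^sub>L" using Z_Z tJ[OF h] by simp
      then show ?thesis using hy[OF h] by simp
    qed
    have aZ: "a Z = 1"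
    proof -
      have "(a Z - 1) *\<^sub>R v = 0" using hy[OF Z_in_t] Z_Z[OF vV(3)] by (simp add: scaleR_left_diff_distrib)
      then show ?thesis using vV(2) by simp
    qed
    let ?\<alpha> = "\<i> *\<^sub>F complexify t a"
    have root: "?\<alpha> \<in> roots t"
      using rotation_root[OF subspace_t lin hx hy _ Z_in_t] vV(2) aZ by simp
    have val: "?\<alpha> (cplx_of h) = \<i> * of_real (a h)" if "h \<in> t" for h
      using complexify_cplx_of[OF subspace_t lin that] by (simp add: fun_scale_def)
    have pos: "?\<alpha> \<in> positive_roots_m k t l \<alpha>\<^sub>s"
      using root val[OF Z_in_t] aZ by (simp add: positive_roots_m_iff)
    have "[h,v]\<^sub>L = angle ?\<alpha> h *\<^sub>R J v" if "h \<in> t" for h using hx[OF that] val[OF that] by simp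
    then show "v \<in> ?R" using pos vV root_space_m[OF pos vV(3)] by blast
  qed
  finally show ?thesis .
qed

end

section \<open>Restricted roots and the restriction map\<close>

lemma bracket_span_eq_0:
  fixes S S' :: "'g::lie_algebra set"
  assumes "\<And>x y. x \<in> S \<Longrightarrow> y \<in> S' \<Longrightarrow> [x,y]\<^sub>L = 0" and "x \<in> span S" "y \<in> span S'"
  shows "[x,y]\<^sub>L = 0"
proof -
  have "span S' \<subseteq> {y. [x,y]\<^sub>L = 0}" if "x \<in> S" for x
    using assms(1)[OF that] by (intro span_minimal) (auto simp: subspace_def)
  then have "span S \<subseteq> {x. [x,y]\<^sub>L = 0}"
    using assms(3) by (intro span_minimal) (auto simp: subspace_def)
  then show ?thesis using assms(2) by blast
qed

text \<open>The set under \<open>Max\<close> is bounded by the dimension of the algebra, hence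
  finite, so \<open>Max\<close> is a true upper bound.\<close>

lemma dim_le_symmetric_rank:
  fixes a :: "'g::lie_algebra set"
  assumes "subspace a" "a \<subseteq> m" "\<And>x y. x \<in> a \<Longrightarrow> y \<in> a \<Longrightarrow> [x,y]\<^sub>L = 0"
  shows "dim a \<le> symmetric_rank m"
  unfolding symmetric_rank_def
proof (rule Max_ge)
  have "{dim a | a. subspace a \<and> a \<subseteq> m \<and> (\<forall>x\<in>a. \<forall>y\<in>a. [x,y]\<^sub>L = 0)} \<subseteq> {..DIM('g)}"
    using dim_subset_UNIV by auto
  then show "finite {dim a | a. subspace a \<and> a \<subseteq> m \<and> (\<forall>x\<in>a. \<forall>y\<in>a. [x,y]\<^sub>L = 0)}"
    using finite_subset by blast
qed (use assms in blast)

locale strongly_orthogonal_frame = compact_hermitian k m t l \<alpha>\<^sub>s H E Z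
  for k m t :: "'g::lie_algebra set" and l \<alpha>\<^sub>s H E Z +
  fixes r :: nat and \<beta> :: "nat \<Rightarrow> 'g functional"
  assumes rank: "r = symmetric_rank m"
    and \<beta>: "j \<in> {1..r} \<Longrightarrow> \<beta> j \<in> positive_roots_m k t l \<alpha>\<^sub>s"
    and \<beta>_orth: "strongly_orthogonal t r \<beta>"
begin

abbreviation X :: "nat \<Rightarrow> 'g" where "X j \<equiv> vec_X E (\<beta> j)"

lemma X_m: "j \<in> {1..r} \<Longrightarrow> X j \<in> m" and X_nz: "j \<in> {1..r} \<Longrightarrow> X j \<noteq> 0"
  and vec_T_eq: "j \<in> {1..r} \<Longrightarrow> vec_T H (\<beta> j) = [X j,J (X j)]\<^sub>L"
  and T_in_t: "j \<in> {1..r} \<Longrightarrow> [X j,J (X j)]\<^sub>L \<in> t"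
  and X_tripotent: "j \<in> {1..r} \<Longrightarrow> [[X j,J (X j)]\<^sub>L,X j]\<^sub>L = J (X j)"
  and t_X: "j \<in> {1..r} \<Longrightarrow> h \<in> t \<Longrightarrow> [h,X j]\<^sub>L = angle (\<beta> j) h *\<^sub>R J (X j)"
  using root_vectors_real[OF \<beta>[of j]] by auto

text \<open>\<open>t\<close> rotates the pair \<open>[X p,X q]\<close>, \<open>[X p,J (X q)]\<close>
  by the angle of \<open>\<beta> q - \<beta> p\<close>. If the pair were nonzero, this difference
  would be a root or zero, contrary to strong orthogonality.\<close>

lemma X_X_X_JX:
  assumes p: "p \<in> {1..r}" and q: "q \<in> {1..r}" and pq: "p \<noteq> q"
  shows "[X p,X q]\<^sub>L = 0 \<and> [X p,J (X q)]\<^sub>L = 0"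
proof (rule ccontr)
  assume nz: "\<not> ?thesis"
  let ?u = "[X p,X q]\<^sub>L" and ?w = "[X p,J (X q)]\<^sub>L"
  \<comment> \<open>\<open>angle (\<beta> j)\<close> is linear only on \<open>t\<close>, as
    \<open>\<beta> j\<close> is extended by zero. \<open>\<theta> j\<close> agrees with it there and
    is linear everywhere, as \<open>complexify_cplx_dual\<close> and \<open>rotation_root\<close>
    require.\<close>
  define \<theta> where "\<theta> j h = lie_form [h,X j]\<^sub>L (J (X j)) / lie_form (X j) (X j)" for j h
  have \<theta>: "\<theta> j h = angle (\<beta> j) h" if "j \<in> {1..r}" "h \<in> t" for j h
    unfolding \<theta>_def t_X[OF that] using B_J_J[OF X_m[OF that(1)]] B_pos[OF X_nz[OF that(1)]] by simp
  define a where "a h = \<theta> q h - \<theta> p h" for h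
  have lin: "linear a" by (rule linearI) (auto simp: a_def \<theta>_def add_divide_distrib algebra_simps)
  have hJ: "[h,J (X j)]\<^sub>L = - \<theta> j h *\<^sub>R X j" if "j \<in> {1..r}" "h \<in> t" for j h
    using bracket_k_J[of h "X j"] t_subset_k Z_Z[OF X_m[OF that(1)]] \<theta>[OF that] t_X[OF that] that(2)
    by auto
  have hu: "[h,?u]\<^sub>L = a h *\<^sub>R ?w" if h: "h \<in> t" for h
    using bracket_bracket_right[of h "X p" "X q"] t_X[OF p h] t_X[OF q h] \<theta>[OF p h] \<theta>[OF q h]
      bracket_J_left[OF X_m[OF p] X_m[OF q]]
    by (simp add: a_def algebra_simps)
  have hw: "[h,?w]\<^sub>L = - a h *\<^sub>R ?u" if h: "h \<in> t" for h
    using bracket_bracket_right[of h "X p" "J (X q)"] t_X[OF p h] hJ[OF q h] \<theta>[OF p h]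
      bracket_J_left[OF X_m[OF p] J_in_m[OF X_m[OF q]]] Z_Z[OF X_m[OF q]]
    by (simp add: a_def algebra_simps)
  have dual: "\<beta> j \<in> cplx_dual t" if "j \<in> {1..r}" for j
    using \<beta>[OF that] positive_roots_m_iff by (auto simp: roots_def)
  have val: "\<beta> j (cplx_of h) = \<i> * of_real (\<theta> j h)" if "j \<in> {1..r}" "h \<in> t" for j h
    using root_vectors_real(7)[OF \<beta>[OF that(1)] that(2)] \<theta>[OF that] by simp
  have eq: "\<beta> q - \<beta> p = \<i> *\<^sub>F complexify t a"
  proof (rule cplx_dual_eqI[OF subspace_t])
    show "\<beta> q - \<beta> p \<in> cplx_dual t" using dual p q by (intro diff_cplx_dual)
    show "\<i> *\<^sub>F complexify t a \<in> cplx_dual t"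
      by (intro fun_scale_cplx_dual complexify_cplx_dual subspace_t lin)
    show "(\<beta> q - \<beta> p) (cplx_of h) = (\<i> *\<^sub>F complexify t a) (cplx_of h)" if "h \<in> t" for h
      using val[OF p that] val[OF q that] complexify_cplx_of[OF subspace_t lin that]
      by (simp add: fun_scale_def a_def right_diff_distrib)
  qed
  have no: "\<beta> q - \<beta> p \<notin> roots t \<union> {0}"
    using \<beta>_orth p q pq unfolding strongly_orthogonal_def by metis
  show False
  proof (cases "\<exists>h\<in>t. a h \<noteq> 0")
    case True
    then obtain h where h: "h \<in> t" "a h \<noteq> 0" by blast
    have "\<i> *\<^sub>F complexify t a \<in> roots t"
      using rotation_root[OF subspace_t lin hu hw _ h] nz by blast
    then show False using no eq by simp
  next
    case False
    then have "\<i> *\<^sub>F complexify t a = 0"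
      by (auto simp: fun_eq_iff fun_scale_def complexify_def complex_eq_iff)
    then show False using no eq by simp
  qed
qed

lemma T_X_frame:
  assumes "p \<in> {1..r}" "q \<in> {1..r}"
  shows "[[X p,J (X p)]\<^sub>L,X q]\<^sub>L = (if p = q then J (X q) else 0)"
proof (cases "p = q")
  case False
  then show ?thesis
    using X_X_X_JX[OF assms False] bracket_J_left[OF X_m X_m, OF assms]
    by (simp add: bracket_bracket_left[of _ _ "X q"])
qed (use X_tripotent assms in simp)

lemma JX_nz: "j \<in> {1..r} \<Longrightarrow> J (X j) \<noteq> 0"
  using J_eq_0_iff X_m X_nz by blast

lemma X_inj: "inj_on X {1..r}"
proof (rule inj_onI, rule ccontr)
  fix p q assume pq: "p \<in> {1..r}" "q \<in> {1..r}" "X p = X q" "p \<noteq> q"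
  have "J (X p) = [[X p,J (X p)]\<^sub>L,X q]\<^sub>L" using X_tripotent[OF pq(1)] pq(3) by simp
  also have "\<dots> = 0" using T_X_frame[OF pq(1,2)] pq(4) by simp
  finally show False using JX_nz[OF pq(1)] by simp
qed

text \<open>\<open>ad (T p)\<close> kills every \<open>X q\<close> with \<open>q \<noteq> p\<close>
  and so isolates a single coefficient of a linear relation.\<close>

lemma X_independent: "independent (X ` {1..r})"
proof
  assume "dependent (X ` {1..r})"
  then obtain u p where p: "p \<in> {1..r}" "u (X p) \<noteq> 0" and 0: "(\<Sum>v\<in>X ` {1..r}. u v *\<^sub>R v) = 0"
    by (subst (asm) dependent_finite) auto
  have "0 = [[X p,J (X p)]\<^sub>L,\<Sum>v\<in>X ` {1..r}. u v *\<^sub>R v]\<^sub>L" using 0 by simp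
  also have "\<dots> = (\<Sum>q\<in>{1..r}. u (X q) *\<^sub>R [[X p,J (X p)]\<^sub>L,X q]\<^sub>L)"
    by (simp only: lie_bracket_sum_right sum.reindex[OF X_inj] o_def lie_bracket_simps)
  also have "\<dots> = (\<Sum>q\<in>{1..r}. if q = p then u (X p) *\<^sub>R J (X p) else 0)"
    using T_X_frame[OF p(1)] by (intro sum.cong) auto
  also have "\<dots> = u (X p) *\<^sub>R J (X p)" using p(1) by simp
  finally show False using p JX_nz by auto
qed

text \<open>Maximality is a dimension count: a vector of \<open>m\<close> outside the span that
  commutes with all \<open>X j\<close> would extend the span to an abelian subspace of dimension
  \<open>r + 1\<close>, exceeding the rank.\<close>

sublocale tripotent_frame lie_form k m Z r X
proof
  show "[X p,X q]\<^sub>L = 0" if "p \<in> {1..r}" "q \<in> {1..r}" for p q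
    using X_X_X_JX[OF that] by (cases "p = q") auto
  show "[X p,J (X q)]\<^sub>L = 0" if "p \<in> {1..r}" "q \<in> {1..r}" "p \<noteq> q" for p q
    using X_X_X_JX[OF that] by blast
  show "X j \<in> m" "[[X j,J (X j)]\<^sub>L,X j]\<^sub>L = J (X j)" if "j \<in> {1..r}" for j
    by (rule X_m[OF that] X_tripotent[OF that])+
  fix v assume v: "v \<in> m" "\<And>j. j \<in> {1..r} \<Longrightarrow> [X j,v]\<^sub>L = 0"
  show "v \<in> span (X ` {1..r})"
  proof (rule ccontr)
    assume nv: "v \<notin> span (X ` {1..r})"
    let ?S = "insert v (X ` {1..r})"
    have "v \<notin> X ` {1..r}" by (rule contra_subsetD[OF span_superset nv])
    then have "dim (span ?S) = Suc r"
      using dim_eq_card_independent[OF independent_insertI[OF nv X_independent]] card_image[OF X_inj]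
      by (simp only: dim_span card_insert_disjoint finite_imageI finite_atLeastAtMost card_atLeastAtMost) simp
    moreover have "dim (span ?S) \<le> symmetric_rank m"
    proof (rule dim_le_symmetric_rank)
      show "span ?S \<subseteq> m" by (rule span_minimal[OF _ subspace_m]) (use v(1) X_m in blast)
      have Xy: "[X p,y]\<^sub>L = 0" if p: "p \<in> {1..r}" and y: "y \<in> ?S" for p y
      proof -
        consider "y = v" | q where "q \<in> {1..r}" "y = X q" using y by blast
        then show ?thesis
        proof cases
          case 1 then show ?thesis using v(2)[OF p] by simp
        next
          case (2 q) then show ?thesis using X_X_X_JX[OF p 2(1)] by (cases "p = q") auto
        qed
      qed
      have vy: "[v,y]\<^sub>L = 0" if y: "y \<in> ?S" for y
      proof -
        consider "y = v" | q where "q \<in> {1..r}" "y = X q" using y by blast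
        then show ?thesis
        proof cases
          case (2 q) then show ?thesis using v(2)[OF 2(1)] lie_bracket_anticomm[of v y] by simp
        qed simp
      qed
      have S: "[x,y]\<^sub>L = 0" if "x \<in> ?S" "y \<in> ?S" for x y using that Xy vy by blast
      show "[x,y]\<^sub>L = 0" if "x \<in> span ?S" "y \<in> span ?S" for x y
        using bracket_span_eq_0[OF S that] .
    qed simp
    ultimately show False using rank by simp
  qed
qed

lemma T_inj: "inj_on T {1..r}"
proof (rule inj_onI, rule ccontr)
  fix p q assume pq: "p \<in> {1..r}" "q \<in> {1..r}" "T p = T q" "p \<noteq> q"
  have "J (X q) = [T p,X q]\<^sub>L" unfolding pq(3) using X_tripotent[OF pq(2)] by simp
  also have "\<dots> = 0" using T_X_frame[OF pq(1,2)] pq(4) by simp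
  finally show False using JX_nz[OF pq(2)] by simp
qed

lemma T_independent: "independent (T ` {1..r})"
proof
  assume "dependent (T ` {1..r})"
  then obtain u p where p: "p \<in> {1..r}" "u (T p) \<noteq> 0" and 0: "(\<Sum>v\<in>T ` {1..r}. u v *\<^sub>R v) = 0"
    by (subst (asm) dependent_finite) auto
  have "0 = [\<Sum>v\<in>T ` {1..r}. u v *\<^sub>R v,X p]\<^sub>L" using 0 by simp
  also have "\<dots> = (\<Sum>q\<in>{1..r}. u (T q) *\<^sub>R [T q,X p]\<^sub>L)"
    by (simp only: lie_bracket_sum_left sum.reindex[OF T_inj] o_def lie_bracket_simps)
  also have "\<dots> = (\<Sum>q\<in>{1..r}. if q = p then u (T p) *\<^sub>R J (X p) else 0)"
    using T_X_frame p(1) by (intro sum.cong) auto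
  also have "\<dots> = u (T p) *\<^sub>R J (X p)" using p(1) by simp
  finally show False using p JX_nz by auto
qed

section \<open>Dual bases, restrictions of roots and restricted roots\<close>

abbreviation \<aa> :: "'g set" where "\<aa> \<equiv> span (X ` {1..r})"
abbreviation t' :: "'g set" where "t' \<equiv> span (T ` {1..r})"
abbreviation \<epsilon> :: "nat \<Rightarrow> 'g functional" where "\<epsilon> \<equiv> dual_basis \<aa> r X"
abbreviation \<epsilon>' :: "nat \<Rightarrow> 'g functional" where "\<epsilon>' \<equiv> dual_basis t' r T"

lemmas \<epsilon> = dual_basis_cplx_dual[OF refl X_independent X_inj]
lemmas \<epsilon>' = dual_basis_cplx_dual[OF refl T_independent T_inj]

lemma a_functional_eqI:
  "f \<in> cplx_dual \<aa> \<Longrightarrow> g \<in> cplx_dual \<aa> \<Longrightarrow>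
    (\<And>j. j \<in> {1..r} \<Longrightarrow> f (cplx_of (X j)) = g (cplx_of (X j))) \<Longrightarrow> f = g"
  by (rule cplx_dual_eq_on_spanning[OF subspace_span _ _ refl]) auto

lemma t'_functional_eqI:
  "f \<in> cplx_dual t' \<Longrightarrow> g \<in> cplx_dual t' \<Longrightarrow>
    (\<And>j. j \<in> {1..r} \<Longrightarrow> f (cplx_of (T j)) = g (cplx_of (T j))) \<Longrightarrow> f = g"
  by (rule cplx_dual_eq_on_spanning[OF subspace_span _ _ refl]) auto

lemma t'_subset_t: "t' \<subseteq> t"
  using T_in_t by (intro span_minimal subspace_t) auto

lemma restriction_cplx_dual:
  "\<alpha> \<in> positive_roots_m k t l \<alpha>\<^sub>s \<Longrightarrow> restrict_functional t' \<alpha> \<in> cplx_dual t'"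
  using restrict_functional_cplx_dual[OF subspace_span _ t'_subset_t] positive_roots_m_iff
  by (auto simp: roots_def)

lemma restriction_T:
  assumes "\<alpha> \<in> positive_roots_m k t l \<alpha>\<^sub>s" "j \<in> {1..r}"
  shows "restrict_functional t' \<alpha> (cplx_of (T j)) = \<i> * of_real (angle \<alpha> (T j))"
proof -
  have "cplx_of (T j) \<in> t' \<times> t'"
    by (intro cplx_of_mem subspace_span span_base imageI assms(2))
  then show ?thesis
    using root_vectors_real(7)[OF assms(1) T_in_t[OF assms(2)]] by (simp add: restrict_functional_def)
qed

lemma restriction_\<beta>:
  assumes j: "j \<in> {1..r}"
  shows "restrict_functional t' (\<beta> j) = \<i> *\<^sub>F \<epsilon>' j"
proof (rule t'_functional_eqI)
  show "restrict_functional t' (\<beta> j) \<in> cplx_dual t'" by (rule restriction_cplx_dual[OF \<beta>[OF j]])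
  show "\<i> *\<^sub>F \<epsilon>' j \<in> cplx_dual t'" by (intro fun_scale_cplx_dual \<epsilon>'(1) j)
  fix i assume i: "i \<in> {1..r}"
  have "angle (\<beta> j) (T i) *\<^sub>R J (X j) = [T i,X j]\<^sub>L" by (rule t_X[OF j T_in_t[OF i], symmetric])
  also have "\<dots> = (if i = j then 1 else 0) *\<^sub>R J (X j)"
    using T_X_frame[OF i j] by (cases "i = j") simp_all
  finally have "angle (\<beta> j) (T i) = (if i = j then 1 else 0)" using JX_nz[OF j] scaleR_right_imp_eq by blast
  then show "restrict_functional t' (\<beta> j) (cplx_of (T i)) = (\<i> *\<^sub>F \<epsilon>' j) (cplx_of (T i))"
    unfolding restriction_T[OF \<beta>[OF j] i] fun_scale_def \<epsilon>'(2)[OF j i] by auto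
qed

lemma root_vectors_weight:
  assumes \<alpha>: "\<alpha> \<in> positive_roots_m k t l \<alpha>\<^sub>s"
  shows "vec_X E \<alpha> \<in> weight_space (\<lambda>j. angle \<alpha> (T j))"
    and "vec_Y E \<alpha> \<in> weight_space (\<lambda>j. angle \<alpha> (T j))"
proof -
  note X = root_vectors_real[OF \<alpha>]
  show *: "vec_X E \<alpha> \<in> weight_space (\<lambda>j. angle \<alpha> (T j))"
    using X(1) X(8)[OF T_in_t] by (simp add: weight_space_def)
  show "vec_Y E \<alpha> \<in> weight_space (\<lambda>j. angle \<alpha> (T j))"
    unfolding X(3) by (rule J_weight_space[OF *])
qed

text \<open>Each weight space is invariant under the operators of \<open>root_decomposition\<close>,
  so it is spanned by vectors lying in root planes. A nonzero vector in such a plane already fixes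
  the values of its root at all \<open>T j\<close>, and then the whole plane has this
  weight.\<close>

lemma weight_space_eq_span:
  "weight_space a =
    span (\<Union>\<alpha>\<in>{\<alpha>\<in>positive_roots_m k t l \<alpha>\<^sub>s. \<forall>j\<in>{1..r}. angle \<alpha> (T j) = a j}. {vec_X E \<alpha>, vec_Y E \<alpha>})"
  (is "_ = span ?S")
proof
  show "span ?S \<subseteq> weight_space a"
  proof (rule span_minimal[OF _ subspace_weight_space])
    show "?S \<subseteq> weight_space a" using root_vectors_weight by (fastforce simp: weight_space_def)
  qed
  have "weight_space a \<subseteq> span (\<Union>\<alpha>\<in>positive_roots_m k t l \<alpha>\<^sub>s. {v\<in>weight_space a. v \<noteq> 0 \<and>
      v \<in> span {vec_X E \<alpha>, vec_Y E \<alpha>} \<and> (\<forall>h\<in>t. [h,v]\<^sub>L = angle \<alpha> h *\<^sub>R J v)})" (is "_ \<subseteq> span ?R")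
  proof (rule root_decomposition[OF subspace_weight_space])
    show "weight_space a \<subseteq> m" by (auto simp: weight_space_def)
    fix h v assume h: "h \<in> t" and v: "v \<in> weight_space a"
    have Jv: "J v \<in> weight_space a" by (rule J_weight_space[OF v])
    then have m: "[h,J v]\<^sub>L \<in> m" using bracket_km t_subset_k h by (auto simp: weight_space_def)
    have "[T j,[h,J v]\<^sub>L]\<^sub>L = a j *\<^sub>R J [h,J v]\<^sub>L" if j: "j \<in> {1..r}" for j
    proof -
      have "[T j,[h,J v]\<^sub>L]\<^sub>L = [h,[T j,J v]\<^sub>L]\<^sub>L" by (rule bracket_t_t[OF T_in_t[OF j] h])
      also have "[T j,J v]\<^sub>L = a j *\<^sub>R J (J v)" using Jv j by (simp add: weight_space_def)
      also have "[h,a j *\<^sub>R J (J v)]\<^sub>L = a j *\<^sub>R J [h,J v]\<^sub>L"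
        using bracket_k_J[of h "J v"] t_subset_k h by auto
      finally show ?thesis .
    qed
    then show "[h,J v]\<^sub>L \<in> weight_space a" using m by (simp add: weight_space_def)
  qed
  also have "\<dots> \<subseteq> span ?S"
  proof (rule span_minimal[OF subsetI subspace_span])
    fix v assume "v \<in> ?R"
    then obtain \<alpha> where \<alpha>: "\<alpha> \<in> positive_roots_m k t l \<alpha>\<^sub>s" and v: "v \<in> weight_space a" "v \<noteq> 0"
      "v \<in> span {vec_X E \<alpha>, vec_Y E \<alpha>}" "\<forall>h\<in>t. [h,v]\<^sub>L = angle \<alpha> h *\<^sub>R J v" by blast
    have Jv: "J v \<noteq> 0" using v J_eq_0_iff by (auto simp: weight_space_def)
    have "angle \<alpha> (T j) = a j" if j: "j \<in> {1..r}" for j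
    proof -
      have "angle \<alpha> (T j) *\<^sub>R J v = [T j,v]\<^sub>L" by (rule bspec[OF v(4) T_in_t[OF j], symmetric])
      also have "\<dots> = a j *\<^sub>R J v" using v(1) j by (simp add: weight_space_def)
      finally show ?thesis by (rule scaleR_right_imp_eq[OF Jv])
    qed
    then have "{vec_X E \<alpha>, vec_Y E \<alpha>} \<subseteq> ?S" using \<alpha> by blast
    then show "v \<in> span ?S" using v(3) span_mono by blast
  qed
  finally show "weight_space a \<subseteq> span ?S" .
qed

text \<open>The coordinates of the restriction of \<open>\<alpha>\<close>, divided by i, are the
  weights of its vector \<open>X\<close>, to which \<open>weight_classification\<close>
  applies.\<close>

lemma restriction_types:
  assumes \<alpha>: "\<alpha> \<in> positive_roots_m k t l \<alpha>\<^sub>s"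
  shows "restrict_functional t' \<alpha> \<in> {(\<i>/2) *\<^sub>F \<epsilon>' j | j. j \<in> {1..r}} \<union> {\<i> *\<^sub>F \<epsilon>' j | j. j \<in> {1..r}} \<union>
      {(\<i>/2) *\<^sub>F (\<epsilon>' p + \<epsilon>' q) | p q. 1 \<le> p \<and> p < q \<and> q \<le> r}"
proof -
  let ?a = "\<lambda>j. angle \<alpha> (T j)"
  have eq: "restrict_functional t' \<alpha> = f"
    if "f \<in> cplx_dual t'" "\<And>i. i \<in> {1..r} \<Longrightarrow> f (cplx_of (T i)) = \<i> * of_real (?a i)" for f
  proof (rule t'_functional_eqI[OF restriction_cplx_dual[OF \<alpha>] that(1)])
    show "restrict_functional t' \<alpha> (cplx_of (T j)) = f (cplx_of (T j))" if j: "j \<in> {1..r}" for j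
      unfolding restriction_T[OF \<alpha> j] \<open>\<And>i. i \<in> {1..r} \<Longrightarrow> f (cplx_of (T i)) = \<i> * of_real (?a i)\<close>[OF j] ..
  qed
  consider j where "short_weight ?a j" | j where "long_weight ?a j" | p q where "pair_weight ?a p q"
    using weight_classification[OF root_vectors_weight(1)[OF \<alpha>] root_vectors_real(2)[OF \<alpha>]] by blast
  then show ?thesis
  proof cases
    case 1
    then have j: "j \<in> {1..r}" "?a j = 1/2" "\<And>i. i \<in> {1..r} \<Longrightarrow> i \<noteq> j \<Longrightarrow> ?a i = 0"
      by (auto simp: short_weight_def)
    have "restrict_functional t' \<alpha> = (\<i>/2) *\<^sub>F \<epsilon>' j"
    proof (rule eq)
      show "(\<i>/2) *\<^sub>F \<epsilon>' j \<in> cplx_dual t'" by (intro fun_scale_cplx_dual \<epsilon>'(1) j)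
      show "((\<i>/2) *\<^sub>F \<epsilon>' j) (cplx_of (T i)) = \<i> * of_real (?a i)" if "i \<in> {1..r}" for i
      proof -
        have "?a i = (if i = j then 1/2 else 0)" using j that by (cases "i = j") auto
        then show ?thesis unfolding fun_scale_def \<epsilon>'(2)[OF j(1) that] by simp
      qed
    qed
    then show ?thesis using j(1) by blast
  next
    case 2
    then have j: "j \<in> {1..r}" "?a j = 1" "\<And>i. i \<in> {1..r} \<Longrightarrow> i \<noteq> j \<Longrightarrow> ?a i = 0"
      by (auto simp: long_weight_def)
    have "restrict_functional t' \<alpha> = \<i> *\<^sub>F \<epsilon>' j"
    proof (rule eq)
      show "\<i> *\<^sub>F \<epsilon>' j \<in> cplx_dual t'" by (intro fun_scale_cplx_dual \<epsilon>'(1) j)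
      show "(\<i> *\<^sub>F \<epsilon>' j) (cplx_of (T i)) = \<i> * of_real (?a i)" if "i \<in> {1..r}" for i
        unfolding fun_scale_def \<epsilon>'(2)[OF j(1) that] using j that by (cases "i = j") auto
    qed
    then show ?thesis using j(1) by blast
  next
    case 3
    then have pq: "1 \<le> p" "p < q" "q \<le> r" "p \<in> {1..r}" "q \<in> {1..r}" "?a p = 1/2" "?a q = 1/2"
      "\<And>i. i \<in> {1..r} \<Longrightarrow> i \<noteq> p \<Longrightarrow> i \<noteq> q \<Longrightarrow> ?a i = 0"
      by (auto simp: pair_weight_def)
    have "restrict_functional t' \<alpha> = (\<i>/2) *\<^sub>F (\<epsilon>' p + \<epsilon>' q)"
    proof (rule eq)
      show "(\<i>/2) *\<^sub>F (\<epsilon>' p + \<epsilon>' q) \<in> cplx_dual t'"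
        by (intro fun_scale_cplx_dual add_cplx_dual \<epsilon>'(1) pq)
      show "((\<i>/2) *\<^sub>F (\<epsilon>' p + \<epsilon>' q)) (cplx_of (T i)) = \<i> * of_real (?a i)" if "i \<in> {1..r}" for i
      proof -
        have "?a i = (if i = p then 1/2 else if i = q then 1/2 else 0)"
          using pq(6-8) that by simp
        then show ?thesis
          unfolding fun_scale_def plus_fun_apply \<epsilon>'(2)[OF pq(4) that] \<epsilon>'(2)[OF pq(5) that]
          using pq(2) by simp
      qed
    qed
    then show ?thesis using pq by blast
  qed
qed

text \<open>The values of a restricted root on \<open>a\<close> are imaginary because \<open>ad\<close> is skew.\<close>

lemma restricted_root_vector:
  assumes f: "f \<in> roots \<aa>"
  shows "\<And>w. w \<in> \<aa> \<Longrightarrow> f (cplx_of w) = \<i> * of_real (angle f w)"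
    and "\<exists>v\<in>m. v \<noteq> 0 \<and> (\<forall>w\<in>\<aa>. \<forall>w'\<in>\<aa>. [w,[w',v]\<^sub>L]\<^sub>L = - (angle f w * angle f w') *\<^sub>R v)"
    and "\<exists>j\<in>{1..r}. angle f (X j) \<noteq> 0"
proof -
  have fd: "f \<in> cplx_dual \<aa>" "f \<noteq> 0" "root_space \<aa> f \<noteq> {0}" using f by (auto simp: roots_def)
  have "0 \<in> root_space \<aa> f"
    by (simp add: root_space_def cplx_bracket_def cplx_scale_def prod_eq_iff)
  then obtain x y where xy: "(x, y) \<in> root_space \<aa> f" "x \<noteq> 0 \<or> y \<noteq> 0"
  proof -
    from fd(3) \<open>0 \<in> root_space \<aa> f\<close> obtain z where "z \<in> root_space \<aa> f" "z \<noteq> 0" by blast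
    then show ?thesis using that[of "fst z" "snd z"] by (simp add: prod_eq_iff)
  qed
  have e: "[w,x]\<^sub>L = Re (f (cplx_of w)) *\<^sub>R x - angle f w *\<^sub>R y"
    "[w,y]\<^sub>L = Re (f (cplx_of w)) *\<^sub>R y + angle f w *\<^sub>R x" if w: "w \<in> \<aa>" for w
  proof -
    have "cplx_of w \<in> \<aa> \<times> \<aa>" by (rule cplx_of_mem[OF subspace_span w])
    moreover have "\<forall>h\<in>\<aa> \<times> \<aa>. [h,(x, y)]\<^sub>C = f h *\<^sub>C (x, y)"
      using xy(1) unfolding root_space_def by (rule CollectD)
    ultimately have "[cplx_of w,(x, y)]\<^sub>C = f (cplx_of w) *\<^sub>C (x, y)" by (rule bspec[rotated])
    then show "[w,x]\<^sub>L = Re (f (cplx_of w)) *\<^sub>R x - angle f w *\<^sub>R y"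
      "[w,y]\<^sub>L = Re (f (cplx_of w)) *\<^sub>R y + angle f w *\<^sub>R x"
      by (auto simp: cplx_bracket_def cplx_of_def cplx_scale_def)
  qed
  have skew: "lie_form [w,z]\<^sub>L z = 0" for w z :: 'g
    using lie_form_invariant[of w z z] B_sym[of z "[w,z]\<^sub>L"] by simp
  have Re0: "Re (f (cplx_of w)) = 0" if w: "w \<in> \<aa>" for w
  proof -
    let ?p = "Re (f (cplx_of w))"
    have "?p * lie_form x x - angle f w * lie_form y x = 0" using skew[of w x] by (simp add: e[OF w])
    moreover have "?p * lie_form y y + angle f w * lie_form x y = 0"
      using skew[of w y] by (simp add: e[OF w])
    ultimately have "?p * (lie_form x x + lie_form y y) = 0"
      using B_sym[of x y] by (simp add: algebra_simps)
    moreover have "lie_form x x + lie_form y y > 0"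
      using xy(2) B_pos[of x] B_pos[of y] B_nonneg[of x] B_nonneg[of y] by fastforce
    ultimately show ?thesis by simp
  qed
  then show val: "\<And>w. w \<in> \<aa> \<Longrightarrow> f (cplx_of w) = \<i> * of_real (angle f w)" by (simp add: complex_eq_iff)
  show nz: "\<exists>j\<in>{1..r}. angle f (X j) \<noteq> 0"
  proof (rule ccontr)
    assume c: "\<not> ?thesis"
    have "f (cplx_of (X j)) = 0" if "j \<in> {1..r}" for j
      using c that val[of "X j"] span_base[of "X j" "X ` {1..r}"] by auto
    then have "f = 0" using fd(1) by (intro a_functional_eqI) (auto simp: cplx_dual_def)
    then show False using fd(2) by simp
  qed
  \<comment> \<open>The root vector \<open>x + i y\<close> need not lie in the complexification of
    \<open>m\<close>. But \<open>ad w\<close> exchanges \<open>k\<close> and \<open>m\<close>, so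
    two brackets return each component to a multiple of itself. If both \<open>m\<close>-components
    were zero, an \<open>X j\<close> with nonzero angle would force the \<open>k\<close>-components
    to vanish too.\<close>
  obtain xk xm yk ym where dec: "xk \<in> k" "xm \<in> m" "x = xk + xm" "yk \<in> k" "ym \<in> m" "y = yk + ym"
    using k_m_sum[of x] k_m_sum[of y] by blast
  have unique: "a = c \<and> b = d" if "a \<in> k" "c \<in> k" "b \<in> m" "d \<in> m" "a + b = c + d" for a b c d
  proof -
    have "a - c = d - b" using that(5) by (simp add: algebra_simps)
    moreover have "a - c \<in> k" "d - b \<in> m"
      using that subspace_diff[OF subspace_k] subspace_diff[OF subspace_m] by auto
    ultimately have "a - c \<in> k \<inter> m" by simp
    then have "a - c = 0" using k_m_disjoint by simp
    then show ?thesis using that(5) by simp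
  qed
  have am: "\<aa> \<subseteq> m" using X_m by (intro span_minimal subspace_m) auto
  have kc: "c *\<^sub>R u \<in> k" if "u \<in> k" for c u using subspace_scale[OF subspace_k that] .
  have mc: "c *\<^sub>R u \<in> m" if "u \<in> m" for c u using subspace_scale[OF subspace_m that] .
  have c: "[w,xm]\<^sub>L = - angle f w *\<^sub>R yk \<and> [w,xk]\<^sub>L = - angle f w *\<^sub>R ym"
    "[w,ym]\<^sub>L = angle f w *\<^sub>R xk \<and> [w,yk]\<^sub>L = angle f w *\<^sub>R xm" if w: "w \<in> \<aa>" for w
  proof -
    have wm: "w \<in> m" using w am by blast
    have "[w,xm]\<^sub>L + [w,xk]\<^sub>L = - angle f w *\<^sub>R yk + - angle f w *\<^sub>R ym"
      using e(1)[OF w] Re0[OF w] by (simp add: dec algebra_simps)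
    then show "[w,xm]\<^sub>L = - angle f w *\<^sub>R yk \<and> [w,xk]\<^sub>L = - angle f w *\<^sub>R ym"
      using wm dec by (intro unique bracket_mm bracket_mk kc mc)
    have "[w,ym]\<^sub>L + [w,yk]\<^sub>L = angle f w *\<^sub>R xk + angle f w *\<^sub>R xm"
      using e(2)[OF w] Re0[OF w] by (simp add: dec algebra_simps)
    then show "[w,ym]\<^sub>L = angle f w *\<^sub>R xk \<and> [w,yk]\<^sub>L = angle f w *\<^sub>R xm"
      using wm dec by (intro unique bracket_mm bracket_mk kc mc)
  qed
  have sq: "[w,[w',xm]\<^sub>L]\<^sub>L = - (angle f w * angle f w') *\<^sub>R xm"
    "[w,[w',ym]\<^sub>L]\<^sub>L = - (angle f w * angle f w') *\<^sub>R ym" if "w \<in> \<aa>" "w' \<in> \<aa>" for w w'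
    using c[OF that(1)] c[OF that(2)] by (simp_all add: mult.commute)
  have "xm \<noteq> 0 \<or> ym \<noteq> 0"
  proof (rule ccontr)
    assume z: "\<not> ?thesis"
    obtain j where j: "j \<in> {1..r}" "angle f (X j) \<noteq> 0" using nz by blast
    have "X j \<in> \<aa>" using j(1) by (intro span_base) auto
    from c[OF this] have "xk = 0" "yk = 0" using z j(2) by auto
    then show False using z xy(2) dec by simp
  qed
  then show "\<exists>v\<in>m. v \<noteq> 0 \<and> (\<forall>w\<in>\<aa>. \<forall>w'\<in>\<aa>. [w,[w',v]\<^sub>L]\<^sub>L = - (angle f w * angle f w') *\<^sub>R v)"
    using sq dec by blast
qed

text \<open>Evaluating the quadratic condition at \<open>X i + X j\<close> and using
  \<open>P i j = P j i\<close> recovers the mixed products. The converse extends linearly in the two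
  arguments, one after the other.\<close>

lemma m_space_eq_restricted_space:
  assumes f: "f \<in> roots \<aa>"
  shows "m_space m \<aa> f = restricted_space (\<lambda>j. angle f (X j))"
proof -
  let ?q = "angle f"
  have fd: "f \<in> cplx_dual \<aa>" using f by (auto simp: roots_def)
  have q_add: "?q (v + w) = ?q v + ?q w" if "v \<in> \<aa>" "w \<in> \<aa>" for v w
    using cplx_dual_cplx_of(1)[OF subspace_span fd that] by simp
  have q_scale: "?q (c *\<^sub>R w) = c * ?q w" if "w \<in> \<aa>" for c w
    using cplx_dual_cplx_of(2)[OF subspace_span fd that] by simp
  have q_0: "?q 0 = 0" using q_scale[OF span_zero, of 0] by simp
  have X: "X j \<in> \<aa>" if "j \<in> {1..r}" for j using that by (intro span_base) auto
  have square: "cplx_of [w,[w,v]\<^sub>L]\<^sub>L = (f (cplx_of w))\<^sup>2 *\<^sub>C cplx_of v \<longleftrightarrow>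
      [w,[w,v]\<^sub>L]\<^sub>L = - (?q w * ?q w) *\<^sub>R v" if "w \<in> \<aa>" for w v
    by (subst restricted_root_vector(1)[OF f that])
      (simp add: cplx_of_def cplx_scale_def power2_eq_square)
  \<comment> \<open>Membership in the span is part of the set because \<open>angle f\<close> is
    additive only there.\<close>
  have sub: "subspace {w\<in>\<aa>. L w = ?q w *\<^sub>R z}" if "linear L" for L and z :: 'g
    unfolding subspace_def using q_add q_scale q_0 that span_add span_scale span_zero
    by (auto simp: linear_0 linear_add linear_scale scaleR_left_distrib)
  show ?thesis
  proof (intro equalityI subsetI)
    fix v assume "v \<in> m_space m \<aa> f"
    then have v: "v \<in> m" "\<And>w. w \<in> \<aa> \<Longrightarrow> [w,[w,v]\<^sub>L]\<^sub>L = - (?q w * ?q w) *\<^sub>R v"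
      using square by (auto simp: m_space_def)
    have "P i j v = - (?q (X i) * ?q (X j)) *\<^sub>R v" if ij: "i \<in> {1..r}" "j \<in> {1..r}" for i j
    proof -
      have qa: "?q (X i + X j) = ?q (X i) + ?q (X j)" by (rule q_add[OF X X]) (rule ij)+
      have "X i + X j \<in> \<aa>" using X ij by (intro span_add)
      from v(2)[OF this] have "P i i v + P j j v + (P i j v + P j i v)
          = - (?q (X i) * ?q (X i)) *\<^sub>R v - (?q (X j) * ?q (X j)) *\<^sub>R v
            - (?q (X i) * ?q (X j) + ?q (X i) * ?q (X j)) *\<^sub>R v"
        by (simp add: qa algebra_simps)
      then have "P i j v + P i j v = - (?q (X i) * ?q (X j) + ?q (X i) * ?q (X j)) *\<^sub>R v"
        using v(2)[OF X[OF ij(1)]] v(2)[OF X[OF ij(2)]] P_commute[OF ij, of v] by simp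
      then have "2 *\<^sub>R P i j v = 2 *\<^sub>R (- (?q (X i) * ?q (X j)) *\<^sub>R v)" by (simp add: scaleR_2 scaleR_left_distrib)
      then show ?thesis by (rule scaleR_left_imp_eq[rotated]) simp
    qed
    then show "v \<in> restricted_space (\<lambda>j. ?q (X j))" using v(1) by (simp add: restricted_space_def)
  next
    fix v assume v: "v \<in> restricted_space (\<lambda>j. ?q (X j))"
    have 1: "[X i,[w,v]\<^sub>L]\<^sub>L = ?q w *\<^sub>R (- ?q (X i) *\<^sub>R v)" if i: "i \<in> {1..r}" and w: "w \<in> \<aa>" for i w
    proof -
      have "\<aa> \<subseteq> {w\<in>\<aa>. [X i,[w,v]\<^sub>L]\<^sub>L = ?q w *\<^sub>R (- ?q (X i) *\<^sub>R v)}"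
      proof (rule span_minimal[OF _ sub])
        show "linear (\<lambda>w. [X i,[w,v]\<^sub>L]\<^sub>L)" by (rule linearI) auto
        show "X ` {1..r} \<subseteq> {w\<in>\<aa>. [X i,[w,v]\<^sub>L]\<^sub>L = ?q w *\<^sub>R (- ?q (X i) *\<^sub>R v)}"
          using v i X by (auto simp: restricted_space_def mult.commute)
      qed
      then show ?thesis using w by blast
    qed
    have "[w,[w,v]\<^sub>L]\<^sub>L = - (?q w * ?q w) *\<^sub>R v" if w: "w \<in> \<aa>" for w
    proof -
      have "\<aa> \<subseteq> {u\<in>\<aa>. [u,[w,v]\<^sub>L]\<^sub>L = ?q u *\<^sub>R (- ?q w *\<^sub>R v)}"
      proof (rule span_minimal[OF _ sub])
        show "linear (\<lambda>u. [u,[w,v]\<^sub>L]\<^sub>L)" by (rule linearI) auto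
        show "X ` {1..r} \<subseteq> {u\<in>\<aa>. [u,[w,v]\<^sub>L]\<^sub>L = ?q u *\<^sub>R (- ?q w *\<^sub>R v)}"
          using 1[OF _ w] X by (auto simp: mult.commute)
      qed
      then show ?thesis using w by auto
    qed
    then show "v \<in> m_space m \<aa> f" using v square by (auto simp: m_space_def restricted_space_def)
  qed
qed

text \<open>
  In every case of the definition of \<open>rho_m\<close> the coordinates of the value are the absolute values of
  those of the argument; hence the value is unique.
\<close>

lemma rho_m_value:
  assumes \<mu>: "\<mu> \<in> restricted_positive_roots \<aa> r X"
  shows "rho_m r \<epsilon> \<epsilon>' \<mu> \<in> cplx_dual t'"
    and "\<And>j. j \<in> {1..r} \<Longrightarrow> rho_m r \<epsilon> \<epsilon>' \<mu> (cplx_of (T j)) = \<i> * of_real \<bar>angle \<mu> (X j)\<bar>"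
proof -
  let ?l = "\<lambda>j. angle \<mu> (X j)"
  have f: "\<mu> \<in> roots \<aa>" and lex: "lex_positive r X \<mu>"
    using \<mu> by (auto simp: restricted_positive_roots_def)
  have fd: "\<mu> \<in> cplx_dual \<aa>" using f by (auto simp: roots_def)
  have X: "X j \<in> \<aa>" if "j \<in> {1..r}" for j using that by (intro span_base) auto
  note val = restricted_root_vector(1)[OF f X]
  define R where "R g \<longleftrightarrow>
     (\<exists>j\<in>{1..r}. \<mu> = (\<i>/2) *\<^sub>F \<epsilon> j \<and> g = (\<i>/2) *\<^sub>F \<epsilon>' j) \<or>
     (\<exists>j\<in>{1..r}. \<mu> = \<i> *\<^sub>F \<epsilon> j \<and> g = \<i> *\<^sub>F \<epsilon>' j) \<or>
     (\<exists>p k. 1 \<le> p \<and> p < k \<and> k \<le> r \<and>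
        (\<mu> = (\<i>/2) *\<^sub>F (\<epsilon> p + \<epsilon> k) \<or> \<mu> = (\<i>/2) *\<^sub>F (\<epsilon> p - \<epsilon> k)) \<and>
        g = (\<i>/2) *\<^sub>F (\<epsilon>' p + \<epsilon>' k))" for g
  have R_value: "g \<in> cplx_dual t' \<and> (\<forall>i\<in>{1..r}. g (cplx_of (T i)) = \<i> * of_real \<bar>?l i\<bar>)" if "R g" for g
  proof -
    from that consider
        "\<exists>j\<in>{1..r}. \<mu> = (\<i>/2) *\<^sub>F \<epsilon> j \<and> g = (\<i>/2) *\<^sub>F \<epsilon>' j"
      | "\<exists>j\<in>{1..r}. \<mu> = \<i> *\<^sub>F \<epsilon> j \<and> g = \<i> *\<^sub>F \<epsilon>' j"
      | "\<exists>p k. 1 \<le> p \<and> p < k \<and> k \<le> r \<and>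
          (\<mu> = (\<i>/2) *\<^sub>F (\<epsilon> p + \<epsilon> k) \<or> \<mu> = (\<i>/2) *\<^sub>F (\<epsilon> p - \<epsilon> k)) \<and>
          g = (\<i>/2) *\<^sub>F (\<epsilon>' p + \<epsilon>' k)"
      unfolding R_def by argo
    then show ?thesis
    proof cases
      case 1
      then obtain j where 1: "j \<in> {1..r}" "\<mu> = (\<i>/2) *\<^sub>F \<epsilon> j" "g = (\<i>/2) *\<^sub>F \<epsilon>' j" by blast
      have "g (cplx_of (T i)) = \<i> * of_real \<bar>?l i\<bar>" if "i \<in> {1..r}" for i
        unfolding 1(2,3) fun_scale_def \<epsilon>(2)[OF 1(1) that] \<epsilon>'(2)[OF 1(1) that] by simp
      then show ?thesis using fun_scale_cplx_dual[OF \<epsilon>'(1)[OF 1(1)]] 1(3) by simp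
    next
      case 2
      then obtain j where 2: "j \<in> {1..r}" "\<mu> = \<i> *\<^sub>F \<epsilon> j" "g = \<i> *\<^sub>F \<epsilon>' j" by blast
      have "g (cplx_of (T i)) = \<i> * of_real \<bar>?l i\<bar>" if "i \<in> {1..r}" for i
        unfolding 2(2,3) fun_scale_def \<epsilon>(2)[OF 2(1) that] \<epsilon>'(2)[OF 2(1) that] by simp
      then show ?thesis using fun_scale_cplx_dual[OF \<epsilon>'(1)[OF 2(1)]] 2(3) by simp
    next
      case 3
      then obtain p k where pk': "1 \<le> p \<and> p < k \<and> k \<le> r"
        and 3: "\<mu> = (\<i>/2) *\<^sub>F (\<epsilon> p + \<epsilon> k) \<or> \<mu> = (\<i>/2) *\<^sub>F (\<epsilon> p - \<epsilon> k)" "g = (\<i>/2) *\<^sub>F (\<epsilon>' p + \<epsilon>' k)"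
        by (elim exE conjE) (rule that, (assumption | rule conjI)+)
      from pk' have pk: "p \<in> {1..r}" "k \<in> {1..r}" "p \<noteq> k" by auto
      have "g (cplx_of (T i)) = \<i> * of_real \<bar>?l i\<bar>" if i: "i \<in> {1..r}" for i
        using 3(1)
      proof
        assume \<mu>: "\<mu> = (\<i>/2) *\<^sub>F (\<epsilon> p + \<epsilon> k)"
        show ?thesis
          unfolding \<mu> 3(2) fun_scale_def plus_fun_apply \<epsilon>(2)[OF pk(1) i] \<epsilon>(2)[OF pk(2) i]
            \<epsilon>'(2)[OF pk(1) i] \<epsilon>'(2)[OF pk(2) i] using pk(3) by simp
      next
        assume \<mu>: "\<mu> = (\<i>/2) *\<^sub>F (\<epsilon> p - \<epsilon> k)"
        show ?thesis
          unfolding \<mu> 3(2) fun_scale_def plus_fun_apply minus_apply \<epsilon>(2)[OF pk(1) i] \<epsilon>(2)[OF pk(2) i]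
            \<epsilon>'(2)[OF pk(1) i] \<epsilon>'(2)[OF pk(2) i] using pk(3) by simp
      qed
      then show ?thesis
        using fun_scale_cplx_dual[OF add_cplx_dual[OF \<epsilon>'(1)[OF pk(1)] \<epsilon>'(1)[OF pk(2)]]] 3(2) by simp
    qed
  qed
  have eqI: "\<mu> = g" if "g \<in> cplx_dual \<aa>" "\<And>i. i \<in> {1..r} \<Longrightarrow> g (cplx_of (X i)) = \<i> * of_real (?l i)" for g
    using that val by (intro a_functional_eqI fd) auto
  \<comment> \<open>That a positive restricted root has one of the listed forms is proved here. Its
    root vector yields a vector of weights \<open>\<bar>l j\<bar>\<close>, the classification gives
    the type, and lexicographic positivity settles the leading sign.\<close>
  have "\<exists>g. R g"
  proof -
    obtain v where v: "v \<in> m" "v \<noteq> 0"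
      "\<And>w w'. w \<in> \<aa> \<Longrightarrow> w' \<in> \<aa> \<Longrightarrow> [w,[w',v]\<^sub>L]\<^sub>L = - (angle \<mu> w * angle \<mu> w') *\<^sub>R v"
      using restricted_root_vector(2)[OF f] by blast
    have "v \<in> restricted_space ?l" using v(1) v(3)[OF X X] by (simp add: restricted_space_def)
    then have vw: "v \<in> weight_space (\<lambda>j. \<bar>?l j\<bar>)"
      using restricted_subset_weight[OF restricted_root_vector(3)[OF f]] by blast
    have minus_i: "\<mu> ((- \<i>) *\<^sub>C cplx_of (X j)) = of_real (?l j)" if "j \<in> {1..r}" for j
    proof -
      have "\<mu> ((- \<i>) *\<^sub>C cplx_of (X j)) = - \<i> * \<mu> (cplx_of (X j))"
        by (rule cplx_dual_scale[OF fd cplx_of_mem[OF subspace_span X[OF that]]])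
      also have "\<dots> = - \<i> * (\<i> * of_real (?l j))" by (rule arg_cong[OF val[OF that]])
      finally show ?thesis by simp
    qed
    obtain j0 where j0: "j0 \<in> {1..r}" "?l j0 > 0" and first: "\<And>i. i \<in> {1..<j0} \<Longrightarrow> ?l i = 0"
    proof -
      obtain j0 where j0: "j0 \<in> {1..r}" "Re (\<mu> ((-\<i>) *\<^sub>C cplx_of (X j0))) > 0"
        "\<forall>i\<in>{1..<j0}. \<mu> ((-\<i>) *\<^sub>C cplx_of (X i)) = 0" using lex by (auto simp: lex_positive_def)
      have "?l i = 0" if "i \<in> {1..<j0}" for i using j0 that minus_i[of i] by auto
      then show ?thesis using that j0 minus_i[OF j0(1)] by simp
    qed
    consider j where "short_weight (\<lambda>j. \<bar>?l j\<bar>) j" | j where "long_weight (\<lambda>j. \<bar>?l j\<bar>) j"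
      | p q where "pair_weight (\<lambda>j. \<bar>?l j\<bar>) p q"
      using weight_classification[OF vw v(2)] by blast
    then show ?thesis
    proof cases
      case 1
      then have j: "j \<in> {1..r}" "\<bar>?l j\<bar> = 1/2" and other: "\<And>i. i \<in> {1..r} \<Longrightarrow> i \<noteq> j \<Longrightarrow> ?l i = 0"
        by (auto simp: short_weight_def)
      then have "j0 = j" using j0 by force
      then have lj: "?l j = 1/2" using j j0 by simp
      have "\<mu> = (\<i>/2) *\<^sub>F \<epsilon> j"
      proof (rule eqI)
        show "(\<i>/2) *\<^sub>F \<epsilon> j \<in> cplx_dual \<aa>" by (intro fun_scale_cplx_dual \<epsilon>(1) j)
        show "((\<i>/2) *\<^sub>F \<epsilon> j) (cplx_of (X i)) = \<i> * of_real (?l i)" if "i \<in> {1..r}" for i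
        proof -
          have "?l i = (if i = j then 1/2 else 0)" using lj other that by simp
          then show ?thesis unfolding fun_scale_def \<epsilon>(2)[OF j(1) that] by simp
        qed
      qed
      then show ?thesis using j(1) unfolding R_def by blast
    next
      case 2
      then have j: "j \<in> {1..r}" "\<bar>?l j\<bar> = 1" and other: "\<And>i. i \<in> {1..r} \<Longrightarrow> i \<noteq> j \<Longrightarrow> ?l i = 0"
        by (auto simp: long_weight_def)
      then have "j0 = j" using j0 by force
      then have lj: "?l j = 1" using j j0 by simp
      have "\<mu> = \<i> *\<^sub>F \<epsilon> j"
      proof (rule eqI)
        show "\<i> *\<^sub>F \<epsilon> j \<in> cplx_dual \<aa>" by (intro fun_scale_cplx_dual \<epsilon>(1) j)
        show "(\<i> *\<^sub>F \<epsilon> j) (cplx_of (X i)) = \<i> * of_real (?l i)" if "i \<in> {1..r}" for i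
          unfolding fun_scale_def \<epsilon>(2)[OF j(1) that] using lj other that by (cases "i = j") auto
      qed
      then show ?thesis using j(1) unfolding R_def by blast
    next
      case 3
      then have pq: "1 \<le> p" "p < q" "q \<le> r" "p \<in> {1..r}" "q \<in> {1..r}" "\<bar>?l p\<bar> = 1/2" "\<bar>?l q\<bar> = 1/2"
        and other: "\<And>i. i \<in> {1..r} \<Longrightarrow> i \<noteq> p \<Longrightarrow> i \<noteq> q \<Longrightarrow> ?l i = 0"
        by (auto simp: pair_weight_def)
      \<comment> \<open>The first nonzero coordinate has index \<open>p\<close> and is positive; the
        sign of the one at \<open>q\<close> stays free, which accounts for both
        \<open>\<epsilon> p + \<epsilon> q\<close> and
        \<open>\<epsilon> p - \<epsilon> q\<close>.\<close>
      have "j0 \<noteq> q" using first[of p] pq by force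
      then have "j0 = p" using other[OF j0(1)] j0(2) by force
      then have lp: "?l p = 1/2" using pq j0 by simp
      have "?l q = 1/2 \<or> ?l q = - (1/2)" using pq(7) by linarith
      then have "\<mu> = (\<i>/2) *\<^sub>F (\<epsilon> p + \<epsilon> q) \<or> \<mu> = (\<i>/2) *\<^sub>F (\<epsilon> p - \<epsilon> q)"
      proof
        assume lq: "?l q = 1/2"
        have "\<mu> = (\<i>/2) *\<^sub>F (\<epsilon> p + \<epsilon> q)"
        proof (rule eqI)
          show "(\<i>/2) *\<^sub>F (\<epsilon> p + \<epsilon> q) \<in> cplx_dual \<aa>"
            by (intro fun_scale_cplx_dual add_cplx_dual \<epsilon>(1) pq)
          show "((\<i>/2) *\<^sub>F (\<epsilon> p + \<epsilon> q)) (cplx_of (X i)) = \<i> * of_real (?l i)" if "i \<in> {1..r}" for i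
          proof -
            have "?l i = (if i = p then 1/2 else if i = q then 1/2 else 0)"
              using lp lq other that by simp
            then show ?thesis
              unfolding fun_scale_def plus_fun_apply \<epsilon>(2)[OF pq(4) that] \<epsilon>(2)[OF pq(5) that]
              using pq(2) by simp
          qed
        qed
        then show ?thesis by blast
      next
        assume lq: "?l q = - (1/2)"
        have "\<mu> = (\<i>/2) *\<^sub>F (\<epsilon> p - \<epsilon> q)"
        proof (rule eqI)
          show "(\<i>/2) *\<^sub>F (\<epsilon> p - \<epsilon> q) \<in> cplx_dual \<aa>"
            by (intro fun_scale_cplx_dual diff_cplx_dual \<epsilon>(1) pq)
          show "((\<i>/2) *\<^sub>F (\<epsilon> p - \<epsilon> q)) (cplx_of (X i)) = \<i> * of_real (?l i)" if "i \<in> {1..r}" for i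
          proof -
            have "?l i = (if i = p then 1/2 else if i = q then - (1/2) else 0)"
              using lp lq other that by simp
            then show ?thesis
              unfolding fun_scale_def minus_apply \<epsilon>(2)[OF pq(4) that] \<epsilon>(2)[OF pq(5) that]
              using pq(2) by simp
          qed
        qed
        then show ?thesis by blast
      qed
      then show ?thesis using pq(1-3) unfolding R_def by blast
    qed
  qed
  then obtain g where g: "R g" by blast
  have "R (rho_m r \<epsilon> \<epsilon>' \<mu>)"
    unfolding rho_m_def R_def[symmetric]
  proof (rule theI[of R, OF g])
    show "g' = g" if "R g'" for g' using R_value[OF that] R_value[OF g] by (intro t'_functional_eqI) auto
  qed
  from R_value[OF this] show "rho_m r \<epsilon> \<epsilon>' \<mu> \<in> cplx_dual t'"
    and "\<And>j. j \<in> {1..r} \<Longrightarrow> rho_m r \<epsilon> \<epsilon>' \<mu> (cplx_of (T j)) = \<i> * of_real \<bar>angle \<mu> (X j)\<bar>" by auto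
qed

section \<open>Translation of the claims into weight spaces\<close>

lemma m_space_plus_J_m_space:
  assumes \<mu>: "\<mu> \<in> restricted_positive_roots \<aa> r X"
  shows "{x + J y | x y. x \<in> m_space m \<aa> \<mu> \<and> y \<in> m_space m \<aa> \<mu>} = weight_space (\<lambda>j. \<bar>angle \<mu> (X j)\<bar>)"
proof -
  have f: "\<mu> \<in> roots \<aa>" using \<mu> by (auto simp: restricted_positive_roots_def)
  show ?thesis
    unfolding m_space_eq_restricted_space[OF f]
    by (rule restricted_plus_J_restricted[OF restricted_root_vector(3)[OF f]])
qed

lemma restriction_eq_rho_m_iff:
  assumes \<mu>: "\<mu> \<in> restricted_positive_roots \<aa> r X" and \<alpha>: "\<alpha> \<in> positive_roots_m k t l \<alpha>\<^sub>s"
  shows "restrict_functional t' \<alpha> = rho_m r \<epsilon> \<epsilon>' \<mu> \<longleftrightarrow>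
    (\<forall>j\<in>{1..r}. angle \<alpha> (T j) = \<bar>angle \<mu> (X j)\<bar>)"
proof
  assume e: "restrict_functional t' \<alpha> = rho_m r \<epsilon> \<epsilon>' \<mu>"
  have "\<i> * of_real (angle \<alpha> (T j)) = \<i> * of_real \<bar>angle \<mu> (X j)\<bar>" if "j \<in> {1..r}" for j
    using restriction_T[OF \<alpha> that] rho_m_value(2)[OF \<mu> that] e by simp
  then show "\<forall>j\<in>{1..r}. angle \<alpha> (T j) = \<bar>angle \<mu> (X j)\<bar>" by (simp add: complex_eq_iff)
next
  assume "\<forall>j\<in>{1..r}. angle \<alpha> (T j) = \<bar>angle \<mu> (X j)\<bar>"
  then show "restrict_functional t' \<alpha> = rho_m r \<epsilon> \<epsilon>' \<mu>"
    using rho_m_value[OF \<mu>] restriction_T[OF \<alpha>]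
    by (intro t'_functional_eqI restriction_cplx_dual[OF \<alpha>]) auto
qed

text \<open>At a generator \<open>T j\<close> both sides multiply \<open>x\<close> by minus its
  weight: on the left because \<open>J\<close> squares to -1, on the right as i times i times the
  weight. Linearity in \<open>S\<close> does the rest.\<close>

lemma J_ad_T_on_weight_space:
  assumes \<mu>: "\<mu> \<in> restricted_positive_roots \<aa> r X" and S: "S \<in> t'"
    and x: "x \<in> weight_space (\<lambda>j. \<bar>angle \<mu> (X j)\<bar>)"
  shows "cplx_of (J [S,x]\<^sub>L) = (\<i> * rho_m r \<epsilon> \<epsilon>' \<mu> (cplx_of S)) *\<^sub>C cplx_of x"
proof -
  let ?g = "rho_m r \<epsilon> \<epsilon>' \<mu>"
  note g = rho_m_value(1)[OF \<mu>]
  have "S \<in> t' \<and> cplx_of (J [S,x]\<^sub>L) = (\<i> * ?g (cplx_of S)) *\<^sub>C cplx_of x"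
    using S
  proof (induction rule: span_induct_alt)
    case base
    show ?case
      using cplx_dual_cplx_of(2)[OF subspace_span g span_zero, of 0] span_zero
      by (simp add: cplx_scale_def cplx_of_def)
  next
    case (step c w u)
    then obtain j where j: "j \<in> {1..r}" "w = T j" by blast
    have w: "w \<in> t'" using step(1) by (rule span_base)
    have xm: "x \<in> m" using x by (simp add: weight_space_def)
    have "J [w,x]\<^sub>L = - \<bar>angle \<mu> (X j)\<bar> *\<^sub>R x" using x j Z_Z[OF xm] by (simp add: weight_space_def)
    moreover have "?g (cplx_of (c *\<^sub>R w + u)) = of_real c * (\<i> * of_real \<bar>angle \<mu> (X j)\<bar>) + ?g (cplx_of u)"
      using cplx_dual_cplx_of(1)[OF subspace_span g span_scale[OF w]] step(2)
        cplx_dual_cplx_of(2)[OF subspace_span g w] rho_m_value(2)[OF \<mu> j(1)] j(2) by simp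
    ultimately show ?case
      using step(2) w by (auto simp: span_add span_scale cplx_scale_def cplx_of_def algebra_simps)
  qed
  then show ?thesis ..
qed

end

theorem corollary4p7p2:
  fixes k m t \<aa> t' :: "'g::lie_algebra set"
    and l r :: nat
    and \<alpha>\<^sub>s \<beta> \<epsilon> \<epsilon>' :: "nat \<Rightarrow> 'g functional"
    and H E :: "'g functional \<Rightarrow> 'g \<times> 'g"
    and Z\<^sub>0 :: 'g
    and X T :: "nat \<Rightarrow> 'g"
    and I :: "'g \<Rightarrow> 'g"
    and \<rho> \<rho>\<^sub>m :: "'g functional \<Rightarrow> 'g functional"
    and \<Delta>\<^sub>m\<^sub>p \<Sigma>\<^sub>p :: "'g functional set"
    and mI :: "'g functional \<Rightarrow> 'g set"
  assumes compact_simple: "compact_simple_lie_algebra TYPE('g)"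
    and decomposition: "hermitian_symmetric_decomposition k m"
    and cartan: "cartan_subalgebra k t"
    and simple_roots: "hermitian_simple_roots k t l \<alpha>\<^sub>s"
    and root_vectors: "root_vectors t (positive_roots t l \<alpha>\<^sub>s) H E"
    and Z0: "Z\<^sub>0 \<in> lie_center k" "\<alpha>\<^sub>s 1 (cplx_of Z\<^sub>0) = \<i>"
    and I: "I = (\<lambda>x. [Z\<^sub>0,x]\<^sub>L)"
    and \<Delta>: "\<Delta>\<^sub>m\<^sub>p = positive_roots_m k t l \<alpha>\<^sub>s"
    and rank: "r = symmetric_rank m"
    and \<beta>: "\<forall>j\<in>{1..r}. \<beta> j \<in> \<Delta>\<^sub>m\<^sub>p" "strongly_orthogonal t r \<beta>"
    and X: "X = (\<lambda>j. vec_X E (\<beta> j))"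
    and T: "T = (\<lambda>j. vec_T H (\<beta> j))"
    and \<aa>: "\<aa> = span (X ` {1..r})"
    and t': "t' = span (T ` {1..r})"
    and \<epsilon>: "\<epsilon> = dual_basis \<aa> r X"
    and \<epsilon>': "\<epsilon>' = dual_basis t' r T"
    and \<Sigma>: "\<Sigma>\<^sub>p = restricted_positive_roots \<aa> r X"
    and \<rho>: "\<rho> = restrict_functional t'"
    and \<rho>\<^sub>m: "\<rho>\<^sub>m = rho_m r \<epsilon> \<epsilon>'"
    and mI: "\<And>\<mu>. mI \<mu> = {x + I y | x y. x \<in> m_space m \<aa> \<mu> \<and> y \<in> m_space m \<aa> \<mu>}"
  shows "(\<forall>j\<in>{1..r}. \<rho> (\<beta> j) = \<i> *\<^sub>F \<epsilon>' j) \<and>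
    \<rho> ` \<Delta>\<^sub>m\<^sub>p \<subseteq>
      {(\<i>/2) *\<^sub>F \<epsilon>' j | j. j \<in> {1..r}} \<union> {\<i> *\<^sub>F \<epsilon>' j | j. j \<in> {1..r}} \<union>
      {(\<i>/2) *\<^sub>F (\<epsilon>' p + \<epsilon>' q) | p q. 1 \<le> p \<and> p < q \<and> q \<le> r} \<and>
    (\<forall>\<mu>\<in>\<Sigma>\<^sub>p. mI \<mu> = span (\<Union>\<alpha>\<in>{\<alpha>\<in>\<Delta>\<^sub>m\<^sub>p. \<rho> \<alpha> = \<rho>\<^sub>m \<mu>}. {vec_X E \<alpha>, vec_Y E \<alpha>})) \<and>
    (\<forall>\<mu>\<in>\<Sigma>\<^sub>p. \<forall>S\<in>t'. \<forall>x\<in>mI \<mu>.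
       cplx_of (I [S,x]\<^sub>L) = (\<i> * \<rho>\<^sub>m \<mu> (cplx_of S)) *\<^sub>C cplx_of x)"
proof (cases "1 \<le> l")
  \<comment> \<open>Without simple roots every root would be an empty sum, hence zero, so there are
    none. Then \<open>r = 0\<close>, no restricted root is lexicographically positive, and all
    claims are vacuous.\<close>
  case False
  then have "roots t = {}"
    using simple_roots
    by (auto simp: hermitian_simple_roots_def simple_root_system_def roots_def)
  then have \<Delta>0: "\<Delta>\<^sub>m\<^sub>p = {}" by (auto simp: \<Delta> positive_roots_m_def roots_m_def)
  then have "{1..r} = {}" using \<beta>(1) by auto
  then have "\<Sigma>\<^sub>p = {}" by (auto simp: \<Sigma> restricted_positive_roots_def lex_positive_def)
  then show ?thesis using \<Delta>0 \<open>{1..r} = {}\<close> by auto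
next
  case True
  interpret F: strongly_orthogonal_frame k m t l \<alpha>\<^sub>s H E Z\<^sub>0 r \<beta>
    by unfold_locales
      (use compact_simple decomposition cartan simple_roots root_vectors Z0 True rank \<beta> \<Delta> in auto)
  have \<aa>_eq: "\<aa> = F.\<aa>" by (simp only: \<aa> X)
  have t'_eq: "t' = F.t'"
    unfolding t' T by (rule arg_cong[of _ _ span]) (auto simp: F.vec_T_eq image_iff)
  have \<epsilon>_eq: "\<epsilon> = F.\<epsilon>" by (simp only: \<epsilon> \<aa>_eq X)
  \<comment> \<open>The given \<open>T j\<close>, defined through \<open>H\<close>, and the bracket
    \<open>[X j,J (X j)]\<close> are known to agree only for \<open>j\<close> in
    \<open>{1..r}\<close>; the description in \<open>dual_basis\<close> looks at no other
    index.\<close>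
  have \<epsilon>'_eq: "\<epsilon>' = F.\<epsilon>'"
  proof
    fix j
    have "(\<forall>i\<in>{1..r}. f (cplx_of (T i)) = (if i = j then 1 else 0))
        = (\<forall>i\<in>{1..r}. f (cplx_of (F.T i)) = (if i = j then 1 else 0))" for f :: "'g functional"
      using F.vec_T_eq by (simp add: T)
    then show "\<epsilon>' j = F.\<epsilon>' j" unfolding \<epsilon>' dual_basis_def t'_eq by simp
  qed
  have \<rho>_eq: "\<rho> = restrict_functional F.t'" by (simp only: \<rho> t'_eq)
  have \<rho>\<^sub>m_eq: "\<rho>\<^sub>m = rho_m r F.\<epsilon> F.\<epsilon>'" by (simp only: \<rho>\<^sub>m \<epsilon>_eq \<epsilon>'_eq)
  have \<Sigma>_eq: "\<Sigma>\<^sub>p = restricted_positive_roots F.\<aa> r F.X" by (simp only: \<Sigma> \<aa>_eq X)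
  have mI_eq: "mI \<mu> = F.weight_space (\<lambda>j. \<bar>F.angle \<mu> (F.X j)\<bar>)" if "\<mu> \<in> \<Sigma>\<^sub>p" for \<mu>
    using F.m_space_plus_J_m_space that unfolding mI I \<aa>_eq \<Sigma>_eq by blast
  have "\<rho> (\<beta> j) = \<i> *\<^sub>F \<epsilon>' j" if "j \<in> {1..r}" for j
    unfolding \<rho>_eq \<epsilon>'_eq by (rule F.restriction_\<beta>[OF that])
  moreover have "\<rho> \<alpha> \<in> {(\<i>/2) *\<^sub>F \<epsilon>' j | j. j \<in> {1..r}} \<union> {\<i> *\<^sub>F \<epsilon>' j | j. j \<in> {1..r}} \<union>
      {(\<i>/2) *\<^sub>F (\<epsilon>' p + \<epsilon>' q) | p q. 1 \<le> p \<and> p < q \<and> q \<le> r}" if "\<alpha> \<in> \<Delta>\<^sub>m\<^sub>p" for \<alpha>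
    using that unfolding \<rho>_eq \<epsilon>'_eq \<Delta> by (rule F.restriction_types)
  moreover have "mI \<mu> = span (\<Union>\<alpha>\<in>{\<alpha>\<in>\<Delta>\<^sub>m\<^sub>p. \<rho> \<alpha> = \<rho>\<^sub>m \<mu>}. {vec_X E \<alpha>, vec_Y E \<alpha>})"
    if \<mu>: "\<mu> \<in> \<Sigma>\<^sub>p" for \<mu>
  proof -
    have "{\<alpha>\<in>\<Delta>\<^sub>m\<^sub>p. \<rho> \<alpha> = \<rho>\<^sub>m \<mu>} =
        {\<alpha>\<in>\<Delta>\<^sub>m\<^sub>p. \<forall>j\<in>{1..r}. F.angle \<alpha> (F.T j) = \<bar>F.angle \<mu> (F.X j)\<bar>}"
      using F.restriction_eq_rho_m_iff \<mu> unfolding \<rho>_eq \<rho>\<^sub>m_eq \<Sigma>_eq \<Delta> by blast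
    then show ?thesis unfolding mI_eq[OF \<mu>] F.weight_space_eq_span \<Delta> by simp
  qed
  moreover have "cplx_of (I [S,x]\<^sub>L) = (\<i> * \<rho>\<^sub>m \<mu> (cplx_of S)) *\<^sub>C cplx_of x"
    if "\<mu> \<in> \<Sigma>\<^sub>p" "S \<in> t'" "x \<in> mI \<mu>" for \<mu> S x
    using F.J_ad_T_on_weight_space[of \<mu> S x] that
    unfolding \<rho>\<^sub>m_eq I mI_eq[OF that(1)] \<Sigma>_eq t'_eq by blast
  ultimately show ?thesis by blast
qed

end
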